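(* Let $H$ be a coalgebra and $n\ge0$. There are exact sequences of complexes $$0\to W_n(H)_\natural\xrightarrow{N}W^b_n(H)\xrightarrow{t-1}W_n(H)\to W_n(H)_\natural\to0,$$ $$0\to I_n(H)_\natural\xrightarrow{N}I^b_n(H)\xrightarrow{t-1}I_n(H)\to I_n(H)_\natural\to0,$$ where the last non-zero maps are the canonical projections.
   Context: $H$ is a coalgebra over $\mathbb{C}$ with $\Delta(h)=\sum h_0\otimes h_1$. $W(H)$ is the non-commutative, non-unital DG algebra freely generated by symbols $h$ of degree 1 and $\omega_h$ of degree 2, linear in $h\in H$, with differential the graded derivation $\partial$: $\partial(h)=\omega_h-\sum h_0h_1$, $\partial(\omega_h)=\sum\omega_{h_0}h_1-\sum h_0\omega_{h_1}$. $\partial_0$ is the derivation with $\partial_0(h)=-\sum h_0h_1$, $\partial_0(\omega_h)=\partial(\omega_h)$. $I(H)$ is the ideal generated by the $\omega_h$; $I_n(H)=I(H)^{n+1}$ ($I(H)^0$ meaning $W(H)$ with unit adjoined), $W_n(H)=W(H)/I(H)^{n+1}$, both with differential $\partial$. With graded commutators, $W_n(H)_\natural=W_n(H)/[W_n(H),W_n(H)]$, $I_n(H)_\natural=I_n(H)/[I(H),I_{n-1}(H)]$. For a generator $a$ (of the form $h$ or $\omega_h$): $t(ax)=(-1)^{|a||x|}xa$, $b_t(ax)=t(\partial_0(a)x)$, $b=\partial+b_t$. On products of $p$ generators $t^p=1$ and $N=1+t+\cdots+t^{p-1}$. The operators $t,N,b$ preserve the powers of $I(H)$; $W_n^b(H)$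 and $I_n^b(H)$ denote $W_n(H)$ and $I_n(H)$ equipped with the differential $b$ instead of $\partial$. *)

theory Defs
  imports Complex_Main "HOL-Library.Poly_Mapping" "HOL-Algebra.Module" "HOL-Algebra.QuotRing"
begin

section \<open>Complex vector spaces\<close>

class complex_vector = ab_group_add +
  fixes scaleC :: "complex \<Rightarrow> 'a \<Rightarrow> 'a"  (infixr \<open>*\<^sub>C\<close> 75)
  assumes scaleC_add_right: "c *\<^sub>C (x + y) = c *\<^sub>C x + c *\<^sub>C y"
    and scaleC_add_left: "(c + d) *\<^sub>C x = c *\<^sub>C x + d *\<^sub>C x"
    and scaleC_scaleC: "c *\<^sub>C d *\<^sub>C x = (c * d) *\<^sub>C x"
    and scaleC_one: "1 *\<^sub>C x = x"

interpretation cvec: vector_space "scaleC :: complex \<Rightarrow> 'a \<Rightarrow> 'a::complex_vector"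
  by standard (simp_all add: scaleC_add_right scaleC_add_left scaleC_scaleC scaleC_one)

abbreviation cspan :: "'a::complex_vector set \<Rightarrow> 'a set"
  where "cspan \<equiv> Modules.module.span scaleC"

abbreviation clinear :: "('a::complex_vector \<Rightarrow> 'b::complex_vector) \<Rightarrow> bool"
  where "clinear \<equiv> Vector_Spaces.linear scaleC scaleC"

lemma clinear_iff:
  "clinear f \<longleftrightarrow> (\<forall>x y. f (x + y) = f x + f y) \<and> (\<forall>c x. f (c *\<^sub>C x) = c *\<^sub>C f x)"
  by (simp add: Vector_Spaces.linear_iff cvec.vector_space_axioms)

instantiation complex :: complex_vector
begin
definition scaleC_complex :: "complex \<Rightarrow> complex \<Rightarrow> complex"
  where [simp]: "scaleC_complex c x = c * x"
instance by standard (simp_all add: algebra_simps)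
end

instantiation poly_mapping :: (type, complex_vector) complex_vector
begin
lift_definition scaleC_poly_mapping :: "complex \<Rightarrow> ('a \<Rightarrow>\<^sub>0 'b) \<Rightarrow> ('a \<Rightarrow>\<^sub>0 'b)"
  is "\<lambda>c f k. c *\<^sub>C f k"
proof -
  fix c :: complex and f :: "'a \<Rightarrow> 'b"
  assume "finite {k. f k \<noteq> 0}"
  moreover have "{k. c *\<^sub>C f k \<noteq> 0} \<subseteq> {k. f k \<noteq> 0}" by auto
  ultimately show "finite {k. c *\<^sub>C f k \<noteq> 0}" by (rule rev_finite_subset)
qed
instance
  by standard (transfer; simp add: fun_eq_iff cvec.scale_right_distrib cvec.scale_left_distrib)+
end

definition free_ext :: "('k \<Rightarrow> 'v::complex_vector) \<Rightarrow> ('k \<Rightarrow>\<^sub>0 complex) \<Rightarrow> 'v"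
  where "free_ext f x = (\<Sum>k\<in>Poly_Mapping.keys x. Poly_Mapping.lookup x k *\<^sub>C f k)"

lemma free_ext_superset:
  assumes "finite K" "Poly_Mapping.keys x \<subseteq> K"
  shows "free_ext f x = (\<Sum>k\<in>K. Poly_Mapping.lookup x k *\<^sub>C f k)"
  unfolding free_ext_def using assms by (intro sum.mono_neutral_left) (auto simp: in_keys_iff)

lemma free_ext_add: "free_ext f (x + y) = free_ext f x + free_ext f y"
proof -
  let ?K = "Poly_Mapping.keys x \<union> Poly_Mapping.keys y"
  have "Poly_Mapping.keys (x + y) \<subseteq> ?K" by (rule keys_add)
  then show ?thesis
    by (simp add: free_ext_superset[of ?K] lookup_add cvec.scale_left_distrib sum.distrib)
qed

lemma free_ext_scale: "free_ext f (c *\<^sub>C x) = c *\<^sub>C free_ext f x"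
proof -
  have "Poly_Mapping.keys (c *\<^sub>C x) \<subseteq> Poly_Mapping.keys x"
    by (auto simp: in_keys_iff scaleC_poly_mapping.rep_eq)
  then show ?thesis
    by (simp add: free_ext_superset[of "Poly_Mapping.keys x"] scaleC_poly_mapping.rep_eq
        cvec.scale_sum_right)
qed

lemma free_ext_linear: "clinear (free_ext f)"
  by unfold_locales (simp_all add: free_ext_add free_ext_scale)

lemma free_ext_diff: "free_ext f (x - y) = free_ext f x - free_ext f y"
  using free_ext_add[of f "x - y" y] by simp

lemma free_ext_single [simp]: "free_ext f (Poly_Mapping.single k c) = c *\<^sub>C f k"
  by (simp add: free_ext_def)

lemma free_ext_zero [simp]: "free_ext f 0 = 0"
  by (simp add: free_ext_def)

lemma free_ext_eq_modulo:
  assumes "\<And>r. r \<in> R \<Longrightarrow> free_ext f r = 0" and "p - q \<in> cspan R"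
  shows "free_ext f p = free_ext f q"
proof -
  have "free_ext f (p - q) = 0"
    using assms(2)
    by (induct rule: cvec.span_induct_alt)
      (simp_all add: free_ext_add free_ext_scale assms(1))
  then show ?thesis by (simp add: free_ext_diff)
qed

section \<open>Tensor products and coalgebras\<close>

text \<open>The tensor product is the free vector space on pairs modulo the bilinearity relations.\<close>

definition tensor_relations :: "('a::complex_vector \<times> 'b::complex_vector \<Rightarrow>\<^sub>0 complex) set"
  where "tensor_relations =
    {Poly_Mapping.single (x + x', y) 1 - Poly_Mapping.single (x, y) 1 - Poly_Mapping.single (x', y) 1
       | x x' y. True} \<union>
    {Poly_Mapping.single (x, y + y') 1 - Poly_Mapping.single (x, y) 1 - Poly_Mapping.single (x, y') 1
       | x y y'. True} \<union>
    {Poly_Mapping.single (c *\<^sub>C x, y) 1 - c *\<^sub>C Poly_Mapping.single (x, y) 1 | c x y. True} \<union>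
    {Poly_Mapping.single (x, c *\<^sub>C y) 1 - c *\<^sub>C Poly_Mapping.single (x, y) 1 | c x y. True}"

definition tensor_rel ::
    "('a::complex_vector \<times> 'b::complex_vector \<Rightarrow>\<^sub>0 complex) \<Rightarrow> ('a \<times> 'b \<Rightarrow>\<^sub>0 complex) \<Rightarrow> bool"
  where "tensor_rel p q \<longleftrightarrow> p - q \<in> cspan tensor_relations"

lemma span_equivp: "equivp (\<lambda>p q. p - q \<in> cspan (R :: 'a::complex_vector set))"
proof (rule equivpI)
  show "reflp (\<lambda>p q. p - q \<in> cspan R)" by (simp add: reflp_def cvec.span_zero)
  show "symp (\<lambda>p q. p - q \<in> cspan R)"
    unfolding symp_def by (metis cvec.span_neg minus_diff_eq)
  show "transp (\<lambda>p q. p - q \<in> cspan R)"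
    unfolding transp_def by (metis cvec.span_add diff_add_cancel add_diff_eq)
qed

quotient_type (overloaded) ('a, 'b) tensor =
  "'a::complex_vector \<times> 'b::complex_vector \<Rightarrow>\<^sub>0 complex" / tensor_rel
  unfolding tensor_rel_def[abs_def] by (rule span_equivp)

lemma span_diff_add: "p - q \<in> cspan R \<Longrightarrow> p' - q' \<in> cspan R \<Longrightarrow> (p + p') - (q + q') \<in> cspan R"
  by (metis add_diff_add cvec.span_add)

lemma span_diff_minus: "p - q \<in> cspan R \<Longrightarrow> p' - q' \<in> cspan R \<Longrightarrow> (p - p') - (q - q') \<in> cspan R"
  using cvec.span_diff[of "p - q" R "p' - q'"] by (simp add: algebra_simps)

lemma span_diff_uminus: "p - q \<in> cspan R \<Longrightarrow> - p - (- q) \<in> cspan R"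
  using cvec.span_neg[of "p - q" R] by simp

lemma span_diff_scale: "p - q \<in> cspan R \<Longrightarrow> c *\<^sub>C p - c *\<^sub>C q \<in> cspan R"
  using cvec.span_scale[of "p - q" R c] by (simp add: cvec.scale_right_diff_distrib)

instantiation tensor :: (complex_vector, complex_vector) complex_vector
begin
lift_definition zero_tensor :: "('a, 'b) tensor" is 0 .
lift_definition plus_tensor :: "('a, 'b) tensor \<Rightarrow> ('a, 'b) tensor \<Rightarrow> ('a, 'b) tensor" is "(+)"
  unfolding tensor_rel_def by (rule span_diff_add)
lift_definition minus_tensor :: "('a, 'b) tensor \<Rightarrow> ('a, 'b) tensor \<Rightarrow> ('a, 'b) tensor" is "(-)"
  unfolding tensor_rel_def by (rule span_diff_minus)
lift_definition uminus_tensor :: "('a, 'b) tensor \<Rightarrow> ('a, 'b) tensor" is uminus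
  unfolding tensor_rel_def by (rule span_diff_uminus)
lift_definition scaleC_tensor :: "complex \<Rightarrow> ('a, 'b) tensor \<Rightarrow> ('a, 'b) tensor" is scaleC
  unfolding tensor_rel_def by (rule span_diff_scale)
instance
  by standard (transfer; simp add: tensor_rel_def cvec.span_zero algebra_simps
      cvec.scale_right_distrib cvec.scale_left_distrib)+
end

lift_definition tens :: "'a::complex_vector \<Rightarrow> 'b::complex_vector \<Rightarrow> ('a, 'b) tensor"
  is "\<lambda>x y. Poly_Mapping.single (x, y) 1" .

text \<open>
  The linear map induced by \<open>f\<close>; it is computed on an arbitrarily chosen representative and hence
  is meaningful only for bilinear \<open>f\<close>, see \<open>tensor_lift_tens\<close> and \<open>tensor_lift_linear\<close> below.
\<close>

definition tensor_lift ::
    "('a::complex_vector \<Rightarrow> 'b::complex_vector \<Rightarrow> 'c::complex_vector) \<Rightarrow> ('a, 'b) tensor \<Rightarrow> 'c"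
  where "tensor_lift f z = free_ext (\<lambda>(x, y). f x y) (rep_tensor z)"

definition cbilinear ::
    "('a::complex_vector \<Rightarrow> 'b::complex_vector \<Rightarrow> 'c::complex_vector) \<Rightarrow> bool"
  where "cbilinear f \<longleftrightarrow> (\<forall>x. clinear (f x)) \<and> (\<forall>y. clinear (\<lambda>x. f x y))"

lemma tensor_lift_abs:
  assumes "cbilinear f"
  shows "tensor_lift f (abs_tensor p) = free_ext (\<lambda>(x, y). f x y) p"
proof -
  have "tensor_rel (rep_tensor (abs_tensor p)) p"
    by (metis Quotient3_abs_rep Quotient3_tensor tensor.abs_eq_iff)
  moreover have "free_ext (\<lambda>(x, y). f x y) r = 0" if "r \<in> tensor_relations" for r
    using that assms
    by (auto simp: tensor_relations_def free_ext_diff free_ext_scale cbilinear_def clinear_iff)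
  ultimately show ?thesis
    unfolding tensor_lift_def tensor_rel_def by (rule free_ext_eq_modulo[rotated])
qed

lemma tensor_lift_tens: "cbilinear f \<Longrightarrow> tensor_lift f (tens x y) = f x y"
  by (simp add: tens.abs_eq tensor_lift_abs)

lemma tens_bilinear: "cbilinear tens"
proof -
  have "tens (x + x') y = tens x y + tens x' y" "tens x (y + y') = tens x y + tens x y'"
    for x x' :: 'a and y y' :: 'b
    by (transfer, unfold tensor_rel_def, rule cvec.span_base,
        unfold tensor_relations_def, fastforce simp: diff_diff_eq)+
  moreover have "tens (c *\<^sub>C x) y = c *\<^sub>C tens x y" "tens x (c *\<^sub>C y) = c *\<^sub>C tens x y"
    for x :: 'a and y :: 'b and c
    by (transfer, unfold tensor_rel_def, rule cvec.span_base, unfold tensor_relations_def, blast)+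
  ultimately show ?thesis by (simp add: cbilinear_def clinear_iff)
qed

lemma tensor_lift_linear:
  fixes f :: "'a::complex_vector \<Rightarrow> 'b::complex_vector \<Rightarrow> 'c::complex_vector"
  assumes "cbilinear f"
  shows "clinear (tensor_lift f)"
proof unfold_locales
  fix u v :: "('a, 'b) tensor" and c :: complex
  obtain p q where pq: "u = abs_tensor p" "v = abs_tensor q"
    by (metis Quotient3_abs_rep Quotient3_tensor)
  show "tensor_lift f (u + v) = tensor_lift f u + tensor_lift f v"
    by (simp add: pq plus_tensor.abs_eq tensor_lift_abs assms free_ext_add)
  show "tensor_lift f (c *\<^sub>C u) = c *\<^sub>C tensor_lift f u"
    by (simp add: pq scaleC_tensor.abs_eq tensor_lift_abs assms free_ext_scale)
qed

definition tensor_map ::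
    "('a::complex_vector \<Rightarrow> 'c::complex_vector) \<Rightarrow> ('b::complex_vector \<Rightarrow> 'd::complex_vector)
      \<Rightarrow> ('a, 'b) tensor \<Rightarrow> ('c, 'd) tensor"
  where "tensor_map f g = tensor_lift (\<lambda>x y. tens (f x) (g y))"

definition tensor_assoc ::
    "(('a::complex_vector, 'b::complex_vector) tensor, 'c::complex_vector) tensor
      \<Rightarrow> ('a, ('b, 'c) tensor) tensor"
  where "tensor_assoc = tensor_lift (\<lambda>u z. tensor_lift (\<lambda>x y. tens x (tens y z)) u)"

locale coalgebra =
  fixes comult :: "'h::complex_vector \<Rightarrow> ('h, 'h) tensor" and counit :: "'h \<Rightarrow> complex"
  assumes comult_linear: "clinear comult"
    and counit_linear: "clinear counit"
    and coassoc: "tensor_assoc (tensor_map comult id (comult h)) = tensor_map id comult (comult h)"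
    and counit_left: "tensor_lift (\<lambda>x y. counit x *\<^sub>C y) (comult h) = h"
    and counit_right: "tensor_lift (\<lambda>x y. counit y *\<^sub>C x) (comult h) = h"

section \<open>The algebra \<open>W(H)\<close>\<close>

text \<open>
  \<open>Gen h\<close> is the symbol \<open>h\<close> of degree 1, \<open>Curv h\<close> the symbol \<open>\<omega>\<^sub>h\<close> of degree 2. The free associative
  unital algebra on the symbols is the monoid algebra of words.
\<close>

datatype 'h gen = Gen 'h | Curv 'h

primrec gdeg :: "'h gen \<Rightarrow> nat"
  where "gdeg (Gen h) = 1" | "gdeg (Curv h) = 2"

definition wdeg :: "'h gen list \<Rightarrow> nat"
  where "wdeg w = sum_list (map gdeg w)"

datatype 'g word = Word (letters: "'g list")

instantiation word :: (type) monoid_add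
begin
definition zero_word :: "'a word" where "0 = Word []"
definition plus_word :: "'a word \<Rightarrow> 'a word \<Rightarrow> 'a word"
  where "u + v = Word (letters u @ letters v)"
instance by standard (simp_all add: zero_word_def plus_word_def)
end

definition symb :: "'g \<Rightarrow> ('g word \<Rightarrow>\<^sub>0 complex)"
  where "symb a = Poly_Mapping.single (Word [a]) 1"

text \<open>The symbols become linear in \<open>h\<close> modulo the two-sided ideal spanned by \<open>weil_relations\<close>.\<close>

definition symbol_relations :: "('h::complex_vector gen word \<Rightarrow>\<^sub>0 complex) set"
  where "symbol_relations =
    (\<Union>K\<in>{Gen, Curv}.
      {symb (K (x + y)) - symb (K x) - symb (K y) | x y. True} \<union>
      {symb (K (c *\<^sub>C x)) - c *\<^sub>C symb (K x) | c x. True})"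

definition weil_relations :: "('h::complex_vector gen word \<Rightarrow>\<^sub>0 complex) set"
  where "weil_relations = {x * r * y | x r y. r \<in> symbol_relations}"

definition weil_rel ::
    "('h::complex_vector gen word \<Rightarrow>\<^sub>0 complex) \<Rightarrow> ('h gen word \<Rightarrow>\<^sub>0 complex) \<Rightarrow> bool"
  where "weil_rel p q \<longleftrightarrow> p - q \<in> cspan weil_relations"

quotient_type (overloaded) 'h weil = "'h::complex_vector gen word \<Rightarrow>\<^sub>0 complex" / weil_rel
  unfolding weil_rel_def[abs_def] by (rule span_equivp)

lemma scaleC_eq_single_mult:
  fixes x :: "'k::monoid_add \<Rightarrow>\<^sub>0 complex"
  shows "c *\<^sub>C x = Poly_Mapping.single 0 c * x" "c *\<^sub>C x = x * Poly_Mapping.single 0 c"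
proof -
  have "c *\<^sub>C x = Poly_Mapping.map ((*) c) x"
    by (rule poly_mapping_eqI) (simp add: scaleC_poly_mapping.rep_eq map.rep_eq when_def)
  then show "c *\<^sub>C x = Poly_Mapping.single 0 c * x"
    by (simp add: mult_map_scale_conv_mult)
  have *: "(\<Sum>q. Poly_Mapping.lookup (Poly_Mapping.single 0 c) q when k = l + q) = (c when l = k)" for k l :: 'k
  proof -
    have "(\<lambda>q. Poly_Mapping.lookup (Poly_Mapping.single 0 c) q when k = l + q) = (\<lambda>q. (c when l = k) when q = 0)"
      by (auto simp: fun_eq_iff when_def lookup_single)
    then show ?thesis by (simp only: Sum_any_when_equal)
  qed
  show "c *\<^sub>C x = x * Poly_Mapping.single 0 c"
    by (rule poly_mapping_eqI) (simp add: scaleC_poly_mapping.rep_eq lookup_mult * mult_when mult.commute)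
qed

lemma scaleC_mult_free:
  fixes x y :: "'k::monoid_add \<Rightarrow>\<^sub>0 complex"
  shows "(c *\<^sub>C x) * y = c *\<^sub>C (x * y)" "x * (c *\<^sub>C y) = c *\<^sub>C (x * y)"
  by (simp only: scaleC_eq_single_mult(1) mult.assoc, simp only: scaleC_eq_single_mult(2) mult.assoc)

lemma weil_relations_ideal:
  assumes "r \<in> cspan weil_relations"
  shows "x * r \<in> cspan weil_relations" "r * x \<in> cspan weil_relations"
proof -
  have *: "x * s \<in> weil_relations" "s * x \<in> weil_relations" if "s \<in> weil_relations" for s
  proof -
    from that obtain y q z where s: "s = y * q * z" "q \<in> symbol_relations"
      by (auto simp: weil_relations_def)
    then have "x * s = (x * y) * q * z" "s * x = y * q * (z * x)"
      by (simp_all only: mult.assoc)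
    with s(2) show "x * s \<in> weil_relations" "s * x \<in> weil_relations"
      unfolding weil_relations_def by blast+
  qed
  show "x * r \<in> cspan weil_relations"
    using assms by (induct rule: cvec.span_induct_alt)
      (simp_all add: cvec.span_zero distrib_left scaleC_mult_free cvec.span_add cvec.span_scale
        cvec.span_base *)
  show "r * x \<in> cspan weil_relations"
    using assms by (induct rule: cvec.span_induct_alt)
      (simp_all add: cvec.span_zero distrib_right scaleC_mult_free cvec.span_add cvec.span_scale
        cvec.span_base *)
qed

lemma lookup_mult_word_0:
  fixes p q :: "'g word \<Rightarrow>\<^sub>0 complex"
  shows "Poly_Mapping.lookup (p * q) 0 = Poly_Mapping.lookup p 0 * Poly_Mapping.lookup q 0"
proof -
  have "(\<lambda>m. Poly_Mapping.lookup q m when 0 = l + m) = (\<lambda>m. (Poly_Mapping.lookup q 0 when l = 0) when m = 0)" for l :: "'g word"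
    by (cases l) (auto simp: fun_eq_iff when_def zero_word_def plus_word_def word.expand)
  then show ?thesis by (simp only: lookup_mult mult_when Sum_any_when_equal)
qed

lemma one_notin_weil_relations:
  "1 \<notin> cspan (weil_relations :: ('h::complex_vector gen word \<Rightarrow>\<^sub>0 complex) set)"
proof
  have "Poly_Mapping.lookup (symb a) 0 = 0" for a :: "'h gen"
    by (simp add: symb_def lookup_single zero_word_def)
  then have *: "Poly_Mapping.lookup r 0 = 0"
    if "r \<in> weil_relations" for r :: "'h gen word \<Rightarrow>\<^sub>0 complex"
    using that
    by (auto simp: weil_relations_def symbol_relations_def lookup_mult_word_0 lookup_minus
        scaleC_poly_mapping.rep_eq)
  assume "1 \<in> cspan (weil_relations :: ('h gen word \<Rightarrow>\<^sub>0 complex) set)"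
  then have "Poly_Mapping.lookup (1 :: 'h gen word \<Rightarrow>\<^sub>0 complex) 0 = 0"
    by (induct rule: cvec.span_induct_alt) (simp_all add: lookup_add scaleC_poly_mapping.rep_eq *)
  then show False by simp
qed

lemma weil_rel_refl: "p = q \<Longrightarrow> weil_rel p q"
  by (simp add: weil_rel_def cvec.span_zero)

text \<open>
  The type \<open>weil\<close> is \<open>W(H)\<close> with a unit adjoined; \<open>W(H)\<close> itself is \<open>weil_plus\<close> below.
\<close>

instantiation weil :: (complex_vector) complex_vector
begin
lift_definition zero_weil :: "'a weil" is 0 .
lift_definition plus_weil :: "'a weil \<Rightarrow> 'a weil \<Rightarrow> 'a weil" is "(+)"
  unfolding weil_rel_def by (rule span_diff_add)
lift_definition minus_weil :: "'a weil \<Rightarrow> 'a weil \<Rightarrow> 'a weil" is "(-)"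
  unfolding weil_rel_def by (rule span_diff_minus)
lift_definition uminus_weil :: "'a weil \<Rightarrow> 'a weil" is uminus
  unfolding weil_rel_def by (rule span_diff_uminus)
lift_definition scaleC_weil :: "complex \<Rightarrow> 'a weil \<Rightarrow> 'a weil" is scaleC
  unfolding weil_rel_def by (rule span_diff_scale)
instance
  by standard (transfer; simp add: weil_rel_def cvec.span_zero algebra_simps
      cvec.scale_right_distrib cvec.scale_left_distrib)+
end

instantiation weil :: (complex_vector) ring_1
begin
lift_definition one_weil :: "'a weil" is 1 .
lift_definition times_weil :: "'a weil \<Rightarrow> 'a weil \<Rightarrow> 'a weil" is "(*)"
proof -
  fix p q p' q' :: "'a gen word \<Rightarrow>\<^sub>0 complex"
  assume "weil_rel p q" "weil_rel p' q'"
  then have "p * (p' - q') + (p - q) * q' \<in> cspan weil_relations"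
    unfolding weil_rel_def by (intro cvec.span_add weil_relations_ideal)
  then show "weil_rel (p * p') (q * q')"
    by (simp add: weil_rel_def algebra_simps)
qed
instance
proof
  fix a b c :: "'a weil"
  show "a * b * c = a * (b * c)"
    by transfer (rule weil_rel_refl, rule mult.assoc)
  show "1 * a = a" "a * 1 = a"
    by (transfer, rule weil_rel_refl, simp)+
  show "(a + b) * c = a * c + b * c"
    by transfer (rule weil_rel_refl, rule distrib_right)
  show "a * (b + c) = a * b + a * c"
    by transfer (rule weil_rel_refl, rule distrib_left)
  show "(0 :: 'a weil) \<noteq> 1"
    by transfer (metis weil_rel_def one_notin_weil_relations cvec.span_neg diff_0 minus_minus)
qed
end

lift_definition gen :: "'h::complex_vector gen \<Rightarrow> 'h weil" is symb .

definition monom :: "'h::complex_vector gen list \<Rightarrow> 'h weil"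
  where "monom w = prod_list (map gen w)"

text \<open>
  The linear extension of a map \<open>f\<close> given on products of generators. As for tensors it is computed
  on an arbitrary representative and is meaningful only for letterwise linear \<open>f\<close>, see
  \<open>weil_ext_monom\<close> and \<open>weil_ext_linear\<close>.
\<close>

definition weil_ext :: "('h::complex_vector gen list \<Rightarrow> 'v::complex_vector) \<Rightarrow> 'h weil \<Rightarrow> 'v"
  where "weil_ext f x = free_ext (\<lambda>w. f (letters w)) (rep_weil x)"

definition letterwise_linear ::
    "('h::complex_vector gen list \<Rightarrow> 'v::complex_vector) \<Rightarrow> bool"
  where "letterwise_linear f \<longleftrightarrow>
    (\<forall>u v. clinear (\<lambda>h. f (u @ Gen h # v)) \<and> clinear (\<lambda>h. f (u @ Curv h # v)))"

lemma free_expand: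
  "(x :: 'k \<Rightarrow>\<^sub>0 complex) \<in> cspan (range (\<lambda>k. Poly_Mapping.single k 1))"
proof -
  have "x = (\<Sum>k\<in>Poly_Mapping.keys x. Poly_Mapping.lookup x k *\<^sub>C Poly_Mapping.single k 1)"
    by (rule poly_mapping_eqI)
      (simp add: lookup_sum scaleC_poly_mapping.rep_eq lookup_single when_def in_keys_iff
        if_distrib[where f = "(*) c" for c] cong: if_cong)
  also have "\<dots> \<in> cspan (range (\<lambda>k. Poly_Mapping.single k 1))"
    by (intro cvec.span_sum cvec.span_scale cvec.span_base) auto
  finally show ?thesis .
qed

lemma free_ext_weil_relations:
  assumes "letterwise_linear f" "r \<in> weil_relations"
  shows "free_ext (\<lambda>w. f (letters w)) r = 0"
proof -
  let ?F = "free_ext (\<lambda>w. f (letters w))"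
  from assms(2) obtain x s y where r: "r = x * s * y" and s: "s \<in> symbol_relations"
    by (auto simp: weil_relations_def)
  have base: "?F (Poly_Mapping.single u 1 * s * Poly_Mapping.single v 1) = 0" for u v
    using s assms(1)
    by (auto simp: symbol_relations_def symb_def right_diff_distrib left_diff_distrib mult_single
        scaleC_mult_free free_ext_diff free_ext_scale plus_word_def letterwise_linear_def clinear_iff)
  have "?F (Poly_Mapping.single u 1 * s * y) = 0" for u
    using free_expand[of y]
    by (induct rule: cvec.span_induct_alt)
      (auto simp: distrib_left scaleC_mult_free free_ext_add free_ext_scale base)
  note * = this
  have "?F (x * s * y) = 0"
    using free_expand[of x]
    by (induct rule: cvec.span_induct_alt)
      (auto simp: distrib_right scaleC_mult_free free_ext_add free_ext_scale *)
  then show ?thesis by (simp add: r)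
qed

lemma weil_ext_abs:
  assumes "letterwise_linear f"
  shows "weil_ext f (abs_weil p) = free_ext (\<lambda>w. f (letters w)) p"
proof -
  have "weil_rel (rep_weil (abs_weil p)) p"
    by (metis Quotient3_abs_rep Quotient3_weil weil.abs_eq_iff)
  then show ?thesis
    unfolding weil_ext_def weil_rel_def
    by (rule free_ext_eq_modulo[rotated]) (rule free_ext_weil_relations[OF assms])
qed

lemma monom_abs: "monom w = abs_weil (Poly_Mapping.single (Word w) 1)"
proof (induct w)
  case Nil
  then show ?case
    by (simp add: monom_def one_weil.abs_eq single_one flip: zero_word_def)
next
  case (Cons a w)
  then show ?case
    by (simp add: monom_def gen.abs_eq times_weil.abs_eq symb_def mult_single plus_word_def)
qed

lemma weil_ext_monom: "letterwise_linear f \<Longrightarrow> weil_ext f (monom w) = f w"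
  by (simp add: monom_abs weil_ext_abs)

lemma weil_ext_linear: "letterwise_linear f \<Longrightarrow> clinear (weil_ext f)"
  unfolding clinear_iff
proof safe
  fix u v :: "'a weil" and c :: complex
  assume f: "letterwise_linear f"
  obtain p q where pq: "u = abs_weil p" "v = abs_weil q"
    by (metis Quotient3_abs_rep Quotient3_weil)
  show "weil_ext f (u + v) = weil_ext f u + weil_ext f v"
    by (simp add: pq plus_weil.abs_eq weil_ext_abs f free_ext_add)
  show "weil_ext f (c *\<^sub>C u) = c *\<^sub>C weil_ext f u"
    by (simp add: pq scaleC_weil.abs_eq weil_ext_abs f free_ext_scale)
qed

primrec deriv_word ::
    "('h::complex_vector gen \<Rightarrow> 'h weil) \<Rightarrow> 'h gen list \<Rightarrow> 'h weil"
  where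
    "deriv_word D [] = 0"
  | "deriv_word D (a # w) = D a * monom w + (-1) ^ gdeg a * gen a * deriv_word D w"

definition comult_prod ::
    "('h::complex_vector \<Rightarrow> ('h, 'h) tensor) \<Rightarrow> ('h \<Rightarrow> 'h gen) \<Rightarrow> ('h \<Rightarrow> 'h gen) \<Rightarrow> 'h \<Rightarrow> 'h weil"
  where "comult_prod \<Delta> K L h = tensor_lift (\<lambda>x y. gen (K x) * gen (L y)) (\<Delta> h)"

primrec gen_d :: "('h::complex_vector \<Rightarrow> ('h, 'h) tensor) \<Rightarrow> 'h gen \<Rightarrow> 'h weil"
  where
    "gen_d \<Delta> (Gen h) = gen (Curv h) - comult_prod \<Delta> Gen Gen h"
  | "gen_d \<Delta> (Curv h) = comult_prod \<Delta> Curv Gen h - comult_prod \<Delta> Gen Curv h"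

primrec gen_d0 :: "('h::complex_vector \<Rightarrow> ('h, 'h) tensor) \<Rightarrow> 'h gen \<Rightarrow> 'h weil"
  where
    "gen_d0 \<Delta> (Gen h) = - comult_prod \<Delta> Gen Gen h"
  | "gen_d0 \<Delta> (Curv h) = gen_d \<Delta> (Curv h)"

definition weil_d :: "('h::complex_vector \<Rightarrow> ('h, 'h) tensor) \<Rightarrow> 'h weil \<Rightarrow> 'h weil"
  where "weil_d \<Delta> = weil_ext (deriv_word (gen_d \<Delta>))"

definition weil_d0 :: "('h::complex_vector \<Rightarrow> ('h, 'h) tensor) \<Rightarrow> 'h weil \<Rightarrow> 'h weil"
  where "weil_d0 \<Delta> = weil_ext (deriv_word (gen_d0 \<Delta>))"

text \<open>
  The values on the empty word are immaterial, since the operators are only used on \<open>W(H)\<close> and its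
  ideals.
\<close>

primrec t_word :: "'h::complex_vector gen list \<Rightarrow> 'h weil"
  where
    "t_word [] = 1"
  | "t_word (a # w) = (-1) ^ (gdeg a * wdeg w) * monom w * gen a"

definition weil_t :: "'h::complex_vector weil \<Rightarrow> 'h weil"
  where "weil_t = weil_ext t_word"

primrec bt_word ::
    "('h::complex_vector \<Rightarrow> ('h, 'h) tensor) \<Rightarrow> 'h gen list \<Rightarrow> 'h weil"
  where
    "bt_word \<Delta> [] = 0"
  | "bt_word \<Delta> (a # w) = weil_t (weil_d0 \<Delta> (gen a) * monom w)"

definition weil_b :: "('h::complex_vector \<Rightarrow> ('h, 'h) tensor) \<Rightarrow> 'h weil \<Rightarrow> 'h weil"
  where "weil_b \<Delta> x = weil_d \<Delta> x + weil_ext (bt_word \<Delta>) x"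

definition weil_N :: "'h::complex_vector weil \<Rightarrow> 'h weil"
  where "weil_N = weil_ext (\<lambda>w. \<Sum>i<length w. (weil_t ^^ i) (monom w))"

subsection \<open>The operators satisfy their defining equations\<close>

lemma scaleC_mult_weil:
  fixes x y :: "'h::complex_vector weil"
  shows "(c *\<^sub>C x) * y = c *\<^sub>C (x * y)" "x * (c *\<^sub>C y) = c *\<^sub>C (x * y)"
  by (transfer, simp add: scaleC_mult_free weil_rel_def cvec.span_zero)+

lemma monom_simps [simp]:
  "monom [] = 1" "monom (a # w) = gen a * monom w" "monom (u @ v) = monom u * monom v"
  by (simp_all add: monom_def)

lemma wdeg_simps [simp]:
  "wdeg [] = 0" "wdeg (a # w) = gdeg a + wdeg w" "wdeg (u @ v) = wdeg u + wdeg v"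
  by (simp_all add: wdeg_def)

lemma gen_linear:
  "gen (Gen (x + y)) = gen (Gen x) + gen (Gen y)" "gen (Gen (c *\<^sub>C x)) = c *\<^sub>C gen (Gen x)"
  "gen (Curv (x + y)) = gen (Curv x) + gen (Curv y)" "gen (Curv (c *\<^sub>C x)) = c *\<^sub>C gen (Curv x)"
proof -
  have "r \<in> cspan weil_relations" if "r \<in> symbol_relations" for r :: "'a gen word \<Rightarrow>\<^sub>0 complex"
  proof (intro cvec.span_base)
    have "r = 1 * r * 1" by simp
    with that show "r \<in> weil_relations" unfolding weil_relations_def by blast
  qed
  note * = this[unfolded symbol_relations_def]
  show "gen (Gen (x + y)) = gen (Gen x) + gen (Gen y)" "gen (Curv (x + y)) = gen (Curv x) + gen (Curv y)"
    by (transfer, unfold weil_rel_def, rule *, fastforce simp: diff_diff_eq)+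
  show "gen (Gen (c *\<^sub>C x)) = c *\<^sub>C gen (Gen x)" "gen (Curv (c *\<^sub>C x)) = c *\<^sub>C gen (Curv x)"
    by (transfer, unfold weil_rel_def, rule *, blast)+
qed

lemmas weil_linear_simps =
  clinear_iff gen_linear distrib_left distrib_right scaleC_mult_weil cvec.scale_right_distrib

lemma weil_sign: "(-1) ^ k * x = ((-1) ^ k :: complex) *\<^sub>C (x :: 'h::complex_vector weil)"
  by (cases "even k") simp_all

lemma comult_prod_linear:
  assumes "clinear \<Delta>" "K \<in> {Gen, Curv}" "L \<in> {Gen, Curv}"
  shows "clinear (comult_prod \<Delta> K L)"
proof -
  have "cbilinear (\<lambda>x y. gen (K x) * gen (L y))"
    using assms(2,3) by (auto simp: cbilinear_def weil_linear_simps)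
  from tensor_lift_linear[OF this] assms(1) show ?thesis
    by (simp add: clinear_iff comult_prod_def)
qed

lemma gen_d_linear:
  assumes "clinear \<Delta>" "K \<in> {Gen, Curv}"
  shows "clinear (\<lambda>h. gen_d \<Delta> (K h))" "clinear (\<lambda>h. gen_d0 \<Delta> (K h))"
  using assms comult_prod_linear[OF assms(1)]
  by (auto simp: weil_linear_simps cvec.scale_right_diff_distrib)

lemma deriv_word_linear:
  assumes "clinear (\<lambda>h. D (Gen h))" "clinear (\<lambda>h. D (Curv h))"
  shows "letterwise_linear (deriv_word D)"
  unfolding letterwise_linear_def
proof (intro allI)
  fix u v
  show "clinear (\<lambda>h. deriv_word D (u @ Gen h # v)) \<and> clinear (\<lambda>h. deriv_word D (u @ Curv h # v))"
    by (induct u)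
      (use assms in \<open>auto simp: weil_linear_simps cvec.scale_right_diff_distrib\<close>)
qed

lemma weil_deriv:
  assumes "clinear (\<lambda>h. D (Gen h))" "clinear (\<lambda>h. D (Curv h))"
  shows "weil_ext (deriv_word D) (gen a) = D a"
    and "weil_ext (deriv_word D) (monom u * monom v) =
      weil_ext (deriv_word D) (monom u) * monom v
      + (-1) ^ wdeg u * monom u * weil_ext (deriv_word D) (monom v)"
proof -
  note ext = weil_ext_monom[OF deriv_word_linear[OF assms]]
  show "weil_ext (deriv_word D) (gen a) = D a"
    using ext[of "[a]"] by simp
  have "deriv_word D (u @ v) = deriv_word D u * monom v + (-1) ^ wdeg u * monom u * deriv_word D v"
    by (induct u) (simp_all add: algebra_simps power_add weil_sign scaleC_mult_weil)
  then show "weil_ext (deriv_word D) (monom u * monom v) =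
      weil_ext (deriv_word D) (monom u) * monom v
      + (-1) ^ wdeg u * monom u * weil_ext (deriv_word D) (monom v)"
    using ext[of "u @ v"] by (simp add: ext)
qed

lemma weil_d_eqs:
  assumes "clinear \<Delta>"
  shows "clinear (weil_d \<Delta>)" "weil_d \<Delta> (gen a) = gen_d \<Delta> a"
    and "weil_d \<Delta> (monom u * monom v) =
      weil_d \<Delta> (monom u) * monom v + (-1) ^ wdeg u * monom u * weil_d \<Delta> (monom v)"
  by (simp_all add: weil_d_def weil_deriv weil_ext_linear deriv_word_linear
      gen_d_linear[OF assms, of Gen] gen_d_linear[OF assms, of Curv] del: gen_d.simps gen_d0.simps)

lemma weil_d0_eqs:
  assumes "clinear \<Delta>"
  shows "clinear (weil_d0 \<Delta>)" "weil_d0 \<Delta> (gen a) = gen_d0 \<Delta> a"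
    and "weil_d0 \<Delta> (monom u * monom v) =
      weil_d0 \<Delta> (monom u) * monom v + (-1) ^ wdeg u * monom u * weil_d0 \<Delta> (monom v)"
  by (simp_all add: weil_d0_def weil_deriv weil_ext_linear deriv_word_linear
      gen_d_linear[OF assms, of Gen] gen_d_linear[OF assms, of Curv] del: gen_d.simps gen_d0.simps)

lemma t_word_linear: "letterwise_linear t_word"
  unfolding letterwise_linear_def
proof (intro allI)
  fix u v :: "'a gen list"
  show "clinear (\<lambda>h. t_word (u @ Gen h # v)) \<and> clinear (\<lambda>h. t_word (u @ Curv h # v))"
    by (cases u) (auto simp: weil_linear_simps)
qed

lemma weil_t_eqs:
  shows "clinear weil_t"
    and "weil_t (gen a * monom w) = (-1) ^ (gdeg a * wdeg w) * monom w * gen a"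
  using weil_ext_monom[OF t_word_linear, of "a # w"]
  by (simp_all add: weil_t_def weil_ext_linear t_word_linear)

lemma bt_word_linear:
  assumes "clinear \<Delta>"
  shows "letterwise_linear (bt_word \<Delta>)"
  unfolding letterwise_linear_def
proof (intro allI)
  fix u v :: "'a gen list"
  show "clinear (\<lambda>h. bt_word \<Delta> (u @ Gen h # v)) \<and> clinear (\<lambda>h. bt_word \<Delta> (u @ Curv h # v))"
    using weil_t_eqs(1) weil_d0_eqs(1)[OF assms] by (cases u) (auto simp: weil_linear_simps)
qed

lemma weil_b_eqs:
  assumes "clinear \<Delta>"
  shows "clinear (weil_b \<Delta>)"
    and "weil_b \<Delta> (gen a * monom w) =
      weil_d \<Delta> (gen a * monom w) + weil_t (weil_d0 \<Delta> (gen a) * monom w)"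
  using weil_ext_monom[OF bt_word_linear[OF assms], of "a # w"]
    weil_ext_linear[OF bt_word_linear[OF assms]] weil_d_eqs(1)[OF assms]
  by (simp_all add: weil_b_def clinear_iff cvec.scale_right_distrib)

lemma weil_t_pow_linear: "clinear (weil_t ^^ i)"
  by (induct i) (simp_all add: clinear_iff weil_t_eqs(1)[unfolded clinear_iff])

lemma N_word_linear: "letterwise_linear (\<lambda>w. \<Sum>i<length w. (weil_t ^^ i) (monom w))"
  by (simp add: letterwise_linear_def weil_linear_simps weil_t_pow_linear[unfolded clinear_iff]
      sum.distrib cvec.scale_sum_right del: sum.lessThan_Suc)

lemma weil_N_eqs:
  shows "clinear weil_N"
    and "weil_N (monom w) = (\<Sum>i<length w. (weil_t ^^ i) (monom w))"
  by (simp_all add: weil_N_def weil_ext_monom weil_ext_linear N_word_linear)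

subsection \<open>\<open>W(H)\<close> and the powers of \<open>I(H)\<close>\<close>

definition weil_plus :: "'h::complex_vector weil set"
  where "weil_plus = cspan {monom w | w. w \<noteq> []}"

definition curv_ideal :: "'h::complex_vector weil set"
  where "curv_ideal = cspan {x * gen (Curv h) * y | x h y. True}"

primrec curv_power :: "nat \<Rightarrow> 'h::complex_vector weil set"
  where
    "curv_power 0 = UNIV"
  | "curv_power (Suc n) = cspan {x * y | x y. x \<in> curv_ideal \<and> y \<in> curv_power n}"

section \<open>Complexes, subobjects and quotients\<close>

text \<open>
  The carrier-based records allow for iterated quotients. Fields that make no sense for a given
  object (the unit of a non-unital algebra, the product of a mere complex) are simply not used.
\<close>

record 'a dgspace = "(complex, 'a) module" +
  comp :: "nat \<Rightarrow> 'a set"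
  diff :: "'a \<Rightarrow> 'a"

definition complex_ring :: "complex ring"
  where "complex_ring = \<lparr>carrier = UNIV, mult = (*), one = 1, zero = 0, add = (+)\<rparr>"

definition sub_dg :: "'a dgspace \<Rightarrow> 'a set \<Rightarrow> 'a dgspace"
  where "sub_dg C S = C\<lparr>carrier := S, comp := \<lambda>k. comp C k \<inter> S\<rparr>"

text \<open>The map induced by \<open>f\<close> on cosets, with values in the cosets of \<open>S\<close> in \<open>D\<close>.\<close>

definition coset_map :: "'b dgspace \<Rightarrow> 'b set \<Rightarrow> ('a \<Rightarrow> 'b) \<Rightarrow> 'a set \<Rightarrow> 'b set"
  where "coset_map D S f A = (\<Union>a\<in>A. S +>\<^bsub>D\<^esub> f a)"

text \<open>The map induced by \<open>f\<close> on cosets, if \<open>f\<close> is constant on them.\<close>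

definition descend :: "('a \<Rightarrow> 'b) \<Rightarrow> 'a set \<Rightarrow> 'b"
  where "descend f A = the_elem (f ` A)"

definition quot_dg :: "'a dgspace \<Rightarrow> 'a set \<Rightarrow> 'a set dgspace"
  where "quot_dg C S =
    \<lparr>carrier = a_rcosets\<^bsub>C\<^esub> S, mult = rcoset_mult C S, one = S +>\<^bsub>C\<^esub> \<one>\<^bsub>C\<^esub>, zero = S,
     add = set_add C, smult = \<lambda>c. coset_map C S (smult C c),
     comp = \<lambda>k. (\<lambda>x. S +>\<^bsub>C\<^esub> x) ` comp C k, diff = coset_map C S (diff C)\<rparr>"

definition submodule_span :: "'a dgspace \<Rightarrow> 'a set \<Rightarrow> 'a set"
  where "submodule_span C X = \<Inter>{S. submodule S complex_ring C \<and> X \<subseteq> S}"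

text \<open>\<open>[A, B]\<close>, spanned by the graded commutators of homogeneous elements.\<close>

definition graded_comm :: "'a dgspace \<Rightarrow> 'a set \<Rightarrow> 'a set \<Rightarrow> 'a set"
  where "graded_comm C A B = submodule_span C
    {(x \<otimes>\<^bsub>C\<^esub> y) \<ominus>\<^bsub>C\<^esub> (((-1) ^ (k * l)) \<odot>\<^bsub>C\<^esub> (y \<otimes>\<^bsub>C\<^esub> x)) | k l x y.
       x \<in> A \<inter> comp C k \<and> y \<in> B \<inter> comp C l}"

definition linear_dg :: "'a dgspace \<Rightarrow> 'b dgspace \<Rightarrow> ('a \<Rightarrow> 'b) \<Rightarrow> bool"
  where "linear_dg C D f \<longleftrightarrow>
    f \<in> carrier C \<rightarrow> carrier D \<and>
    (\<forall>x\<in>carrier C. \<forall>y\<in>carrier C. f (x \<oplus>\<^bsub>C\<^esub> y) = f x \<oplus>\<^bsub>D\<^esub> f y) \<and>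
    (\<forall>c. \<forall>x\<in>carrier C. f (c \<odot>\<^bsub>C\<^esub> x) = c \<odot>\<^bsub>D\<^esub> f x)"

definition cochain_complex :: "'a dgspace \<Rightarrow> bool"
  where "cochain_complex C \<longleftrightarrow>
    Module.module complex_ring C \<and>
    (\<forall>k. submodule (comp C k) complex_ring C) \<and>
    (\<forall>x\<in>carrier C. \<exists>!f. (\<forall>k. f k \<in> comp C k) \<and> finite {k. f k \<noteq> \<zero>\<^bsub>C\<^esub>} \<and>
       x = (\<Oplus>\<^bsub>C\<^esub>k\<in>{k. f k \<noteq> \<zero>\<^bsub>C\<^esub>}. f k)) \<and>
    linear_dg C C (diff C) \<and>
    (\<forall>k. diff C ` comp C k \<subseteq> comp C (Suc k)) \<and>
    (\<forall>x\<in>carrier C. diff C (diff C x) = \<zero>\<^bsub>C\<^esub>)"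

definition cochain_map :: "'a dgspace \<Rightarrow> 'b dgspace \<Rightarrow> ('a \<Rightarrow> 'b) \<Rightarrow> bool"
  where "cochain_map C D f \<longleftrightarrow>
    linear_dg C D f \<and>
    (\<forall>k. f ` comp C k \<subseteq> comp D k) \<and>
    (\<forall>x\<in>carrier C. f (diff C x) = diff D (f x))"

text \<open>\<open>0 \<rightarrow> A \<rightarrow> B \<rightarrow> C \<rightarrow> D \<rightarrow> 0\<close> is an exact sequence of complexes.\<close>

definition exact_complexes ::
    "'a dgspace \<Rightarrow> ('a \<Rightarrow> 'b) \<Rightarrow> 'b dgspace \<Rightarrow> ('b \<Rightarrow> 'c) \<Rightarrow> 'c dgspace \<Rightarrow> ('c \<Rightarrow> 'd) \<Rightarrow> 'd dgspace \<Rightarrow> bool"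
  where "exact_complexes A f B g C h D \<longleftrightarrow>
    cochain_complex A \<and> cochain_complex B \<and> cochain_complex C \<and> cochain_complex D \<and>
    cochain_map A B f \<and> cochain_map B C g \<and> cochain_map C D h \<and>
    inj_on f (carrier A) \<and>
    f ` carrier A = a_kernel B C g \<and>
    g ` carrier B = a_kernel C D h \<and>
    h ` carrier C = carrier D"

section \<open>The complexes \<open>W\<^sub>n(H)\<close> and \<open>I\<^sub>n(H)\<close>\<close>

definition unital_weil :: "('h::complex_vector \<Rightarrow> ('h, 'h) tensor) \<Rightarrow> 'h weil dgspace"
  where "unital_weil \<Delta> =
    \<lparr>carrier = UNIV, mult = (*), one = 1, zero = 0, add = (+), smult = scaleC,
     comp = \<lambda>k. cspan {monom w | w. wdeg w = k}, diff = weil_d \<Delta>\<rparr>"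

definition weil_dg :: "('h::complex_vector \<Rightarrow> ('h, 'h) tensor) \<Rightarrow> 'h weil dgspace"
  where "weil_dg \<Delta> = sub_dg (unital_weil \<Delta>) weil_plus"

definition Wn :: "('h::complex_vector \<Rightarrow> ('h, 'h) tensor) \<Rightarrow> nat \<Rightarrow> 'h weil set dgspace"
  where "Wn \<Delta> n = quot_dg (weil_dg \<Delta>) (curv_power (Suc n))"

definition Wn_map ::
    "('h::complex_vector \<Rightarrow> ('h, 'h) tensor) \<Rightarrow> nat \<Rightarrow> ('h weil \<Rightarrow> 'h weil) \<Rightarrow> 'h weil set \<Rightarrow> 'h weil set"
  where "Wn_map \<Delta> n f = coset_map (weil_dg \<Delta>) (curv_power (Suc n)) f"

definition Wn_b :: "('h::complex_vector \<Rightarrow> ('h, 'h) tensor) \<Rightarrow> nat \<Rightarrow> 'h weil set dgspace"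
  where "Wn_b \<Delta> n = (Wn \<Delta> n)\<lparr>diff := Wn_map \<Delta> n (weil_b \<Delta>)\<rparr>"

definition Wn_comm :: "('h::complex_vector \<Rightarrow> ('h, 'h) tensor) \<Rightarrow> nat \<Rightarrow> 'h weil set set"
  where "Wn_comm \<Delta> n = graded_comm (Wn \<Delta> n) (carrier (Wn \<Delta> n)) (carrier (Wn \<Delta> n))"

definition Wn_nat :: "('h::complex_vector \<Rightarrow> ('h, 'h) tensor) \<Rightarrow> nat \<Rightarrow> 'h weil set set dgspace"
  where "Wn_nat \<Delta> n = quot_dg (Wn \<Delta> n) (Wn_comm \<Delta> n)"

definition In :: "('h::complex_vector \<Rightarrow> ('h, 'h) tensor) \<Rightarrow> nat \<Rightarrow> 'h weil dgspace"
  where "In \<Delta> n = sub_dg (unital_weil \<Delta>) (curv_power (Suc n))"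

definition In_b :: "('h::complex_vector \<Rightarrow> ('h, 'h) tensor) \<Rightarrow> nat \<Rightarrow> 'h weil dgspace"
  where "In_b \<Delta> n = (In \<Delta> n)\<lparr>diff := weil_b \<Delta>\<rparr>"

text \<open>\<open>[I(H), I\<^sub>n\<^sub>-\<^sub>1(H)]\<close>; here \<open>I\<^sub>n\<^sub>-\<^sub>1(H) = I(H)\<^sup>n\<close> is \<open>W(H)\<close> with a unit adjoined if \<open>n = 0\<close>.\<close>

definition In_comm :: "('h::complex_vector \<Rightarrow> ('h, 'h) tensor) \<Rightarrow> nat \<Rightarrow> 'h weil set"
  where "In_comm \<Delta> n = graded_comm (unital_weil \<Delta>) curv_ideal (curv_power n)"

definition In_nat :: "('h::complex_vector \<Rightarrow> ('h, 'h) tensor) \<Rightarrow> nat \<Rightarrow> 'h weil set dgspace"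
  where "In_nat \<Delta> n = quot_dg (In \<Delta> n) (In_comm \<Delta> n)"

end

theory Submission
  imports Defs
begin

text \<open>
  On products of \<open>p\<close> generators \<open>t\<^sup>p = 1\<close>, so that over the complex numbers the kernel of \<open>t - 1\<close> is the
  image of \<open>N\<close> and conversely. Explicitly \<open>1 - N L = Q (1 - t) = (1 - t) Q\<close>, where \<open>L\<close> divides by the
  word length and \<open>Q\<close> is \<open>1/p\<close> times the sum of the \<open>t\<^sup>j\<close> over \<open>j < i < p\<close>. All these operators preserve
  the number of letters \<open>\<omega>\<^sub>h\<close>, hence exactness holds on the powers of \<open>I(H)\<close> and on the quotients by them.

  As for the differentials, put \<open>c(a x) = \<partial>\<^sub>0(a) x\<close> for a generator \<open>a\<close>, so that \<open>b = \<partial> + t c\<close>. The relations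
  \<open>\<partial> t - t \<partial> = (t - 1) t c\<close>, \<open>\<partial> c + c \<partial> = c c\<close> and \<open>c t c = - t c c\<close> give \<open>(t - 1) b = \<partial> (t - 1)\<close>
  and \<open>b b = 0\<close>. Since \<open>N L\<close> is the identity on the invariants of \<open>t\<close>, the remaining identity
  \<open>b N = N \<partial>\<close> may be checked after averaging, where it reduces to \<open>N \<partial>\<^sub>0 = N c N\<close>.

  Finally the image of \<open>t - 1\<close> is the span of the graded commutators.
\<close>

subsection \<open>Gradings, subcomplexes and quotient complexes\<close>

text \<open>The correction \<open>t c\<close> in \<open>b\<close> comes from word lengths. One
  rotation moves a letter \<open>a\<close> to the end, but \<open>\<partial>\<^sub>0(a)\<close> has
  length two and needs two rotations, so \<open>\<partial>\<close> does not commute with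
  \<open>t\<close>. The same jump is the obstacle to \<open>b N = N \<partial>\<close>: on words of
  length \<open>p\<close> both differentials have a component of length \<open>p\<close> and one of
  length \<open>p + 1\<close>, and dividing by the length treats these differently. The identity
  \<open>N \<partial>\<^sub>0 = N c N\<close> holds because the \<open>p\<close> rotations of a word
  bring each letter to the front once, where \<open>c\<close> differentiates it. On an invariant of
  length \<open>p\<close> it reads \<open>N \<partial>\<^sub>0 = p N c\<close>, which is the factor
  that reconciles \<open>1/p\<close> with \<open>1/(p + 1)\<close>. The averaging formula fails on
  the empty word, where \<open>t = 1\<close> and \<open>N = 0\<close>. Neither family of complexes
  contains it: \<open>W(H)\<close> has no unit, and a word with some \<open>\<omega>\<^sub>h\<close>
  is nonempty.\<close>

lemma complex_ring_simps [simp]: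
  "carrier complex_ring = UNIV" "x \<otimes>\<^bsub>complex_ring\<^esub> y = x * y" "x \<oplus>\<^bsub>complex_ring\<^esub> y = x + y"
  "\<one>\<^bsub>complex_ring\<^esub> = 1" "\<zero>\<^bsub>complex_ring\<^esub> = 0"
  by (simp_all add: complex_ring_def)

lemma cring_complex_ring: "cring complex_ring"
proof -
  have "\<exists>y. y + x = 0" for x :: complex
    by (rule exI[of _ "- x"]) simp
  then show ?thesis
    by (intro cringI abelian_groupI comm_monoidI) (simp_all add: algebra_simps)
qed

locale dg_module = Module.module complex_ring C for C :: "'a dgspace" (structure)

lemma dg_moduleI:
  fixes C :: "'a dgspace"
  assumes "abelian_group C"
    and "\<And>c x. x \<in> carrier C \<Longrightarrow> c \<odot>\<^bsub>C\<^esub> x \<in> carrier C"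
    and "\<And>c d x. x \<in> carrier C \<Longrightarrow> (c + d) \<odot>\<^bsub>C\<^esub> x = c \<odot>\<^bsub>C\<^esub> x \<oplus>\<^bsub>C\<^esub> d \<odot>\<^bsub>C\<^esub> x"
    and "\<And>c x y. x \<in> carrier C \<Longrightarrow> y \<in> carrier C \<Longrightarrow>
      c \<odot>\<^bsub>C\<^esub> (x \<oplus>\<^bsub>C\<^esub> y) = c \<odot>\<^bsub>C\<^esub> x \<oplus>\<^bsub>C\<^esub> c \<odot>\<^bsub>C\<^esub> y"
    and "\<And>c d x. x \<in> carrier C \<Longrightarrow> (c * d) \<odot>\<^bsub>C\<^esub> x = c \<odot>\<^bsub>C\<^esub> (d \<odot>\<^bsub>C\<^esub> x)"
    and "\<And>x. x \<in> carrier C \<Longrightarrow> 1 \<odot>\<^bsub>C\<^esub> x = x"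
  shows "dg_module C"
  unfolding dg_module_def using assms
  by (intro Module.moduleI cring_complex_ring) auto

lemma linear_dg_closed: "linear_dg C D f \<Longrightarrow> x \<in> carrier C \<Longrightarrow> f x \<in> carrier D"
  and linear_dg_add: "linear_dg C D f \<Longrightarrow> x \<in> carrier C \<Longrightarrow> y \<in> carrier C \<Longrightarrow>
      f (x \<oplus>\<^bsub>C\<^esub> y) = f x \<oplus>\<^bsub>D\<^esub> f y"
  and linear_dg_smult: "linear_dg C D f \<Longrightarrow> x \<in> carrier C \<Longrightarrow> f (c \<odot>\<^bsub>C\<^esub> x) = c \<odot>\<^bsub>D\<^esub> f x"
  by (auto simp: linear_dg_def)

context
  fixes C :: "'a dgspace" and D :: "'b dgspace" and f
  assumes C: "dg_module C" and D: "dg_module D" and f: "linear_dg C D f"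
begin

interpretation C: dg_module C by (rule C)
interpretation D: dg_module D by (rule D)

lemma linear_dg_zero: "f \<zero>\<^bsub>C\<^esub> = \<zero>\<^bsub>D\<^esub>"
  using linear_dg_smult[OF f C.zero_closed, of 0] linear_dg_closed[OF f C.zero_closed]
    C.smult_l_null[OF C.zero_closed] D.smult_l_null
  by simp

lemma linear_dg_inv: "x \<in> carrier C \<Longrightarrow> f (\<ominus>\<^bsub>C\<^esub> x) = \<ominus>\<^bsub>D\<^esub> f x"
  by (metis linear_dg_zero linear_dg_add[OF f] linear_dg_closed[OF f] C.a_inv_closed C.l_neg
      D.M.minus_equality)

lemma linear_dg_minus:
  "x \<in> carrier C \<Longrightarrow> y \<in> carrier C \<Longrightarrow> f (x \<ominus>\<^bsub>C\<^esub> y) = f x \<ominus>\<^bsub>D\<^esub> f y"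
  by (simp add: C.minus_eq D.minus_eq linear_dg_add[OF f] linear_dg_inv)

lemma linear_dg_finsum:
  assumes "finite A" "g \<in> A \<rightarrow> carrier C"
  shows "f (\<Oplus>\<^bsub>C\<^esub>k\<in>A. g k) = (\<Oplus>\<^bsub>D\<^esub>k\<in>A. f (g k))"
  using assms
proof (induct rule: finite_induct)
  case empty
  then show ?case by (simp add: linear_dg_zero)
next
  case (insert a A)
  then have "g a \<in> carrier C" "g \<in> A \<rightarrow> carrier C" by auto
  moreover from this have "(\<lambda>k. f (g k)) \<in> A \<rightarrow> carrier D" "f (g a) \<in> carrier D"
    using linear_dg_closed[OF f] by auto
  ultimately show ?case
    using insert by (simp add: linear_dg_add[OF f])
qed

end

text \<open>The grading is given by projections instead of unique decompositions: projections
  restrict to invariant subspaces and pass to cosets, so subcomplexes and quotients inherit it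
  directly.\<close>

definition grading :: "'a dgspace \<Rightarrow> (nat \<Rightarrow> 'a \<Rightarrow> 'a) \<Rightarrow> bool"
  where "grading C \<pi> \<longleftrightarrow>
    dg_module C \<and>
    (\<forall>k. linear_dg C C (\<pi> k) \<and> comp C k = \<pi> k ` carrier C) \<and>
    (\<forall>k l. \<forall>x\<in>carrier C. \<pi> k (\<pi> l x) = (if k = l then \<pi> k x else \<zero>\<^bsub>C\<^esub>)) \<and>
    (\<forall>x\<in>carrier C. \<exists>A. finite A \<and> (\<forall>k. k \<notin> A \<longrightarrow> \<pi> k x = \<zero>\<^bsub>C\<^esub>) \<and> x = (\<Oplus>\<^bsub>C\<^esub>k\<in>A. \<pi> k x))"

definition graded_complex :: "'a dgspace \<Rightarrow> (nat \<Rightarrow> 'a \<Rightarrow> 'a) \<Rightarrow> bool"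
  where "graded_complex C \<pi> \<longleftrightarrow>
    grading C \<pi> \<and> linear_dg C C (diff C) \<and>
    (\<forall>k. diff C ` comp C k \<subseteq> comp C (Suc k)) \<and>
    (\<forall>x\<in>carrier C. diff C (diff C x) = \<zero>\<^bsub>C\<^esub>)"

lemma gradingI:
  assumes "dg_module C" "\<And>k. linear_dg C C (\<pi> k)" "\<And>k. comp C k = \<pi> k ` carrier C"
    and "\<And>x k l. x \<in> carrier C \<Longrightarrow> \<pi> k (\<pi> l x) = (if k = l then \<pi> k x else \<zero>\<^bsub>C\<^esub>)"
    and "\<And>x. x \<in> carrier C \<Longrightarrow>
      \<exists>A. finite A \<and> (\<forall>k. k \<notin> A \<longrightarrow> \<pi> k x = \<zero>\<^bsub>C\<^esub>) \<and> x = (\<Oplus>\<^bsub>C\<^esub>k\<in>A. \<pi> k x)"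
  shows "grading C \<pi>"
  unfolding grading_def by (intro conjI allI ballI assms)

lemma gradingD:
  assumes "grading C \<pi>"
  shows "dg_module C" "linear_dg C C (\<pi> k)" "comp C k = \<pi> k ` carrier C"
    and "x \<in> carrier C \<Longrightarrow> \<pi> k (\<pi> l x) = (if k = l then \<pi> k x else \<zero>\<^bsub>C\<^esub>)"
    and "x \<in> carrier C \<Longrightarrow>
      \<exists>A. finite A \<and> (\<forall>k. k \<notin> A \<longrightarrow> \<pi> k x = \<zero>\<^bsub>C\<^esub>) \<and> x = (\<Oplus>\<^bsub>C\<^esub>k\<in>A. \<pi> k x)"
  using assms unfolding grading_def by simp_all

lemma linear_dg_image_submodule:
  assumes C: "dg_module C" and D: "dg_module D" and f: "linear_dg C D f"
  shows "submodule (f ` carrier C) complex_ring D"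
proof -
  interpret C: dg_module C by (rule C)
  interpret D: dg_module D by (rule D)
  show ?thesis
  proof (rule D.submoduleI)
    show "f ` carrier C \<subseteq> carrier D"
      using linear_dg_closed[OF f] by (rule image_subsetI)
    show "\<zero>\<^bsub>D\<^esub> \<in> f ` carrier C"
      by (rule image_eqI[where f = f, OF linear_dg_zero[OF C D f, symmetric] C.zero_closed])
  next
    fix a assume "a \<in> f ` carrier C"
    then obtain x where x: "x \<in> carrier C" "a = f x" by blast
    show "\<ominus>\<^bsub>D\<^esub> a \<in> f ` carrier C"
      using x linear_dg_inv[OF C D f x(1)] by (intro image_eqI[of _ f "\<ominus>\<^bsub>C\<^esub> x"]) simp_all
    show "c \<odot>\<^bsub>D\<^esub> a \<in> f ` carrier C" for c
      using x linear_dg_smult[OF f x(1), of c]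
      by (intro image_eqI[of _ f "c \<odot>\<^bsub>C\<^esub> x"]) simp_all
    fix b assume "b \<in> f ` carrier C"
    then obtain y where y: "y \<in> carrier C" "b = f y" by blast
    show "a \<oplus>\<^bsub>D\<^esub> b \<in> f ` carrier C"
      using x y linear_dg_add[OF f x(1) y(1)]
      by (intro image_eqI[of _ f "x \<oplus>\<^bsub>C\<^esub> y"]) simp_all
  qed
qed

text \<open>Uniqueness of the homogeneous components: \<open>\<pi> l\<close>, applied to any
  decomposition, annihilates every summand except the one of degree \<open>l\<close>.\<close>

lemma graded_complex_imp_cochain_complex:
  assumes "graded_complex C \<pi>"
  shows "cochain_complex C"
proof -
  have gr: "grading C \<pi>" using assms by (simp add: graded_complex_def)
  note mod = gradingD(1)[OF gr] and lin = gradingD(2)[OF gr] and comp = gradingD(3)[OF gr]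
    and proj = gradingD(4)[OF gr] and dec = gradingD(5)[OF gr]
  interpret dg_module C by (rule mod)
  have "\<exists>!f. (\<forall>k. f k \<in> comp C k) \<and> finite {k. f k \<noteq> \<zero>\<^bsub>C\<^esub>} \<and>
       x = (\<Oplus>\<^bsub>C\<^esub>k\<in>{k. f k \<noteq> \<zero>\<^bsub>C\<^esub>}. f k)" if x: "x \<in> carrier C" for x
  proof (rule ex1I[where a = "\<lambda>k. \<pi> k x"])
    obtain A where A: "finite A" "\<And>k. k \<notin> A \<Longrightarrow> \<pi> k x = \<zero>\<^bsub>C\<^esub>" "x = (\<Oplus>\<^bsub>C\<^esub>k\<in>A. \<pi> k x)"
      using dec[OF x] by blast
    \<comment> \<open>\<open>cochain_complex\<close> sums over the support, which may be smaller
      than \<open>A\<close>.\<close>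
    have sub: "{k. \<pi> k x \<noteq> \<zero>\<^bsub>C\<^esub>} \<subseteq> A" using A(2) by blast
    have "(\<Oplus>\<^bsub>C\<^esub>k\<in>A. \<pi> k x) = (\<Oplus>\<^bsub>C\<^esub>k\<in>{k. \<pi> k x \<noteq> \<zero>\<^bsub>C\<^esub>}. \<pi> k x)"
      by (rule M.add.finprod_mono_neutral_cong_right[OF A(1) sub])
        (use linear_dg_closed[OF lin x] in auto)
    with A sub x comp show "(\<forall>k. \<pi> k x \<in> comp C k) \<and> finite {k. \<pi> k x \<noteq> \<zero>\<^bsub>C\<^esub>} \<and>
       x = (\<Oplus>\<^bsub>C\<^esub>k\<in>{k. \<pi> k x \<noteq> \<zero>\<^bsub>C\<^esub>}. \<pi> k x)"
      using finite_subset by auto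
  next
    fix f
    assume f: "(\<forall>k. f k \<in> comp C k) \<and> finite {k. f k \<noteq> \<zero>\<^bsub>C\<^esub>} \<and>
       x = (\<Oplus>\<^bsub>C\<^esub>k\<in>{k. f k \<noteq> \<zero>\<^bsub>C\<^esub>}. f k)"
    let ?A = "{k. f k \<noteq> \<zero>\<^bsub>C\<^esub>}"
    have car: "f k \<in> carrier C" for k
      using f comp linear_dg_closed[OF lin] by (metis imageE)
    have pf: "\<pi> l (f k) = (if k = l then f l else \<zero>\<^bsub>C\<^esub>)" for k l
      using f proj unfolding comp by (smt (verit) imageE)
    show "f = (\<lambda>k. \<pi> k x)"
    proof
      fix l
      have "\<pi> l x = (\<Oplus>\<^bsub>C\<^esub>k\<in>?A. \<pi> l (f k))"
        using f linear_dg_finsum[OF mod mod lin, of ?A f l] car by auto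
      also have "\<dots> = (\<Oplus>\<^bsub>C\<^esub>k\<in>?A. if l = k then f k else \<zero>\<^bsub>C\<^esub>)"
        by (rule M.finsum_cong') (auto simp: pf car)
      also have "\<dots> = f l"
      proof (cases "l \<in> ?A")
        case True
        then show ?thesis using f car by (subst M.add.finprod_singleton) auto
      next
        case False
        then have "(\<Oplus>\<^bsub>C\<^esub>k\<in>?A. if l = k then f k else \<zero>\<^bsub>C\<^esub>) = (\<Oplus>\<^bsub>C\<^esub>k\<in>?A. \<zero>\<^bsub>C\<^esub>)"
          by (intro M.finsum_cong') auto
        with False show ?thesis by simp
      qed
      finally show "f l = \<pi> l x" by simp
    qed
  qed
  moreover have "submodule (comp C k) complex_ring C" for k
    unfolding comp by (rule linear_dg_image_submodule[OF mod mod lin])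
  ultimately show ?thesis
    using assms mod unfolding cochain_complex_def graded_complex_def dg_module_def by blast
qed

text \<open>\<open>f\<close> sends the component of degree \<open>l\<close> into degree
  \<open>l\<close>, where \<open>\<pi> k\<close> is the identity or zero. In the exact sequences
  this makes the image of \<open>t - 1\<close> stable under the projections.\<close>

lemma grading_commute:
  assumes C: "grading C \<pi>" and f: "linear_dg C C f" and deg: "\<And>k. f ` comp C k \<subseteq> comp C k"
    and x: "x \<in> carrier C"
  shows "\<pi> k (f x) = f (\<pi> k x)"
proof -
  note mod = gradingD(1)[OF C] and lin = gradingD(2)[OF C] and comp = gradingD(3)[OF C]
    and proj = gradingD(4)[OF C] and dec = gradingD(5)[OF C]
  interpret dg_module C by (rule mod)
  note cl = linear_dg_closed[OF f] linear_dg_closed[OF lin]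
  obtain A where A: "finite A" "\<And>k. k \<notin> A \<Longrightarrow> \<pi> k x = \<zero>\<^bsub>C\<^esub>" "x = (\<Oplus>\<^bsub>C\<^esub>k\<in>A. \<pi> k x)"
    using dec[OF x] by blast
  have p: "\<pi> k (f (\<pi> l x)) = (if k = l then f (\<pi> k x) else \<zero>\<^bsub>C\<^esub>)" for l
  proof -
    have "f (\<pi> l x) \<in> comp C l" using deg[of l] comp x by blast
    then obtain y where y: "y \<in> carrier C" "f (\<pi> l x) = \<pi> l y" unfolding comp by blast
    then show ?thesis using proj[OF y(1), of k l] by auto
  qed
  have "f x = (\<Oplus>\<^bsub>C\<^esub>l\<in>A. f (\<pi> l x))"
    using linear_dg_finsum[OF mod mod f A(1), of "\<lambda>k. \<pi> k x"] A(3) cl x by auto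
  then have "\<pi> k (f x) = (\<Oplus>\<^bsub>C\<^esub>l\<in>A. \<pi> k (f (\<pi> l x)))"
    using linear_dg_finsum[OF mod mod lin A(1), of "\<lambda>l. f (\<pi> l x)" k] cl x by auto
  also have "\<dots> = (\<Oplus>\<^bsub>C\<^esub>l\<in>A. if k = l then f (\<pi> l x) else \<zero>\<^bsub>C\<^esub>)"
    by (rule M.finsum_cong') (auto simp: p cl x)
  also have "\<dots> = f (\<pi> k x)"
  proof (cases "k \<in> A")
    case True
    then show ?thesis using A(1) cl x by (subst M.add.finprod_singleton) auto
  next
    case False
    then have "(\<Oplus>\<^bsub>C\<^esub>l\<in>A. if k = l then f (\<pi> l x) else \<zero>\<^bsub>C\<^esub>) = (\<Oplus>\<^bsub>C\<^esub>l\<in>A. \<zero>\<^bsub>C\<^esub>)"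
      by (intro M.finsum_cong') auto
    with False show ?thesis by (simp add: A(2) linear_dg_zero[OF mod mod f])
  qed
  finally show ?thesis .
qed

locale dg_submodule = dg_module C for C :: "'a dgspace" (structure) +
  fixes S
  assumes sub: "submodule S complex_ring C"

sublocale dg_submodule \<subseteq> abelian_subgroup S C
  using sub by (intro abelian_subgroupI3 additive_subgroupI)
    (simp_all add: submodule_def M.abelian_group_axioms)

lemma (in dg_module) minus_eq_zero_iff:
  assumes "x \<in> carrier C" "y \<in> carrier C"
  shows "x \<ominus> y = \<zero> \<longleftrightarrow> x = y"
proof
  assume "x \<ominus> y = \<zero>"
  then have "(x \<oplus> \<ominus> y) \<oplus> y = y" using assms by (simp add: M.minus_eq)
  then show "x = y" using assms by (simp add: M.a_assoc M.l_neg)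
qed (use assms in \<open>simp add: M.minus_eq M.r_neg\<close>)

context dg_submodule
begin

lemma smult_sub: "x \<in> S \<Longrightarrow> c \<odot> x \<in> S"
  using submodule.smult_closed[OF sub] by simp

lemma coset_eq_iff:
  assumes "x \<in> carrier C" "y \<in> carrier C"
  shows "S +> x = S +> y \<longleftrightarrow> x \<ominus> y \<in> S"
proof
  assume "S +> x = S +> y"
  then have "x \<in> S +> y" using a_rcos_self[OF assms(1)] by simp
  then show "x \<ominus> y \<in> S"
    using a_rcos_module[OF assms(2,1)] by (simp add: M.minus_eq)
next
  assume "x \<ominus> y \<in> S"
  then have "x \<in> S +> y"
    using a_rcos_module[OF assms(2,1)] by (simp add: M.minus_eq)
  then show "S +> x = S +> y"
    using a_repr_independence'[of x y] assms by simp
qed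

lemma coset_eq_sub_iff: "x \<in> carrier C \<Longrightarrow> S +> x = S \<longleftrightarrow> x \<in> S"
  using M.a_coset_join1 M.a_coset_join2 a_subgroup by blast

lemma quot_carrier: "carrier (quot_dg C S) = (\<lambda>x. S +> x) ` carrier C"
  by (auto simp: quot_dg_def A_RCOSETS_def RCOSETS_def a_r_coset_def)

lemma quot_comp: "comp (quot_dg C S) k = (\<lambda>x. S +> x) ` comp C k"
  by (simp add: quot_dg_def)

lemma quot_zero: "\<zero>\<^bsub>quot_dg C S\<^esub> = S +> \<zero>"
  using a_coset_add_zero[OF a_subset] by (simp add: quot_dg_def)

lemma quot_add:
  "x \<in> carrier C \<Longrightarrow> y \<in> carrier C \<Longrightarrow>
    (S +> x) \<oplus>\<^bsub>quot_dg C S\<^esub> (S +> y) = S +> (x \<oplus> y)"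
  by (simp add: quot_dg_def a_rcos_sum)

text \<open>\<open>coset_map\<close> is a union over all representatives; stability of
  \<open>S\<close> under \<open>f\<close> makes all members of that union the same coset.\<close>

lemma coset_map_eq:
  assumes f: "linear_dg C C f" and S: "f ` S \<subseteq> S" and x: "x \<in> carrier C"
  shows "coset_map C S f (S +> x) = S +> f x"
proof -
  note mod = dg_module_axioms
  have "S +> f a = S +> f x" if "a \<in> S +> x" for a
  proof -
    have a: "a \<in> carrier C" using that a_r_coset_subset_G[OF a_subset x] by blast
    have "a \<ominus> x \<in> S" using that a_rcos_module[OF x a] by (simp add: M.minus_eq)
    then have "f (a \<ominus> x) \<in> S" using S by blast
    then show ?thesis
      using a x linear_dg_closed[OF f] by (simp add: coset_eq_iff linear_dg_minus[OF mod mod f])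
  qed
  then show ?thesis
    unfolding coset_map_def using a_rcos_self[OF x] by blast
qed

lemma smult_linear: "linear_dg C C (\<lambda>x. c \<odot> x)"
  unfolding linear_dg_def
proof (intro conjI ballI allI funcsetI)
  fix d x assume x: "x \<in> carrier C"
  show "c \<odot> (d \<odot> x) = d \<odot> (c \<odot> x)"
    using x smult_assoc1[of c d x] smult_assoc1[of d c x] by (simp add: mult.commute)
qed (simp_all add: smult_r_distr)

lemma quot_smult: "x \<in> carrier C \<Longrightarrow> c \<odot>\<^bsub>quot_dg C S\<^esub> (S +> x) = S +> (c \<odot> x)"
  using coset_map_eq[OF smult_linear, of c x] smult_sub by (auto simp: quot_dg_def)

lemma quot_module: "dg_module (quot_dg C S)"
proof (rule dg_moduleI)
  note q = quot_carrier quot_add quot_smult quot_zero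
  show "abelian_group (quot_dg C S)"
  proof (rule abelian_groupI)
    fix X assume "X \<in> carrier (quot_dg C S)"
    then obtain x where x: "x \<in> carrier C" "X = S +> x" by (auto simp: quot_carrier)
    then show "\<exists>Y\<in>carrier (quot_dg C S). Y \<oplus>\<^bsub>quot_dg C S\<^esub> X = \<zero>\<^bsub>quot_dg C S\<^esub>"
      by (intro bexI[of _ "S +> (\<ominus> x)"]) (simp_all add: q M.l_neg)
  qed (auto simp: q M.a_ac)
qed (auto simp: quot_carrier quot_add quot_smult smult_l_distr[simplified] smult_r_distr[simplified]
    smult_assoc1[simplified] smult_one[simplified])

lemma proj_linear: "linear_dg C (quot_dg C S) (\<lambda>x. S +> x)"
  by (auto simp: linear_dg_def quot_carrier quot_add quot_smult)

lemma coset_map_linear: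
  assumes f: "linear_dg C C f" and S: "f ` S \<subseteq> S"
  shows "linear_dg (quot_dg C S) (quot_dg C S) (coset_map C S f)"
  using linear_dg_closed[OF f]
  by (auto simp: linear_dg_def quot_carrier quot_add quot_smult coset_map_eq[OF assms]
      linear_dg_add[OF f] linear_dg_smult[OF f])

lemma quot_grading:
  assumes gr: "grading C \<pi>" and S: "\<And>k. \<pi> k ` S \<subseteq> S"
  shows "grading (quot_dg C S) (\<lambda>k. coset_map C S (\<pi> k))"
proof -
  note lin = gradingD(2)[OF gr] and cl = linear_dg_closed[OF gradingD(2)[OF gr]]
  note map = coset_map_eq[OF lin S]
  have "\<exists>A. finite A \<and> (\<forall>k. k \<notin> A \<longrightarrow> coset_map C S (\<pi> k) X = \<zero>\<^bsub>quot_dg C S\<^esub>) \<and>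
      X = (\<Oplus>\<^bsub>quot_dg C S\<^esub>k\<in>A. coset_map C S (\<pi> k) X)" if X: "X \<in> carrier (quot_dg C S)" for X
  proof -
    obtain x where x: "x \<in> carrier C" "X = S +> x" using X by (auto simp: quot_carrier)
    obtain A where A: "finite A" "\<And>k. k \<notin> A \<Longrightarrow> \<pi> k x = \<zero>" "x = (\<Oplus>k\<in>A. \<pi> k x)"
      using gradingD(5)[OF gr x(1)] by blast
    have cm: "coset_map C S (\<pi> k) X = S +> \<pi> k x" for k
      using x map by simp
    have "S +> (\<Oplus>k\<in>A. \<pi> k x) = (\<Oplus>\<^bsub>quot_dg C S\<^esub>k\<in>A. S +> \<pi> k x)"
      using linear_dg_finsum[OF dg_module_axioms quot_module proj_linear A(1), of "\<lambda>k. \<pi> k x"]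
        cl[OF x(1)] by simp
    then have "X = (\<Oplus>\<^bsub>quot_dg C S\<^esub>k\<in>A. coset_map C S (\<pi> k) X)"
      unfolding cm by (simp only: x(2) flip: A(3))
    moreover have "\<forall>k. k \<notin> A \<longrightarrow> coset_map C S (\<pi> k) X = \<zero>\<^bsub>quot_dg C S\<^esub>"
      using A(2) by (simp add: cm quot_zero)
    ultimately show ?thesis using A(1) by (intro exI[of _ A] conjI)
  qed
  moreover have "comp (quot_dg C S) k = coset_map C S (\<pi> k) ` carrier (quot_dg C S)" for k
    by (simp add: quot_comp quot_carrier gradingD(3)[OF gr] image_image map cong: image_cong)
  moreover have "coset_map C S (\<pi> k) (coset_map C S (\<pi> l) X) =
      (if k = l then coset_map C S (\<pi> k) X else \<zero>\<^bsub>quot_dg C S\<^esub>)"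
    if "X \<in> carrier (quot_dg C S)" for k l X
    using that gradingD(4)[OF gr, of _ k l]
    by (auto simp: quot_carrier map cl quot_zero)
  ultimately show ?thesis
    using coset_map_linear[OF lin S] quot_module by (intro gradingI)
qed

lemma quot_graded_complex:
  assumes gc: "graded_complex C \<pi>" and S: "\<And>k. \<pi> k ` S \<subseteq> S" and d: "diff C ` S \<subseteq> S"
  shows "graded_complex (quot_dg C S) (\<lambda>k. coset_map C S (\<pi> k))"
proof -
  have gr: "grading C \<pi>" and lin: "linear_dg C C (diff C)"
    and deg: "\<And>k. diff C ` comp C k \<subseteq> comp C (Suc k)"
    and dd: "\<And>x. x \<in> carrier C \<Longrightarrow> diff C (diff C x) = \<zero>"
    using gc by (auto simp: graded_complex_def)
  have car: "x \<in> carrier C" if "x \<in> comp C k" for x k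
    using that linear_dg_closed[OF gradingD(2)[OF gr]] by (auto simp: gradingD(3)[OF gr])
  have diff: "diff (quot_dg C S) = coset_map C S (diff C)" by (simp add: quot_dg_def)
  note map = coset_map_eq[OF lin d]
  have "coset_map C S (diff C) ` comp (quot_dg C S) k \<subseteq> comp (quot_dg C S) (Suc k)" for k
    using deg[of k] car by (auto simp: quot_comp map)
  then show ?thesis
    unfolding graded_complex_def diff
    using quot_grading[OF gr S] coset_map_linear[OF lin d] linear_dg_closed[OF lin]
    by (auto simp: quot_carrier map dd quot_zero)
qed

end

lemma sub_dg_simps [simp]:
  "carrier (sub_dg C S) = S" "zero (sub_dg C S) = zero C" "add (sub_dg C S) = add C"
  "smult (sub_dg C S) = smult C" "mult (sub_dg C S) = mult C" "one (sub_dg C S) = one C"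
  "comp (sub_dg C S) = (\<lambda>k. comp C k \<inter> S)" "diff (sub_dg C S) = diff C"
  by (simp_all add: sub_dg_def)

context dg_submodule
begin

lemma sub_dg_module: "dg_module (sub_dg C S)"
proof (rule dg_moduleI)
  show "abelian_group (sub_dg C S)"
  proof (rule abelian_groupI)
    fix x assume x: "x \<in> carrier (sub_dg C S)"
    then show "\<exists>y\<in>carrier (sub_dg C S). y \<oplus>\<^bsub>sub_dg C S\<^esub> x = \<zero>\<^bsub>sub_dg C S\<^esub>"
      using a_Hcarr[of x] by (intro bexI[of _ "\<ominus> x"]) (simp_all add: M.l_neg)
  qed (use a_subset in \<open>auto simp: M.a_ac subset_eq\<close>)
qed (use a_subset in \<open>auto simp: subset_eq smult_sub smult_l_distr[simplified]
    smult_r_distr[simplified] smult_assoc1[simplified] smult_one[simplified]\<close>)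

lemma sub_linear:
  "linear_dg C C f \<Longrightarrow> f ` S \<subseteq> S \<Longrightarrow> linear_dg (sub_dg C S) (sub_dg C S) f"
  using a_subset by (auto simp: linear_dg_def subset_eq)

lemma sub_incl_linear: "linear_dg (sub_dg C S) C (\<lambda>x. x)"
  using a_subset by (auto simp: linear_dg_def)

lemma sub_graded_complex:
  assumes gc: "graded_complex C \<pi>" and S: "\<And>k. \<pi> k ` S \<subseteq> S" and d: "diff C ` S \<subseteq> S"
  shows "graded_complex (sub_dg C S) \<pi>"
proof -
  have gr: "grading C \<pi>" and lin: "linear_dg C C (diff C)"
    and deg: "\<And>k. diff C ` comp C k \<subseteq> comp C (Suc k)"
    and dd: "\<And>x. x \<in> carrier C \<Longrightarrow> diff C (diff C x) = \<zero>"
    using gc by (auto simp: graded_complex_def)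
  have car: "x \<in> carrier C" if "x \<in> S" for x using that a_subset by blast
  have idem: "\<pi> k x = x" if "x \<in> comp C k" for x k
    using that gradingD(4)[OF gr] by (auto simp: gradingD(3)[OF gr])
  have "comp (sub_dg C S) k = \<pi> k ` carrier (sub_dg C S)" for k
  proof
    show "comp (sub_dg C S) k \<subseteq> \<pi> k ` carrier (sub_dg C S)"
      using idem by (auto intro!: image_eqI[where f = "\<pi> k"])
    show "\<pi> k ` carrier (sub_dg C S) \<subseteq> comp (sub_dg C S) k"
      using S[of k] car by (auto simp: gradingD(3)[OF gr])
  qed
  moreover have "\<exists>A. finite A \<and> (\<forall>k. k \<notin> A \<longrightarrow> \<pi> k x = \<zero>\<^bsub>sub_dg C S\<^esub>) \<and>
      x = (\<Oplus>\<^bsub>sub_dg C S\<^esub>k\<in>A. \<pi> k x)" if x: "x \<in> carrier (sub_dg C S)" for x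
  proof -
    have xC: "x \<in> carrier C" using x car by simp
    obtain A where A: "finite A" "\<And>k. k \<notin> A \<Longrightarrow> \<pi> k x = \<zero>" "x = (\<Oplus>k\<in>A. \<pi> k x)"
      using gradingD(5)[OF gr xC] by blast
    \<comment> \<open>Sums formed in the subcomplex and in \<open>C\<close> agree because the
      inclusion is linear.\<close>
    have "(\<lambda>k. \<pi> k x) \<in> A \<rightarrow> carrier (sub_dg C S)" using S x by auto
    then have "(\<Oplus>\<^bsub>sub_dg C S\<^esub>k\<in>A. \<pi> k x) = (\<Oplus>k\<in>A. \<pi> k x)"
      by (rule linear_dg_finsum[OF sub_dg_module dg_module_axioms sub_incl_linear A(1)])
    with A show ?thesis by (intro exI[of _ A]) simp
  qed
  ultimately have "grading (sub_dg C S) \<pi>"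
    using sub_dg_module sub_linear[OF gradingD(2)[OF gr] S] gradingD(4)[OF gr] car
    by (intro gradingI) (assumption | simp)+
  moreover have "diff C ` (comp C k \<inter> S) \<subseteq> comp C (Suc k) \<inter> S" for k
    using deg[of k] d by blast
  ultimately show ?thesis
    unfolding graded_complex_def using sub_linear[OF lin d] dd car by simp
qed

end

lemma (in dg_module) inv_eq_smult: "x \<in> carrier C \<Longrightarrow> \<ominus> x = (-1) \<odot> x"
  using smult_l_distr[of "-1" 1 x] smult_one[of x] smult_closed[of "-1" x] smult_l_null[of x]
  by (intro M.minus_equality) simp_all

lemma (in dg_module) dg_submoduleI:
  assumes "H \<subseteq> carrier C" "\<zero> \<in> H" "\<And>x y. x \<in> H \<Longrightarrow> y \<in> H \<Longrightarrow> x \<oplus> y \<in> H"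
    and "\<And>c x. x \<in> H \<Longrightarrow> c \<odot> x \<in> H"
  shows "dg_submodule C H"
  unfolding dg_submodule_def dg_submodule_axioms_def
  using assms inv_eq_smult by (intro conjI dg_module_axioms submoduleI) auto

lemma submodule_span_eqI:
  assumes "submodule T complex_ring C" "G \<subseteq> T"
    and "\<And>S. submodule S complex_ring C \<Longrightarrow> G \<subseteq> S \<Longrightarrow> T \<subseteq> S"
  shows "submodule_span C G = T"
  unfolding submodule_span_def using assms by blast

subsection \<open>Exact sequences of coinvariants\<close>

text \<open>The common form of both sequences, with \<open>T\<close> in the role of
  \<open>t - 1\<close>. Exactness is contained in \<open>kerT\<close> and \<open>kerN\<close>; the
  latter makes \<open>N\<close> both well defined and injective on cosets of \<open>S\<close>. The
  relation \<open>Tb\<close> serves twice: it makes \<open>T\<close> a chain map, and it shows that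
  its image \<open>S\<close> is stable under \<open>diff C\<close>.\<close>

lemma exact_coinvariants:
  fixes C :: "'a dgspace" (structure)
  assumes gc: "graded_complex C \<pi>" and gcb: "graded_complex (C\<lparr>diff := b\<rparr>) \<pi>"
    and T: "linear_dg C C T" "\<And>k. T ` comp C k \<subseteq> comp C k"
    and N: "linear_dg C C N" "\<And>k. N ` comp C k \<subseteq> comp C k"
    and Tb: "\<And>x. x \<in> carrier C \<Longrightarrow> T (b x) = diff C (T x)"
    and bN: "\<And>x. x \<in> carrier C \<Longrightarrow> b (N x) = N (diff C x)"
    and S: "S = T ` carrier C"
    and kerT: "\<And>x. x \<in> carrier C \<Longrightarrow> T x = \<zero>\<^bsub>C\<^esub> \<longleftrightarrow> x \<in> N ` carrier C"
    and kerN: "\<And>x. x \<in> carrier C \<Longrightarrow> N x = \<zero>\<^bsub>C\<^esub> \<longleftrightarrow> x \<in> S"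
  shows "exact_complexes (quot_dg C S) (descend N) (C\<lparr>diff := b\<rparr>) T C (\<lambda>x. S +>\<^bsub>C\<^esub> x) (quot_dg C S)"
proof -
  have gr: "grading C \<pi>" and d: "linear_dg C C (diff C)"
    and deg: "\<And>k. diff C ` comp C k \<subseteq> comp C (Suc k)"
    using gc by (auto simp: graded_complex_def)
  note mod = gradingD(1)[OF gr]
  interpret dg_submodule C S
    unfolding dg_submodule_def dg_submodule_axioms_def S
    using mod linear_dg_image_submodule[OF mod mod T(1)] by blast
  have b: "linear_dg C C b" "\<And>k. b ` comp C k \<subseteq> comp C (Suc k)"
    using gcb by (auto simp: graded_complex_def linear_dg_def)
  note cl = linear_dg_closed[OF T(1)] linear_dg_closed[OF N(1)] linear_dg_closed[OF b(1)]
    linear_dg_closed[OF d]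
  have car: "x \<in> carrier C" if "x \<in> comp C k" for x k
    using that linear_dg_closed[OF gradingD(2)[OF gr]] by (auto simp: gradingD(3)[OF gr])
  have \<pi>S: "\<pi> k ` S \<subseteq> S" for k
    using linear_dg_closed[OF gradingD(2)[OF gr]] grading_commute[OF gr T] by (auto simp: S)
  have dS: "diff C ` S \<subseteq> S"
    using cl Tb[symmetric] by (auto simp: S)
  have gq: "graded_complex (quot_dg C S) (\<lambda>k. coset_map C S (\<pi> k))"
    by (rule quot_graded_complex[OF gc \<pi>S dS])
  have N_eq: "N x = N y" if "x \<in> carrier C" "y \<in> carrier C" "S +> x = S +> y" for x y
  proof -
    have "N (x \<ominus> y) = \<zero>" using that kerN[of "x \<ominus> y"] by (simp add: coset_eq_iff)
    then show ?thesis
      using that cl by (simp add: linear_dg_minus[OF mod mod N(1)] minus_eq_zero_iff)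
  qed
  have desc: "descend N (S +> x) = N x" if x: "x \<in> carrier C" for x
  proof -
    \<comment> \<open>\<open>descend\<close> takes the element of the image of a coset, so this
      image has to be a singleton.\<close>
    have "N y = N x" if y: "y \<in> S +> x" for y
    proof (rule N_eq[OF _ x])
      show "y \<in> carrier C" using y a_r_coset_subset_G[OF a_subset x] by (rule subsetD[rotated])
      show "S +> y = S +> x" by (rule a_repr_independence'[OF y x, symmetric])
    qed
    then have "N ` (S +> x) = (\<lambda>_. N x) ` (S +> x)"
      by (rule image_cong[OF refl])
    also have "\<dots> = {N x}" by (rule image_constant[OF a_rcos_self[OF x]])
    finally show ?thesis by (simp add: descend_def)
  qed
  have inj: "inj_on (descend N) (carrier (quot_dg C S))"
  proof (rule inj_onI)
    fix X Y assume "X \<in> carrier (quot_dg C S)" "Y \<in> carrier (quot_dg C S)"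
      and eq: "descend N X = descend N Y"
    then obtain x y where xy: "x \<in> carrier C" "y \<in> carrier C" "X = S +> x" "Y = S +> y"
      by (auto simp: quot_carrier)
    then have "N (x \<ominus> y) = \<zero>"
      using eq cl by (simp add: desc linear_dg_minus[OF mod mod N(1)] minus_eq_zero_iff)
    then show "X = Y" using xy by (simp add: coset_eq_iff kerN)
  qed
  have diffq: "diff (quot_dg C S) = coset_map C S (diff C)" by (simp add: quot_dg_def)
  have Ndeg: "N x \<in> comp C k" if "x \<in> comp C k" for x k using that N(2) by blast
  have Nmap: "cochain_map (quot_dg C S) (C\<lparr>diff := b\<rparr>) (descend N)"
    using cl N(1) Ndeg car
    by (auto simp: cochain_map_def linear_dg_def quot_carrier quot_add quot_smult quot_comp desc
      diffq coset_map_eq[OF d dS] bN)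
  have Tmap: "cochain_map (C\<lparr>diff := b\<rparr>) C T"
    using T Tb by (auto simp: cochain_map_def linear_dg_def)
  have Pmap: "cochain_map C (quot_dg C S) (\<lambda>x. S +> x)"
    using proj_linear
    by (auto simp: cochain_map_def quot_comp coset_map_eq[OF d dS] diffq)
  have "descend N ` carrier (quot_dg C S) = a_kernel (C\<lparr>diff := b\<rparr>) C T"
    using kerT cl by (auto simp: a_kernel_def' quot_carrier desc image_iff)
  moreover have "T ` carrier (C\<lparr>diff := b\<rparr>) = a_kernel C (quot_dg C S) (\<lambda>x. S +> x)"
  proof -
    have "a_kernel C (quot_dg C S) (\<lambda>x. S +> x) = {x \<in> carrier C. S +> x = S}"
      by (simp add: a_kernel_def' quot_dg_def)
    also have "\<dots> = {x \<in> carrier C. x \<in> S}"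
      by (rule Collect_cong) (simp add: coset_eq_sub_iff cong: conj_cong)
    also have "\<dots> = S" using a_subset by blast
    finally show ?thesis using S by simp
  qed
  ultimately show ?thesis
    unfolding exact_complexes_def
    using graded_complex_imp_cochain_complex[OF gq] graded_complex_imp_cochain_complex[OF gc]
      graded_complex_imp_cochain_complex[OF gcb] Nmap Tmap Pmap inj quot_carrier by simp
qed

subsection \<open>Spans of words\<close>

lemma clinear_ident: "clinear (\<lambda>x. x)"
  by (simp add: clinear_iff)

lemma clinear_zero: "clinear (\<lambda>x. 0)"
  by (simp add: clinear_iff)

lemma clinear_compose: "clinear g \<Longrightarrow> clinear f \<Longrightarrow> clinear (\<lambda>x. g (f x))"
  by (simp add: clinear_iff)

lemma clinear_add: "clinear f \<Longrightarrow> clinear g \<Longrightarrow> clinear (\<lambda>x. f x + g x)"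
  and clinear_diff: "clinear f \<Longrightarrow> clinear g \<Longrightarrow> clinear (\<lambda>x. f x - g x)"
  and clinear_minus: "clinear f \<Longrightarrow> clinear (\<lambda>x. - f x)"
  and clinear_scale: "clinear f \<Longrightarrow> clinear (\<lambda>x. c *\<^sub>C f x)"
  by (simp_all add: clinear_iff cvec.scale_right_distrib cvec.scale_right_diff_distrib
      mult.commute algebra_simps)

lemma clinear_sum: "(\<And>i. clinear (f i)) \<Longrightarrow> clinear (\<lambda>x. \<Sum>i\<in>A. f i x)"
  by (simp add: clinear_iff sum.distrib cvec.scale_sum_right)

lemma clinear_mult:
  fixes f :: "'a::complex_vector \<Rightarrow> 'h::complex_vector weil"
  shows "clinear f \<Longrightarrow> clinear (\<lambda>x. a * f x)" "clinear f \<Longrightarrow> clinear (\<lambda>x. f x * a)"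
  by (simp_all add: weil_linear_simps)

lemmas clinear_intros = clinear_ident clinear_zero clinear_add clinear_diff
  clinear_minus clinear_scale clinear_sum clinear_mult

lemma clinearD:
  assumes "clinear f"
  shows "f (x + y) = f x + f y" "f (c *\<^sub>C x) = c *\<^sub>C f x" "f 0 = 0" "f (x - y) = f x - f y"
    and "f (- x) = - f x" "f (\<Sum>i\<in>A. g i) = (\<Sum>i\<in>A. f (g i))"
proof -
  interpret Vector_Spaces.linear scaleC scaleC f by (rule assms)
  show "f (x + y) = f x + f y" "f (c *\<^sub>C x) = c *\<^sub>C f x" "f 0 = 0" "f (x - y) = f x - f y"
    "f (- x) = - f x" "f (\<Sum>i\<in>A. g i) = (\<Sum>i\<in>A. f (g i))"
    by (simp_all add: add scale diff neg sum)
qed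

text \<open>
  The predicate is evaluated at the length and the degree of a word, whose difference is the number
  of letters of the form \<open>\<omega>\<^sub>h\<close>.
\<close>

definition wspan :: "(nat \<Rightarrow> nat \<Rightarrow> bool) \<Rightarrow> 'h::complex_vector weil set"
  where "wspan P = cspan {monom w | w. P (length w) (wdeg w)}"

abbreviation hom_part :: "nat \<Rightarrow> nat \<Rightarrow> 'h::complex_vector weil set"
  where "hom_part p q \<equiv> wspan (\<lambda>p' q'. p' = p \<and> q' = q)"

lemma subspace_wspan: "cvec.subspace (wspan P)"
  by (simp add: wspan_def cvec.subspace_span)

lemmas wspan_closed [simp, intro] =
  cvec.subspace_0[OF subspace_wspan] cvec.subspace_add[OF subspace_wspan]
  cvec.subspace_diff[OF subspace_wspan] cvec.subspace_neg[OF subspace_wspan]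
  cvec.subspace_scale[OF subspace_wspan] cvec.subspace_sum[OF subspace_wspan]

lemma monom_in_wspan: "P (length w) (wdeg w) \<Longrightarrow> monom w \<in> wspan P"
  unfolding wspan_def by (rule cvec.span_base) blast

lemma linear_wspan_subspace:
  assumes "clinear f" "cvec.subspace V" "\<And>w. P (length w) (wdeg w) \<Longrightarrow> f (monom w) \<in> V"
    and "x \<in> wspan P"
  shows "f x \<in> V"
  using assms(4) unfolding wspan_def
proof (induct rule: cvec.span_induct_alt)
  case base
  then show ?case using assms by (simp add: clinearD cvec.subspace_0)
next
  case (step c x y)
  then obtain w where "P (length w) (wdeg w)" "x = monom w" by blast
  with step assms show ?case
    by (simp add: clinearD cvec.subspace_add cvec.subspace_scale)
qed

lemmas linear_wspan = linear_wspan_subspace[OF _ subspace_wspan]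

lemma wspan_mono: "(\<And>p q. P p q \<Longrightarrow> R p q) \<Longrightarrow> x \<in> wspan P \<Longrightarrow> x \<in> wspan R"
  by (rule linear_wspan[OF clinear_ident]) (simp_all add: monom_in_wspan)

lemma linear_eq_on_wspan:
  assumes "clinear f" "clinear g" "\<And>w. P (length w) (wdeg w) \<Longrightarrow> f (monom w) = g (monom w)"
    and "x \<in> wspan P"
  shows "f x = g x"
proof -
  have "f x - g x \<in> {0}"
    by (rule linear_wspan_subspace[OF clinear_diff[OF assms(1,2)] cvec.subspace_single_0 _ assms(4)])
      (simp add: assms(3))
  then show ?thesis by simp
qed

lemma wspan_UNIV: "wspan (\<lambda>_ _. True) = (UNIV :: 'h::complex_vector weil set)"
proof -
  have "x \<in> wspan (\<lambda>_ _. True)" for x :: "'h weil"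
  proof -
    obtain p where x: "x = abs_weil p"
      by (metis Quotient3_abs_rep Quotient3_weil)
    have "abs_weil p \<in> wspan (\<lambda>_ _. True)"
      using free_expand[of p]
    proof (induct rule: cvec.span_induct_alt)
      case base
      then show ?case using wspan_closed(1) by (simp add: zero_weil.abs_eq)
    next
      case (step c y z)
      then obtain w where "y = Poly_Mapping.single (Word w) 1" by (metis imageE word.exhaust)
      then have "abs_weil (c *\<^sub>C y + z) = c *\<^sub>C monom w + abs_weil z"
        by (simp add: monom_abs plus_weil.abs_eq scaleC_weil.abs_eq)
      then show ?case using step monom_in_wspan[of "\<lambda>_ _. True" w] by simp
    qed
    then show ?thesis using x by simp
  qed
  then show ?thesis by auto
qed

lemma linear_eq:
  assumes "clinear f" "clinear g" "\<And>w. f (monom w) = g (monom w)"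
  shows "f x = g x"
  by (rule linear_eq_on_wspan[OF assms(1,2), of "\<lambda>_ _. True"]) (simp_all add: assms(3) wspan_UNIV)

lemma wspan_mult:
  fixes x y :: "'h::complex_vector weil"
  assumes x: "x \<in> wspan P" and y: "y \<in> wspan R"
    and S: "\<And>p q p' q'. P p q \<Longrightarrow> R p' q' \<Longrightarrow> S (p + p') (q + q')"
  shows "x * y \<in> wspan S"
proof (rule linear_wspan[OF _ _ x])
  fix u :: "'h gen list" assume u: "P (length u) (wdeg u)"
  show "monom u * y \<in> wspan S"
    by (rule linear_wspan[OF _ _ y]) (use S[OF u] in \<open>auto intro!: clinear_intros
      simp: monom_in_wspan simp flip: monom_simps(3)\<close>)
qed (intro clinear_intros)

lemma hom_part_mult:
  "x \<in> hom_part p q \<Longrightarrow> y \<in> hom_part p' q' \<Longrightarrow> x * y \<in> hom_part (p + p') (q + q')"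
  by (erule (1) wspan_mult) simp

lemma gen_hom: "gen a \<in> hom_part 1 (gdeg a)"
  using monom_in_wspan[of "\<lambda>p q. p = 1 \<and> q = gdeg a" "[a]"] by simp

lemma one_hom: "1 \<in> hom_part 0 0"
  using monom_in_wspan[of "\<lambda>p q. p = 0 \<and> q = 0" "[]"] by simp

lemma monom_hom: "monom w \<in> hom_part (length w) (wdeg w)"
  by (rule monom_in_wspan) simp

text \<open>Operators given by a formula that depends on the length \<open>p\<close> and the degree
  \<open>q\<close> of a word. Such a formula is compatible with the linearity relations because
  changing \<open>h\<close> inside a letter changes neither number.\<close>

definition shape_ext ::
    "(nat \<Rightarrow> nat \<Rightarrow> 'h::complex_vector weil \<Rightarrow> 'h weil) \<Rightarrow> 'h weil \<Rightarrow> 'h weil"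
  where "shape_ext F = weil_ext (\<lambda>w. F (length w) (wdeg w) (monom w))"

context
  fixes F :: "nat \<Rightarrow> nat \<Rightarrow> 'h::complex_vector weil \<Rightarrow> 'h weil"
  assumes F: "\<And>p q. clinear (F p q)"
begin

lemma shape_ext_letterwise: "letterwise_linear (\<lambda>w. F (length w) (wdeg w) (monom w))"
proof -
  have "clinear (\<lambda>h. gen (Gen h))" "clinear (\<lambda>h. gen (Curv h))"
    by (simp_all add: clinear_iff gen_linear)
  then show ?thesis
    by (auto simp: letterwise_linear_def intro!: clinear_compose[OF F] clinear_intros)
qed

lemma shape_ext_linear: "clinear (shape_ext F)"
  unfolding shape_ext_def by (rule weil_ext_linear[OF shape_ext_letterwise])

lemma shape_ext_monom: "shape_ext F (monom w) = F (length w) (wdeg w) (monom w)"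
  unfolding shape_ext_def by (rule weil_ext_monom[OF shape_ext_letterwise])

lemma shape_ext_hom: "x \<in> hom_part p q \<Longrightarrow> shape_ext F x = F p q x"
  by (rule linear_eq_on_wspan[OF shape_ext_linear F]) (auto simp: shape_ext_monom)

end

text \<open>The Koszul sign for moving an element of degree \<open>k\<close> past the argument. As a
  linear operator it lets sign rules be stated for inhomogeneous elements.\<close>

definition sgn_op :: "nat \<Rightarrow> 'h::complex_vector weil \<Rightarrow> 'h weil"
  where "sgn_op k = shape_ext (\<lambda>p q x. ((-1) ^ (k * q)) *\<^sub>C x)"

lemma sgn_op_linear: "clinear (sgn_op k)"
  unfolding sgn_op_def by (rule shape_ext_linear) (intro clinear_intros)

lemma sgn_op_hom: "x \<in> hom_part p q \<Longrightarrow> sgn_op k x = ((-1) ^ (k * q)) *\<^sub>C x"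
  unfolding sgn_op_def by (rule shape_ext_hom) (intro clinear_intros)

lemma sgn_op_monom: "sgn_op k (monom w) = ((-1) ^ (k * wdeg w)) *\<^sub>C monom w"
  by (rule sgn_op_hom[OF monom_hom])

lemma sgn_op_gen: "sgn_op k (gen a) = ((-1) ^ (k * gdeg a)) *\<^sub>C gen a"
  by (rule sgn_op_hom[OF gen_hom])

lemma sgn_op_one [simp]: "sgn_op k 1 = 1"
  using sgn_op_hom[OF one_hom, of k] by simp

lemma sgn_op_mult: "sgn_op k (x * y) = sgn_op k x * sgn_op k y"
proof -
  have "sgn_op k (monom u * y) = sgn_op k (monom u) * sgn_op k y" for u
  proof (rule linear_eq[where x = y])
    fix w
    show "sgn_op k (monom u * monom w) = sgn_op k (monom u) * sgn_op k (monom w)"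
      using sgn_op_monom[of k "u @ w"]
      by (simp add: sgn_op_monom scaleC_mult_weil distrib_left power_add mult.commute)
  qed (intro clinear_intros clinear_compose[OF sgn_op_linear] sgn_op_linear)+
  note * = this
  show ?thesis
    by (rule linear_eq[where x = x])
      (intro clinear_intros clinear_compose[OF sgn_op_linear] sgn_op_linear | rule *)+
qed

lemma sgn_op_sgn_op: "sgn_op k (sgn_op l x) = sgn_op (k + l) x"
  by (rule linear_eq[where x = x])
    (intro clinear_compose[OF sgn_op_linear] sgn_op_linear |
      simp add: sgn_op_monom clinearD[OF sgn_op_linear] power_add algebra_simps)+

subsection \<open>The cyclic operator\<close>

lemma weil_t_gen: "weil_t (gen a * x) = sgn_op (gdeg a) x * gen a"
  by (rule linear_eq[where x = x])
    (intro clinear_intros clinear_compose[OF weil_t_eqs(1)] sgn_op_linear |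
      simp add: weil_t_eqs(2) sgn_op_monom weil_sign scaleC_mult_weil)+

lemma weil_t_one [simp]: "weil_t 1 = 1"
  using weil_ext_monom[OF t_word_linear, of "[]"] by (simp add: weil_t_def)

text \<open>A block of \<open>p\<close> letters is moved to the end as a whole, with the single
  Koszul sign of its total degree. For \<open>x = 1\<close> this is \<open>t^p = 1\<close>; for
  words it turns graded commutators into values of \<open>1 - t^p\<close>.\<close>

lemma weil_t_pow_hom: "z \<in> hom_part p q \<Longrightarrow> (weil_t ^^ p) (z * x) = sgn_op q x * z"
proof -
  have *: "(weil_t ^^ length w) (monom w * x) = sgn_op (wdeg w) x * monom w" for w
  proof (induct w arbitrary: x)
    case Nil
    have "sgn_op 0 x = x"
      unfolding sgn_op_def by (rule linear_eq[where x = x])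
        (intro clinear_intros shape_ext_linear | simp add: shape_ext_monom clinear_intros)+
    then show ?case by simp
  next
    case (Cons a w)
    have "(weil_t ^^ length (a # w)) (monom (a # w) * x)
        = (weil_t ^^ length w) (sgn_op (gdeg a) (monom w * x) * gen a)"
      by (simp add: funpow_Suc_right mult.assoc weil_t_gen del: funpow.simps)
    also have "\<dots> = ((-1) ^ (gdeg a * wdeg w)) *\<^sub>C
        (weil_t ^^ length w) (monom w * (sgn_op (gdeg a) x * gen a))"
      by (simp add: sgn_op_mult sgn_op_monom scaleC_mult_weil mult.assoc
          clinearD[OF weil_t_pow_linear])
    \<comment> \<open>The sign of \<open>a\<close> against \<open>w\<close> occurs twice, once when
      \<open>a\<close> passes \<open>w\<close> and once when \<open>w\<close> passes
      \<open>a\<close>, and cancels.\<close>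
    also have "\<dots> = sgn_op (wdeg (a # w)) x * monom (a # w)"
      unfolding Cons
      by (simp add: sgn_op_mult sgn_op_gen sgn_op_sgn_op scaleC_mult_weil mult.assoc add.commute
          mult.commute[of "gdeg a"] scaleC_scaleC scaleC_one flip: power_add mult_2)
    finally show ?case .
  qed
  assume z: "z \<in> hom_part p q"
  show ?thesis
    by (rule linear_eq_on_wspan[OF _ _ _ z])
      (intro clinear_intros clinear_compose[OF weil_t_pow_linear] | use * in force)+
qed

lemma weil_t_pow_length: "x \<in> hom_part p q \<Longrightarrow> (weil_t ^^ p) x = x"
  using weil_t_pow_hom[of x p q 1] by simp

lemma weil_t_hom: "x \<in> hom_part p q \<Longrightarrow> weil_t x \<in> hom_part p q"
proof (erule linear_wspan[OF weil_t_eqs(1), rotated])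
  fix w :: "'a gen list" assume w: "length w = p \<and> wdeg w = q"
  show "weil_t (monom w) \<in> hom_part p q"
  proof (cases w)
    case (Cons a v)
    have "monom v * gen a \<in> hom_part (length v + 1) (wdeg v + gdeg a)"
      by (rule hom_part_mult[OF monom_hom gen_hom])
    then show ?thesis
      using w Cons by (simp add: weil_t_gen sgn_op_monom scaleC_mult_weil add.commute)
  qed (use w one_hom in simp)
qed

lemma weil_t_pow_closed: "x \<in> hom_part p q \<Longrightarrow> (weil_t ^^ i) x \<in> hom_part p q"
  by (induct i) (simp_all add: weil_t_hom)

lemma wspan_hom_cases:
  assumes "clinear f" "x \<in> wspan P" "\<And>p q y. P p q \<Longrightarrow> y \<in> hom_part p q \<Longrightarrow> f y \<in> wspan R"
  shows "f x \<in> wspan R"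
  by (rule linear_wspan[OF assms(1) _ assms(2)]) (rule assms(3)[OF _ monom_hom])

lemma wspan_hom_eq:
  assumes "clinear f" "clinear g" "x \<in> wspan P" "\<And>p q y. P p q \<Longrightarrow> y \<in> hom_part p q \<Longrightarrow> f y = g y"
  shows "f x = g x"
  by (rule linear_eq_on_wspan[OF assms(1,2) _ assms(3)]) (rule assms(4)[OF _ monom_hom])

lemma wspan_of_hom: "P p q \<Longrightarrow> x \<in> hom_part p q \<Longrightarrow> x \<in> wspan P"
  by (erule wspan_mono[rotated]) simp

lemma hom_eq:
  assumes "clinear f" "clinear g" "\<And>p q y. y \<in> hom_part p q \<Longrightarrow> f y = g y"
  shows "f x = g x"
  by (rule linear_eq[OF assms(1,2)]) (rule assms(3)[OF monom_hom])

lemma weil_t_wspan: "x \<in> wspan P \<Longrightarrow> weil_t x \<in> wspan P"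
  by (erule wspan_hom_cases[OF weil_t_eqs(1)]) (rule wspan_of_hom[OF _ weil_t_hom])

lemma weil_N_shape: "weil_N = shape_ext (\<lambda>p q x. \<Sum>i<p. (weil_t ^^ i) x)"
  by (simp add: fun_eq_iff weil_N_def shape_ext_def)

lemma weil_N_hom: "x \<in> hom_part p q \<Longrightarrow> weil_N x = (\<Sum>i<p. (weil_t ^^ i) x)"
  unfolding weil_N_shape
  by (rule shape_ext_hom) (intro clinear_intros weil_t_pow_linear)

lemma weil_N_closed: "x \<in> hom_part p q \<Longrightarrow> weil_N x \<in> hom_part p q"
  by (simp only: weil_N_hom) (intro wspan_closed weil_t_pow_closed)

lemma weil_N_wspan: "x \<in> wspan P \<Longrightarrow> weil_N x \<in> wspan P"
  by (erule wspan_hom_cases[OF weil_N_eqs(1)]) (rule wspan_of_hom[OF _ weil_N_closed])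

text \<open>Composition with \<open>t\<close> shifts the sum defining \<open>N\<close> by one place,
  and \<open>t^p = 1\<close> closes the cycle.\<close>

lemma weil_t_weil_N: "weil_t (weil_N x) = weil_N x"
  and weil_N_weil_t: "weil_N (weil_t x) = weil_N x"
proof -
  note lin = weil_t_eqs(1) weil_N_eqs(1)
  have *: "(\<Sum>i<p. weil_t ((weil_t ^^ i) y)) = (\<Sum>i<p. (weil_t ^^ i) y)" if "y \<in> hom_part p q" for p q y
    using sum.lessThan_Suc_shift[of "\<lambda>i. (weil_t ^^ i) y" p] weil_t_pow_length[OF that] by simp
  show "weil_t (weil_N x) = weil_N x"
    by (rule hom_eq[where x = x])
      (intro lin clinear_compose[OF lin(1)] | simp add: weil_N_hom clinearD[OF lin(1)] *)+
  show "weil_N (weil_t x) = weil_N x"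
    by (rule hom_eq[where x = x])
      (intro lin clinear_compose[OF lin(2)] |
        simp add: weil_N_hom[OF weil_t_hom] weil_N_hom * flip: funpow_swap1)+
qed

text \<open>This is the operator \<open>L\<close>. Since \<open>1 / 0 = 0\<close>, it sends the unit
  to \<open>0\<close> and inverts multiplication by the length only on nonempty words.\<close>

definition inv_len :: "'h::complex_vector weil \<Rightarrow> 'h weil"
  where "inv_len = shape_ext (\<lambda>p q x. (1 / of_nat p) *\<^sub>C x)"

lemma inv_len_linear: "clinear inv_len"
  unfolding inv_len_def by (rule shape_ext_linear) (intro clinear_intros)

lemma inv_len_hom: "x \<in> hom_part p q \<Longrightarrow> inv_len x = (1 / of_nat p) *\<^sub>C x"
  unfolding inv_len_def by (rule shape_ext_hom) (intro clinear_intros)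

lemma inv_len_wspan: "x \<in> wspan P \<Longrightarrow> inv_len x \<in> wspan P"
  by (erule wspan_hom_cases[OF inv_len_linear]) (simp add: inv_len_hom wspan_of_hom)

lemma inv_len_weil_N: "inv_len (weil_N x) = weil_N (inv_len x)"
  by (rule hom_eq[where x = x])
    (intro clinear_compose[OF inv_len_linear] clinear_compose[OF weil_N_eqs(1)] inv_len_linear
        weil_N_eqs(1) |
      simp add: inv_len_hom inv_len_hom[OF weil_N_closed] clinearD[OF weil_N_eqs(1)])+

definition part_avg :: "'h::complex_vector weil \<Rightarrow> 'h weil"
  where "part_avg = shape_ext (\<lambda>p q x. (1 / of_nat p) *\<^sub>C (\<Sum>i<p. \<Sum>j<i. (weil_t ^^ j) x))"

lemma part_avg_lin: "clinear (\<lambda>x. (1 / of_nat p) *\<^sub>C (\<Sum>i<p. \<Sum>j<i. (weil_t ^^ j) x))"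
  by (intro clinear_intros weil_t_pow_linear)

lemma part_avg_linear: "clinear part_avg"
  unfolding part_avg_def by (rule shape_ext_linear) (rule part_avg_lin)

lemma part_avg_hom:
  "x \<in> hom_part p q \<Longrightarrow> part_avg x = (1 / of_nat p) *\<^sub>C (\<Sum>i<p. \<Sum>j<i. (weil_t ^^ j) x)"
  unfolding part_avg_def by (rule shape_ext_hom) (rule part_avg_lin)

lemma part_avg_wspan: "x \<in> wspan P \<Longrightarrow> part_avg x \<in> wspan P"
  by (erule wspan_hom_cases[OF part_avg_linear], simp only: part_avg_hom)
    (intro wspan_closed wspan_of_hom[OF _ weil_t_pow_closed])

text \<open>The telescoping identity \<open>1 - t^i = (1 - t) (1 + ... + t^(i-1))\<close>, averaged
  over \<open>i < p\<close>, has \<open>1 - N/p\<close> on its left and defines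
  \<open>part_avg\<close> on its right.\<close>

lemma avg_decomposition:
  assumes "x \<in> wspan (\<lambda>p q. p \<noteq> 0)"
  shows "x - weil_N (inv_len x) = part_avg (x - weil_t x)"
    and "part_avg (x - weil_t x) = part_avg x - weil_t (part_avg x)"
proof -
  note comp = clinear_compose[OF weil_t_eqs(1)] clinear_compose[OF weil_N_eqs(1)]
    clinear_compose[OF part_avg_linear]
  note lin = weil_t_eqs(1) part_avg_linear inv_len_linear
  have tel: "(\<Sum>j<i. (weil_t ^^ j) (y - weil_t y)) = y - (weil_t ^^ i) y" for i and y :: "'a weil"
    by (induct i) (simp_all add: clinearD[OF weil_t_pow_linear] funpow_swap1 algebra_simps)
  have com: "part_avg (weil_t y) = weil_t (part_avg y)" if "y \<in> hom_part p q" for p q y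
    using that
    by (simp add: part_avg_hom part_avg_hom[OF weil_t_hom] clinearD[OF weil_t_eqs(1)] funpow_swap1)
  show "x - weil_N (inv_len x) = part_avg (x - weil_t x)"
  proof (rule wspan_hom_eq[OF _ _ assms])
    fix p q :: nat and y :: "'a weil"
    assume p: "p \<noteq> 0" and y: "y \<in> hom_part p q"
    have "part_avg (y - weil_t y) = (1 / of_nat p) *\<^sub>C (\<Sum>i<p. y - (weil_t ^^ i) y)"
      using part_avg_hom[of "y - weil_t y" p q] y weil_t_hom[OF y] tel by auto
    also have "\<dots> = (1 / of_nat p) *\<^sub>C (of_nat p *\<^sub>C y) - (1 / of_nat p) *\<^sub>C (\<Sum>i<p. (weil_t ^^ i) y)"
      by (simp add: sum_subtractf cvec.scale_right_diff_distrib cvec.sum_constant_scale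
          del: sum_constant)
    also have "\<dots> = y - weil_N (inv_len y)"
      using p y by (simp add: inv_len_hom weil_N_hom clinearD[OF weil_N_eqs(1)])
    finally show "y - weil_N (inv_len y) = part_avg (y - weil_t y)" by simp
  qed (intro clinear_intros comp lin)+
  show "part_avg (x - weil_t x) = part_avg x - weil_t (part_avg x)"
    by (rule hom_eq[where x = x])
      (intro clinear_intros comp lin | simp add: com clinearD[OF part_avg_linear])+
qed

lemma weil_N_fixed:
  assumes "x \<in> wspan (\<lambda>p q. p \<noteq> 0)" "weil_t x = x"
  shows "weil_N (inv_len x) = x"
  using avg_decomposition(1)[OF assms(1)] assms(2) by (simp add: clinearD[OF part_avg_linear])

subsection \<open>Derivations and the differentials\<close>

text \<open>\<open>sgn_op 1\<close> is the parity automorphism, so this is the graded Leibniz rule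
  for arbitrary elements.\<close>

definition odd_derivation :: "('h::complex_vector weil \<Rightarrow> 'h weil) \<Rightarrow> bool"
  where "odd_derivation D \<longleftrightarrow> clinear D \<and> (\<forall>x y. D (x * y) = D x * y + sgn_op 1 x * D y)"

lemma odd_derivationI:
  assumes "clinear D"
    and "\<And>u v. D (monom u * monom v) = D (monom u) * monom v + (-1) ^ wdeg u * monom u * D (monom v)"
  shows "odd_derivation D"
proof -
  note lin = assms(1) clinear_compose[OF assms(1)] sgn_op_linear
  have "D (monom u * y) = D (monom u) * y + sgn_op 1 (monom u) * D y" for u y
    by (rule linear_eq[where x = y])
      (intro clinear_intros lin | simp add: assms(2) sgn_op_monom weil_sign)+
  note * = this
  have "D (x * y) = D x * y + sgn_op 1 x * D y" for x y
    by (rule linear_eq[where x = x]) (intro clinear_intros lin | rule *)+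
  with assms(1) show ?thesis by (simp add: odd_derivation_def)
qed

text \<open>The common frame for \<open>\<partial>\<close> and \<open>\<partial>\<^sub>0\<close>.
  The value on a letter consists of a term of length 1, the curvature, and terms of length 2 from
  the coproduct. Hence such a derivation raises the degree by one and the length by at most
  one.\<close>

locale weil_derivation =
  fixes D :: "'h::complex_vector weil \<Rightarrow> 'h weil"
  assumes odd: "odd_derivation D"
    and gen_deg: "\<And>a. D (gen a) \<in> wspan (\<lambda>p q. (p = 1 \<or> p = 2) \<and> q = gdeg a + 1)"
begin

lemma linear: "clinear D"
  using odd by (simp add: odd_derivation_def)

lemma leibniz: "D (x * y) = D x * y + sgn_op 1 x * D y"
  using odd by (simp add: odd_derivation_def)

lemma one: "D 1 = 0"
  using leibniz[of 1 1] by simp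

lemma leibniz_gen: "D (gen a * x) = D (gen a) * x + ((-1) ^ gdeg a) *\<^sub>C (gen a * D x)"
  by (simp add: leibniz sgn_op_gen scaleC_mult_weil)

lemma hom: "x \<in> hom_part p q \<Longrightarrow> D x \<in> wspan (\<lambda>p' q'. (p' = p \<or> p' = Suc p) \<and> q' = Suc q)"
proof (erule linear_wspan[OF linear, rotated], elim conjE)
  show "D (monom w) \<in> wspan (\<lambda>p' q'. (p' = p \<or> p' = Suc p) \<and> q' = Suc q)"
    if "length w = p" "wdeg w = q" for w
    using that
  proof (induct w arbitrary: p q)
    case (Cons a w)
    have "D (gen a) * monom w \<in> wspan (\<lambda>p' q'. (p' = p \<or> p' = Suc p) \<and> q' = Suc q)"
      by (rule wspan_mult[OF gen_deg monom_hom]) (use Cons.prems in auto)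
    moreover have "gen a * D (monom w) \<in> wspan (\<lambda>p' q'. (p' = p \<or> p' = Suc p) \<and> q' = Suc q)"
      by (rule wspan_mult[OF gen_hom Cons.hyps[OF refl refl]]) (use Cons.prems in auto)
    ultimately show ?case by (simp add: leibniz_gen)
  qed (simp add: one)
qed

lemma sgn_op: "D (sgn_op k x) = ((-1) ^ k) *\<^sub>C sgn_op k (D x)"
proof (rule hom_eq[where x = x])
  fix p q :: nat and y :: "'h weil"
  assume y: "y \<in> hom_part p q"
  have "sgn_op k (D y) = ((-1) ^ (k * Suc q)) *\<^sub>C D y"
    by (rule wspan_hom_eq[OF sgn_op_linear clinear_scale[OF clinear_ident] hom[OF y]])
      (simp add: sgn_op_hom)
  then show "D (sgn_op k y) = ((-1) ^ k) *\<^sub>C sgn_op k (D y)"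
    by (simp add: sgn_op_hom[OF y] clinearD[OF linear] scaleC_scaleC power_add)
qed (intro clinear_intros linear sgn_op_linear clinear_compose[OF linear] clinear_compose[OF sgn_op_linear])+

lemma square_zero:
  assumes "\<And>a. D (D (gen a)) = 0"
  shows "D (D x) = 0"
proof (rule linear_eq[where x = x])
  show "D (D (monom w)) = 0" for w
  proof (induct w)
    case (Cons a w)
    then show ?case
      by (simp add: leibniz assms clinearD[OF linear] sgn_op[of 1, simplified])
  qed (simp add: one clinearD[OF linear])
qed (intro clinear_zero clinear_compose[OF linear] linear)+

end

text \<open>\<open>tensor_lift\<close> is evaluated on one chosen representative of
  \<open>z\<close>, so this is the linearity of \<open>D\<close> on a finite sum.\<close>

lemma tensor_lift_compose: "clinear D \<Longrightarrow> D (tensor_lift f z) = tensor_lift (\<lambda>x y. D (f x y)) z"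
  by (simp add: tensor_lift_def free_ext_def clinearD case_prod_unfold)

lemma tensor_lift_combine:
  "tensor_lift (\<lambda>x y. f x y + g x y) z = tensor_lift f z + tensor_lift g z"
  "tensor_lift (\<lambda>x y. f x y - g x y) z = tensor_lift f z - tensor_lift g z"
  "tensor_lift (\<lambda>x y. - f x y) z = - tensor_lift f z"
  "tensor_lift (\<lambda>x y. c *\<^sub>C f x y) z = c *\<^sub>C tensor_lift f z"
  by (simp_all add: tensor_lift_def free_ext_def case_prod_unfold sum.distrib sum_subtractf
      sum_negf cvec.scale_right_distrib cvec.scale_right_diff_distrib
      cvec.scale_sum_right mult.commute)

lemma tensor_lift_subspace:
  assumes "cvec.subspace V" "\<And>x y. f x y \<in> V"
  shows "tensor_lift f z \<in> V"
  unfolding tensor_lift_def free_ext_def case_prod_unfold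
  by (intro cvec.subspace_sum cvec.subspace_scale assms)

lemma gen_clinear: "K \<in> {Gen, Curv} \<Longrightarrow> clinear (\<lambda>h. gen (K h))"
  by (auto simp: clinear_iff gen_linear)

text \<open>The part of \<open>\<partial>\<close> on letters that keeps the word length; it is where
  \<open>\<partial>\<close> and \<open>\<partial>\<^sub>0\<close> differ.\<close>

definition lin_part :: "'h::complex_vector gen \<Rightarrow> 'h weil"
  where "lin_part a = (case a of Gen h \<Rightarrow> gen (Curv h) | Curv h \<Rightarrow> 0)"

lemma lin_part_simps [simp]: "lin_part (Gen h) = gen (Curv h)" "lin_part (Curv h) = 0"
  by (simp_all add: lin_part_def)

lemma lin_part_hom: "lin_part a \<in> hom_part 1 (gdeg a + 1)"
  using gen_hom[of "Curv h" for h] by (cases a) (simp_all add: numeral_2_eq_2)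

section \<open>Coassociativity and the squares of \<open>\<partial>\<close> and
  \<open>\<partial>\<^sub>0\<close>\<close>

context coalgebra
begin

text \<open>Both sides are the image of the twice iterated coproduct under one trilinear product of
  letters, computed from its two bracketings.\<close>

lemma comult_prod_coassoc:
  assumes K: "K \<in> {Gen, Curv}" "L \<in> {Gen, Curv}" "M \<in> {Gen, Curv}"
  shows "tensor_lift (\<lambda>x y. comult_prod comult K L x * gen (M y)) (comult h) =
    tensor_lift (\<lambda>x y. gen (K x) * comult_prod comult L M y) (comult h)"
proof -
  define m2 where "m2 = tensor_lift (\<lambda>y z. gen (L y) * gen (M z))"
  \<comment> \<open>\<open>m3\<close> is the trilinear product on the right bracketed tensor
    product, the target of \<open>tensor_assoc\<close>.\<close>
  define m3 where "m3 = tensor_lift (\<lambda>x u. gen (K x) * m2 u)"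
  note lin = gen_clinear[OF K(1)] gen_clinear[OF K(2)] gen_clinear[OF K(3)]
  have bil2: "cbilinear (\<lambda>y z. gen (L y) * gen (M z))"
    unfolding cbilinear_def by (intro conjI allI clinear_intros lin)
  have m2: "clinear m2" "m2 (tens y z) = gen (L y) * gen (M z)" for y z
    unfolding m2_def using bil2 by (rule tensor_lift_linear, rule tensor_lift_tens)
  have bil3: "cbilinear (\<lambda>x u. gen (K x) * m2 u)"
    unfolding cbilinear_def by (intro conjI allI clinear_intros lin m2)
  have m3: "clinear m3" "m3 (tens x u) = gen (K x) * m2 u" for x u
    unfolding m3_def using bil3 by (rule tensor_lift_linear, rule tensor_lift_tens)
  have tens_lin: "clinear (tens x)" "clinear (\<lambda>x. tens x y)"
    for x :: "'x::complex_vector" and y :: "'y::complex_vector"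
    using tens_bilinear unfolding cbilinear_def by blast+
  define ta where "ta = (\<lambda>u z. tensor_lift (\<lambda>x y. tens x (tens y z)) u :: ('h, ('h, 'h) tensor) tensor)"
  have bila: "cbilinear (\<lambda>x y. tens x (tens y z))" for z :: 'h
    unfolding cbilinear_def
    by (intro conjI allI tens_lin(2) clinear_compose[OF tens_lin(1) tens_lin(2)])
  have "clinear (\<lambda>u. ta u z)" for z
    unfolding ta_def by (rule tensor_lift_linear[OF bila])
  moreover have "clinear (ta u)" for u
    by (simp add: ta_def clinear_iff tensor_lift_combine clinearD(1,2)[OF tens_lin(1)])
  ultimately have bilta: "cbilinear ta" by (simp add: cbilinear_def)
  have ta: "tensor_assoc = tensor_lift ta" by (simp add: tensor_assoc_def ta_def)
  have lin3: "clinear (\<lambda>w. m3 (tensor_assoc w))"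
    unfolding ta by (rule clinear_compose[OF m3(1) tensor_lift_linear[OF bilta]])
  have "m3 (tensor_assoc (tens u y)) = tensor_lift (\<lambda>a b. gen (K a) * gen (L b)) u * gen (M y)" for u y
    unfolding ta tensor_lift_tens[OF bilta]
    by (simp add: ta_def tensor_lift_compose[OF m3(1)] m3(2) m2(2)
        tensor_lift_compose[OF clinear_mult(2)[OF clinear_ident]] mult.assoc)
  then have "m3 (tensor_assoc (tensor_map comult id (comult h))) =
      tensor_lift (\<lambda>x y. comult_prod comult K L x * gen (M y)) (comult h)"
    by (simp add: tensor_map_def tensor_lift_compose[OF lin3] comult_prod_def)
  moreover have "m3 (tensor_map id comult (comult h)) =
      tensor_lift (\<lambda>x y. gen (K x) * comult_prod comult L M y) (comult h)"
    by (simp add: tensor_map_def tensor_lift_compose[OF m3(1)] m3(2) comult_prod_def m2_def)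
  ultimately show ?thesis
    using coassoc[of h] by simp
qed

text \<open>The degree of a letter depends only on its constructor, so \<open>undefined\<close>
  merely serves as an argument with which to name that degree.\<close>

lemma comult_prod_hom:
  assumes "K \<in> {Gen, Curv}" "L \<in> {Gen, Curv}"
  shows "comult_prod comult K L h \<in> hom_part 2 (gdeg (K undefined) + gdeg (L undefined))"
  unfolding comult_prod_def
proof (rule tensor_lift_subspace[OF subspace_wspan])
  fix x y
  have "gdeg (K x) = gdeg (K undefined)" "gdeg (L y) = gdeg (L undefined)"
    using assms by auto
  then show "gen (K x) * gen (L y) \<in> hom_part 2 (gdeg (K undefined) + gdeg (L undefined))"
    using hom_part_mult[OF gen_hom gen_hom, of "K x" "L y"] by (simp add: numeral_2_eq_2)
qed

lemma gen_d0_hom: "gen_d0 comult a \<in> hom_part 2 (gdeg a + 1)"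
  using comult_prod_hom[of Gen Gen] comult_prod_hom[of Curv Gen] comult_prod_hom[of Gen Curv]
  by (cases a) (auto simp: numeral_2_eq_2 numeral_3_eq_3 simp del: wspan_closed)

lemma gen_d_split: "gen_d comult a = lin_part a + gen_d0 comult a"
  by (cases a) simp_all

lemma gen_d_deg:
  "gen_d comult a \<in> wspan (\<lambda>p q. (p = 1 \<or> p = 2) \<and> q = gdeg a + 1)"
  "gen_d0 comult a \<in> wspan (\<lambda>p q. (p = 1 \<or> p = 2) \<and> q = gdeg a + 1)"
proof -
  show "gen_d0 comult a \<in> wspan (\<lambda>p q. (p = 1 \<or> p = 2) \<and> q = gdeg a + 1)"
    by (rule wspan_of_hom[OF _ gen_d0_hom]) simp
  moreover have "lin_part a \<in> wspan (\<lambda>p q. (p = 1 \<or> p = 2) \<and> q = gdeg a + 1)"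
    by (rule wspan_of_hom[OF _ lin_part_hom]) simp
  ultimately show "gen_d comult a \<in> wspan (\<lambda>p q. (p = 1 \<or> p = 2) \<and> q = gdeg a + 1)"
    by (simp add: gen_d_split)
qed

sublocale d: weil_derivation "weil_d comult"
  using weil_d_eqs[OF comult_linear] gen_d_deg(1) by unfold_locales (auto intro!: odd_derivationI)

sublocale d0: weil_derivation "weil_d0 comult"
  using weil_d0_eqs[OF comult_linear] gen_d_deg(2) by unfold_locales (auto intro!: odd_derivationI)

abbreviation "d \<equiv> weil_d comult"
abbreviation "d0 \<equiv> weil_d0 comult"

lemma d_comult_prod:
  assumes "K \<in> {Gen, Curv}" "L \<in> {Gen, Curv}"
  shows "d (comult_prod comult K L h) = tensor_lift (\<lambda>x y. d (gen (K x)) * gen (L y)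
      + (-1) ^ gdeg (K x) *\<^sub>C (gen (K x) * d (gen (L y)))) (comult h)"
    and "d0 (comult_prod comult K L h) = tensor_lift (\<lambda>x y. d0 (gen (K x)) * gen (L y)
      + (-1) ^ gdeg (K x) *\<^sub>C (gen (K x) * d0 (gen (L y)))) (comult h)"
  unfolding comult_prod_def
  by (simp_all add: tensor_lift_compose[OF d.linear] tensor_lift_compose[OF d0.linear]
      d.leibniz_gen d0.leibniz_gen)

lemmas d_gen = weil_d_eqs(2)[OF comult_linear] weil_d0_eqs(2)[OF comult_linear]

text \<open>Every term containing a twice iterated coproduct occurs in two bracketings, which
  coassociativity identifies. In the first and third equations these terms cancel. In the second and
  fourth, the surviving ones, with \<open>Curv\<close> in the middle, occur alike on both
  sides.\<close>

lemma d_comult_prods: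
  "d (comult_prod comult Gen Gen h) = comult_prod comult Curv Gen h - comult_prod comult Gen Curv h"
  "d (comult_prod comult Curv Gen h) = d (comult_prod comult Gen Curv h)"
  "d0 (comult_prod comult Gen Gen h) = 0"
  "d0 (comult_prod comult Curv Gen h) = d0 (comult_prod comult Gen Curv h)"
  by (simp_all add: d_comult_prod d_gen left_diff_distrib right_diff_distrib
      tensor_lift_combine comult_prod_coassoc comult_prod_def[of comult Gen Curv h, symmetric]
      comult_prod_def[of comult Curv Gen h, symmetric]
      comult_prod_def[of comult Curv Curv h, symmetric])

text \<open>The third equation is \<open>d (d (gen a)) = 0\<close> with \<open>gen_d\<close> split
  into its two parts, as \<open>d\<close> and \<open>d0\<close> agree on curvature letters.\<close>

lemma d_d_gen: "d (d (gen a)) = 0"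
  and d0_d0_gen: "d0 (d0 (gen a)) = 0"
  and d_d0_gen: "d (d0 (gen a)) + d0 (lin_part a) = 0"
  by (cases a; simp add: d_gen clinearD[OF d.linear] clinearD[OF d0.linear] d_comult_prods)+

lemma d_d: "d (d x) = 0"
  by (rule d.square_zero) (rule d_d_gen)

text \<open>The difference is the derivation that extends \<open>lin_part\<close>, hence it keeps
  the length, whereas \<open>d0\<close> raises it by exactly one. This separates the two lengths
  that occur in \<open>b\<close>.\<close>

lemma d_diff_d0_hom: "x \<in> hom_part p q \<Longrightarrow> d x - d0 x \<in> hom_part p (Suc q)"
proof (erule linear_wspan[OF clinear_diff[OF d.linear d0.linear], rotated], elim conjE)
  show "d (monom w) - d0 (monom w) \<in> hom_part p (Suc q)"
    if "length w = p" "wdeg w = q" for w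
    using that
  proof (induct w arbitrary: p q)
    case (Cons a w)
    have "lin_part a * monom w \<in> hom_part p (Suc q)"
      using hom_part_mult[OF lin_part_hom monom_hom, of a w] Cons.prems by simp
    moreover have "gen a * (d (monom w) - d0 (monom w)) \<in> hom_part p (Suc q)"
      using hom_part_mult[OF gen_hom Cons.hyps[OF refl refl], of a] Cons.prems by simp
    moreover have "d (monom (a # w)) - d0 (monom (a # w)) = lin_part a * monom w
        + (-1) ^ gdeg a *\<^sub>C (gen a * (d (monom w) - d0 (monom w)))"
      by (simp add: d.leibniz_gen d0.leibniz_gen d_gen gen_d_split algebra_simps
          cvec.scale_right_diff_distrib)
    ultimately show ?case by simp
  qed (simp add: d.one d0.one)
qed

lemma d0_hom: "x \<in> hom_part p q \<Longrightarrow> d0 x \<in> hom_part (Suc p) (Suc q)"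
proof (erule linear_wspan[OF d0.linear, rotated], elim conjE)
  show "d0 (monom w) \<in> hom_part (Suc p) (Suc q)" if "length w = p" "wdeg w = q" for w
    using that
  proof (induct w arbitrary: p q)
    case (Cons a w)
    have "gen_d0 comult a * monom w \<in> hom_part (Suc p) (Suc q)"
      using hom_part_mult[OF gen_d0_hom monom_hom, of a w] Cons.prems by simp
    moreover have "gen a * d0 (monom w) \<in> hom_part (Suc p) (Suc q)"
      using hom_part_mult[OF gen_hom Cons.hyps[OF refl refl], of a] Cons.prems by simp
    ultimately show ?case by (simp add: d0.leibniz_gen d_gen)
  qed (simp add: d0.one)
qed

end

section \<open>The operator \<open>c\<close> (here \<open>front_d0\<close>) and its relations with
  \<open>t\<close>, \<open>N\<close> and \<open>\<partial>\<close>\<close>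

primrec front_d0_word ::
    "('h::complex_vector \<Rightarrow> ('h, 'h) tensor) \<Rightarrow> 'h gen list \<Rightarrow> 'h weil"
  where
    "front_d0_word \<Delta> [] = 0"
  | "front_d0_word \<Delta> (a # w) = weil_d0 \<Delta> (gen a) * monom w"

context coalgebra
begin

definition front_d0 :: "'h weil \<Rightarrow> 'h weil"
  where "front_d0 = weil_ext (front_d0_word comult)"

abbreviation "b \<equiv> weil_b comult"

lemma front_d0_word_linear: "letterwise_linear (front_d0_word comult)"
  unfolding letterwise_linear_def
proof (intro allI)
  fix u v :: "'h gen list"
  show "clinear (\<lambda>h. front_d0_word comult (u @ Gen h # v)) \<and>
      clinear (\<lambda>h. front_d0_word comult (u @ Curv h # v))"
    using weil_d0_eqs(1)[OF comult_linear] by (cases u) (auto simp: weil_linear_simps)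
qed

lemma front_d0_linear: "clinear front_d0"
  unfolding front_d0_def by (rule weil_ext_linear[OF front_d0_word_linear])

lemma front_d0_one [simp]: "front_d0 1 = 0"
  using weil_ext_monom[OF front_d0_word_linear, of "[]"] by (simp add: front_d0_def)

lemma front_d0_gen: "front_d0 (gen a * x) = d0 (gen a) * x"
proof (rule linear_eq[where x = x])
  show "front_d0 (gen a * monom w) = d0 (gen a) * monom w" for w
    using weil_ext_monom[OF front_d0_word_linear, of "a # w"] by (simp add: front_d0_def)
qed (intro clinear_intros clinear_compose[OF front_d0_linear])+

lemma b_eq: "b x = d x + weil_t (front_d0 x)"
proof -
  have "weil_ext (bt_word comult) x = weil_t (front_d0 x)"
  proof (rule linear_eq[where x = x])
    show "weil_ext (bt_word comult) (monom w) = weil_t (front_d0 (monom w))" for w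
      using weil_ext_monom[OF bt_word_linear[OF comult_linear], of w]
      by (cases w) (simp_all add: front_d0_gen clinearD[OF weil_t_eqs(1)])
  qed (intro weil_ext_linear bt_word_linear comult_linear clinear_compose[OF weil_t_eqs(1)] front_d0_linear)+
  then show ?thesis by (simp add: weil_b_def)
qed

lemma b_linear: "clinear b"
  by (rule weil_b_eqs(1)[OF comult_linear])

lemma front_d0_hom: "x \<in> hom_part p q \<Longrightarrow> front_d0 x \<in> hom_part (Suc p) (Suc q)"
proof (erule linear_wspan[OF front_d0_linear, rotated])
  fix w :: "'h gen list" assume w: "length w = p \<and> wdeg w = q"
  show "front_d0 (monom w) \<in> hom_part (Suc p) (Suc q)"
  proof (cases w)
    case (Cons a v)
    then show ?thesis
      using hom_part_mult[OF gen_d0_hom monom_hom, of a v] w by (simp add: front_d0_gen d_gen)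
  qed simp
qed

lemma b_hom: "x \<in> hom_part p q \<Longrightarrow> b x \<in> wspan (\<lambda>p' q'. (p' = p \<or> p' = Suc p) \<and> q' = Suc q)"
  unfolding b_eq by (intro wspan_closed d.hom wspan_of_hom[OF _ weil_t_hom[OF front_d0_hom]]) simp_all

lemma weil_t_lin_part: "weil_t (lin_part a * x) = sgn_op (gdeg a + 1) x * lin_part a"
  by (cases a) (simp_all add: weil_t_gen clinearD[OF weil_t_eqs(1)] numeral_2_eq_2)

text \<open>On a word \<open>a x\<close> the terms that differentiate \<open>x\<close> agree on both
  sides, so only the derivative of \<open>a\<close> counts. It stands at the end in
  \<open>d t\<close> and has been rotated once from the front in \<open>t d\<close>. One rotation
  carries \<open>lin_part a\<close> entirely to the end, so that part cancels;
  \<open>d0 (gen a)\<close> has length two and requires two rotations, which leaves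
  \<open>t t c - t c\<close>.\<close>

lemma d_weil_t: "d (weil_t x) - weil_t (d x) = weil_t (weil_t (front_d0 x)) - weil_t (front_d0 x)"
proof (rule linear_eq[where x = x])
  show "d (weil_t (monom w)) - weil_t (d (monom w)) =
      weil_t (weil_t (front_d0 (monom w))) - weil_t (front_d0 (monom w))" for w
  proof (cases w)
    case (Cons a v)
    let ?x = "monom v"
    have tt: "weil_t (weil_t (gen_d0 comult a * ?x)) = sgn_op (gdeg a + 1) ?x * gen_d0 comult a"
      using weil_t_pow_hom[OF gen_d0_hom] by (simp add: numeral_2_eq_2)
    have "d (weil_t (gen a * ?x)) = ((-1) ^ gdeg a) *\<^sub>C (sgn_op (gdeg a) (d ?x) * gen a)
        + sgn_op (gdeg a + 1) ?x * gen_d comult a"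
      by (simp add: weil_t_gen d.leibniz d.sgn_op sgn_op_sgn_op d_gen scaleC_mult_weil)
    moreover have "weil_t (d (gen a * ?x)) = weil_t (gen_d comult a * ?x)
        + ((-1) ^ gdeg a) *\<^sub>C (sgn_op (gdeg a) (d ?x) * gen a)"
      by (simp add: d.leibniz_gen d_gen clinearD[OF weil_t_eqs(1)] weil_t_gen)
    ultimately have "d (weil_t (gen a * ?x)) - weil_t (d (gen a * ?x)) =
        sgn_op (gdeg a + 1) ?x * gen_d comult a - weil_t (gen_d comult a * ?x)"
      by simp
    also have "\<dots> = weil_t (weil_t (gen_d0 comult a * ?x)) - weil_t (gen_d0 comult a * ?x)"
      unfolding tt gen_d_split distrib_left distrib_right clinearD[OF weil_t_eqs(1)] weil_t_lin_part
      by simp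
    finally show ?thesis using Cons by (simp add: front_d0_gen d_gen)
  qed (simp add: d.one clinearD[OF weil_t_eqs(1)])
qed (intro clinear_intros clinear_compose[OF d.linear] clinear_compose[OF weil_t_eqs(1)]
    weil_t_eqs(1) d.linear front_d0_linear)+

lemma weil_t_b: "weil_t (b x) - b x = d (weil_t x - x)"
  using d_weil_t[of x] by (simp add: b_eq clinearD[OF weil_t_eqs(1)] clinearD[OF d.linear] algebra_simps)

text \<open>On \<open>a x\<close> the terms with \<open>d x\<close> cancel, since
  \<open>d0 (gen a)\<close> has one degree more than \<open>a\<close>. The terms in which
  \<open>a\<close> is differentiated twice vanish by \<open>d_d0_gen\<close>, except for
  \<open>c\<close> applied to \<open>d0 (gen a) * x\<close>, which is \<open>c c\<close>.\<close>

lemma d_front_d0: "d (front_d0 x) + front_d0 (d x) = front_d0 (front_d0 x)"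
proof (rule linear_eq[where x = x])
  show "d (front_d0 (monom w)) + front_d0 (d (monom w)) = front_d0 (front_d0 (monom w))" for w
  proof (cases w)
    case (Cons a v)
    let ?x = "monom v"
    have front_d0_lin: "front_d0 (lin_part a * ?x) = d0 (lin_part a) * ?x"
      by (cases a) (simp_all add: front_d0_gen clinearD[OF front_d0_linear] clinearD[OF d0.linear])
    have s: "sgn_op (Suc 0) (gen_d0 comult a) = (-1) ^ (gdeg a + 1) *\<^sub>C gen_d0 comult a"
      using sgn_op_hom[OF gen_d0_hom, of 1 a] by simp
    have "d (front_d0 (gen a * ?x)) + front_d0 (d (gen a * ?x)) =
        (d (d0 (gen a)) + d0 (lin_part a)) * ?x + front_d0 (gen_d0 comult a * ?x)"
      by (simp add: front_d0_gen d.leibniz_gen d_gen gen_d_split distrib_right clinearD[OF front_d0_linear] front_d0_lin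
          d.leibniz[of "gen_d0 comult a"] s scaleC_mult_weil)
    then show ?thesis using Cons d_d0_gen[of a] by (simp add: front_d0_gen d_gen)
  qed (simp add: d.one clinearD[OF d.linear] clinearD[OF front_d0_linear])
qed (intro clinear_intros clinear_compose[OF d.linear] clinear_compose[OF front_d0_linear] d.linear front_d0_linear)+

text \<open>For \<open>z = e f\<close> the first summand differentiates \<open>e\<close>, and the
  second differentiates \<open>f\<close> after \<open>e\<close> has been rotated away. Together they
  are the Leibniz rule for \<open>d0 z\<close>, rotated once.\<close>

lemma front_d0_weil_t_hom:
  assumes "z \<in> hom_part 2 r"
  shows "weil_t (front_d0 (z * x)) + front_d0 (weil_t (z * x)) = weil_t (d0 z * x)"
proof (rule linear_eq_on_wspan[OF _ _ _ assms])
  fix w :: "'h gen list" assume "length w = 2 \<and> wdeg w = r"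
  then obtain e f where w: "w = [e, f]"
    by (auto simp: numeral_2_eq_2 length_Suc_conv)
  have s: "sgn_op (gdeg e) (d0 (gen f)) = (-1) ^ (gdeg e * (gdeg f + 1)) *\<^sub>C d0 (gen f)"
    using sgn_op_hom[OF gen_d0_hom, of "gdeg e" f] by (simp add: d_gen)
  have "weil_t (d0 (gen e * gen f) * x) = weil_t (d0 (gen e) * gen f * x)
      + (-1) ^ gdeg e *\<^sub>C (sgn_op (gdeg e) (d0 (gen f) * x) * gen e)"
    by (simp add: d0.leibniz_gen distrib_right scaleC_mult_weil mult.assoc weil_t_gen
        clinearD[OF weil_t_eqs(1)])
  also have "(-1) ^ gdeg e *\<^sub>C (sgn_op (gdeg e) (d0 (gen f) * x) * gen e) =
      front_d0 (weil_t (gen e * (gen f * x)))"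
    by (simp add: weil_t_gen sgn_op_mult sgn_op_gen s scaleC_mult_weil mult.assoc front_d0_gen
        clinearD[OF front_d0_linear] scaleC_scaleC power_add)
  finally show "weil_t (front_d0 (monom w * x)) + front_d0 (weil_t (monom w * x)) = weil_t (d0 (monom w) * x)"
    by (simp add: w front_d0_gen mult.assoc)
qed (intro clinear_intros clinear_compose[OF d0.linear] clinear_compose[OF front_d0_linear]
    clinear_compose[OF weil_t_eqs(1)] d0.linear)+

text \<open>The preceding relation with \<open>z = d0 (gen a)\<close>, where its right-hand side
  vanishes because \<open>d0\<close> squares to zero.\<close>

lemma front_d0_weil_t_c: "front_d0 (weil_t (front_d0 x)) = - weil_t (front_d0 (front_d0 x))"
proof (rule linear_eq[where x = x])
  show "front_d0 (weil_t (front_d0 (monom w))) = - weil_t (front_d0 (front_d0 (monom w)))" for w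
  proof (cases w)
    case (Cons a v)
    have "weil_t (front_d0 (gen_d0 comult a * monom v)) + front_d0 (weil_t (gen_d0 comult a * monom v)) = 0"
      using front_d0_weil_t_hom[OF gen_d0_hom] d0_d0_gen[of a] by (simp add: d_gen clinearD[OF weil_t_eqs(1)])
    then show ?thesis using Cons by (simp add: front_d0_gen d_gen eq_neg_iff_add_eq_0 add.commute)
  qed (simp add: clinearD[OF weil_t_eqs(1)] clinearD[OF front_d0_linear])
qed (intro clinear_intros clinear_compose[OF weil_t_eqs(1)] clinear_compose[OF front_d0_linear] front_d0_linear)+

lemma b_b: "b (b x) = 0"
proof -
  note lin = clinearD[OF weil_t_eqs(1)] clinearD[OF front_d0_linear] clinearD[OF d.linear]
  \<comment> \<open>Rewriting \<open>d t c\<close> and then \<open>t d c\<close> cancels everything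
    except \<open>t t c c + t c t c\<close>, which is zero by
    \<open>front_d0_weil_t_c\<close>.\<close>
  have "b (b x) = d (weil_t (front_d0 x)) + weil_t (front_d0 (d x)) + weil_t (front_d0 (weil_t (front_d0 x)))"
    by (simp add: b_eq lin d_d)
  also have "d (weil_t (front_d0 x)) = weil_t (d (front_d0 x)) + weil_t (weil_t (front_d0 (front_d0 x))) - weil_t (front_d0 (front_d0 x))"
    using d_weil_t[of "front_d0 x"] by (simp add: algebra_simps)
  also have "weil_t (d (front_d0 x)) = weil_t (front_d0 (front_d0 x)) - weil_t (front_d0 (d x))"
    using d_front_d0[of x] by (simp add: lin eq_diff_eq flip: lin(1))
  finally show ?thesis by (simp add: front_d0_weil_t_c lin)
qed

text \<open>The Leibniz rule read cyclically: the \<open>i\<close>-th rotation brings the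
  \<open>i\<close>-th letter of \<open>w\<close> to the front, \<open>c\<close> differentiates it,
  and \<open>N\<close> forgets the rotation. The factor \<open>x\<close> is needed for the
  induction, as it collects the letters already moved to the end.\<close>

lemma weil_N_front_d0_sum:
  "(\<Sum>i<length w. weil_N (front_d0 ((weil_t ^^ i) (monom w * x)))) = weil_N (d0 (monom w) * x)"
proof (induct w arbitrary: x)
  case Nil
  then show ?case by (simp add: d0.one clinearD[OF weil_N_eqs(1)])
next
  case (Cons a w)
  note lin = clinearD[OF weil_t_pow_linear] clinearD[OF front_d0_linear] clinearD[OF weil_N_eqs(1)]
  let ?s = "(-1) ^ (gdeg a * wdeg w) :: complex"
  let ?y = "sgn_op (gdeg a) x * gen a"
  have s: "sgn_op (gdeg a) (d0 (monom w)) = (-1) ^ (gdeg a * (wdeg w + 1)) *\<^sub>C d0 (monom w)"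
    using sgn_op_hom[OF d0_hom[OF monom_hom], of "gdeg a" w] by simp
  have "(weil_t ^^ Suc i) (monom (a # w) * x) = ?s *\<^sub>C (weil_t ^^ i) (monom w * ?y)" for i
    by (simp add: funpow_Suc_right mult.assoc weil_t_gen sgn_op_mult sgn_op_monom scaleC_mult_weil
        lin del: funpow.simps)
  then have "(\<Sum>i<length w. weil_N (front_d0 ((weil_t ^^ Suc i) (monom (a # w) * x)))) =
      ?s *\<^sub>C (\<Sum>i<length w. weil_N (front_d0 ((weil_t ^^ i) (monom w * ?y))))"
    by (simp only: lin cvec.scale_sum_right)
  also have "\<dots> = ?s *\<^sub>C weil_N (d0 (monom w) * ?y)"
    by (simp only: Cons)
  \<comment> \<open>Under \<open>N\<close> the letter \<open>a\<close> may return from the end to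
    the front, which yields the remaining term of the Leibniz rule.\<close>
  also have "\<dots> = (-1) ^ gdeg a *\<^sub>C weil_N (weil_t (gen a * (d0 (monom w) * x)))"
    by (simp add: weil_t_gen sgn_op_mult s scaleC_mult_weil mult.assoc lin scaleC_scaleC power_add)
  finally show ?case
    by (simp add: sum.lessThan_Suc_shift weil_N_weil_t front_d0_gen d0.leibniz_gen mult.assoc distrib_right
        scaleC_mult_weil lin del: sum.lessThan_Suc funpow.simps(2))
qed

lemma weil_N_d0: "weil_N (d0 x) = weil_N (front_d0 (weil_N x))"
proof (rule linear_eq[where x = x])
  show "weil_N (d0 (monom w)) = weil_N (front_d0 (weil_N (monom w)))" for w
    using weil_N_front_d0_sum[of w 1]
    by (simp add: weil_N_hom[OF monom_hom] clinearD[OF weil_N_eqs(1)] clinearD[OF front_d0_linear])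
qed (intro clinear_compose[OF weil_N_eqs(1)] clinear_compose[OF front_d0_linear] weil_N_eqs(1) d0.linear)+

text \<open>With \<open>y = N w\<close>, the element \<open>b y\<close> is fixed by
  \<open>t\<close>, so \<open>b y = N L b y\<close>. Here \<open>L\<close> divides the component
  \<open>d y - d0 y\<close> by \<open>p\<close> and the component \<open>d0 y + t c y\<close> by
  \<open>p + 1\<close>. Since \<open>N d0 y = p N c y\<close>, the longer component contributes
  \<open>N c y\<close>, which cancels the \<open>d0\<close> part of the shorter one. What remains is
  \<open>(1/p) N d y\<close>, and this equals \<open>N d w\<close>.\<close>

lemma b_weil_N: "b (weil_N x) = weil_N (d x)"
proof (rule hom_eq[where x = x])
  note lin = clinearD[OF weil_t_eqs(1)] clinearD[OF front_d0_linear] clinearD[OF weil_N_eqs(1)]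
    clinearD[OF d.linear] clinearD[OF d0.linear] clinearD[OF inv_len_linear] clinearD[OF b_linear]
  fix p q :: nat and w :: "'h weil"
  assume w: "w \<in> hom_part p q"
  show "b (weil_N w) = weil_N (d w)"
  proof (cases "p = 0")
    \<comment> \<open>On multiples of the unit \<open>N\<close> and \<open>d\<close> both
      vanish.\<close>
    case True
    have "weil_N w = 0" using weil_N_hom[OF w] True by simp
    moreover have "d w = 0"
      using w True by (intro linear_eq_on_wspan[OF d.linear clinear_zero _ w]) (auto simp: d.one)
    ultimately show ?thesis by (simp add: lin)
  next
    case False
    let ?pos = "wspan (\<lambda>p q. p \<noteq> 0) :: 'h weil set"
    define y where "y = weil_N w"
    have y: "y \<in> hom_part p q" unfolding y_def by (rule weil_N_closed[OF w])
    have ty: "weil_t y = y" by (simp add: y_def weil_t_weil_N)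
    have wpos: "w \<in> ?pos" and ypos: "y \<in> ?pos"
      using False w y by (auto intro: wspan_of_hom)
    have "b y \<in> ?pos"
      by (rule wspan_mono[OF _ b_hom[OF y]]) (use False in auto)
    moreover have "weil_t (b y) = b y"
      using weil_t_b[of y] ty by (simp add: lin)
    ultimately have 1: "b y = weil_N (inv_len (b y))"
      by (simp add: weil_N_fixed)
    \<comment> \<open>\<open>d (t - 1) = (t - 1) b\<close>, and \<open>N\<close> annihilates the
      image of \<open>t - 1\<close>. Thus \<open>w\<close> may be replaced by its average
      \<open>y / p\<close> inside \<open>N d\<close>.\<close>
    have Nd: "weil_N (d (z - weil_t z)) = 0" for z
      using arg_cong[OF weil_t_b[of z], of weil_N] by (simp add: lin weil_N_weil_t)
    have "weil_N (d (w - weil_N (inv_len w))) = 0"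
      unfolding avg_decomposition[OF wpos] by (rule Nd)
    then have 2: "weil_N (d w) = (1 / of_nat p) *\<^sub>C weil_N (d y)"
      using w by (simp add: lin inv_len_hom y_def)
    have "(1 / of_nat p) *\<^sub>C weil_N y = y"
      using weil_N_fixed[OF ypos ty] y by (simp add: inv_len_hom lin)
    \<comment> \<open>Being invariant, \<open>y\<close> is multiplied by \<open>p\<close> under
      \<open>N\<close>; this evaluates the inner \<open>N\<close> in
      \<open>N d0 = N c N\<close>.\<close>
    then have "of_nat p *\<^sub>C y = of_nat p *\<^sub>C (1 / of_nat p) *\<^sub>C weil_N y"
      by simp
    then have "weil_N y = of_nat p *\<^sub>C y"
      using False by (simp add: scaleC_scaleC scaleC_one)
    then have 3: "weil_N (d0 y) = of_nat p *\<^sub>C weil_N (front_d0 y)"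
      by (simp add: weil_N_d0 lin)
    have "b y = (d y - d0 y) + (d0 y + weil_t (front_d0 y))"
      by (simp add: b_eq)
    moreover have "inv_len (d y - d0 y) = (1 / of_nat p) *\<^sub>C (d y - d0 y)"
      by (rule inv_len_hom[OF d_diff_d0_hom[OF y]])
    moreover have "inv_len (d0 y + weil_t (front_d0 y)) = (1 / of_nat (Suc p)) *\<^sub>C (d0 y + weil_t (front_d0 y))"
      using d0_hom[OF y] weil_t_hom[OF front_d0_hom[OF y]] by (intro inv_len_hom) (rule wspan_closed)
    ultimately have "inv_len (b y) = (1 / of_nat p) *\<^sub>C (d y - d0 y)
        + (1 / of_nat (Suc p)) *\<^sub>C (d0 y + weil_t (front_d0 y))"
      by (simp only: clinearD(1)[OF inv_len_linear])
    then have "weil_N (inv_len (b y)) = (1 / of_nat p) *\<^sub>C (weil_N (d y) - weil_N (d0 y))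
        + (1 / of_nat (Suc p)) *\<^sub>C (weil_N (d0 y) + weil_N (front_d0 y))"
      by (simp only: lin weil_N_weil_t)
    also have "weil_N (d0 y) + weil_N (front_d0 y) = of_nat (Suc p) *\<^sub>C weil_N (front_d0 y)"
      by (simp add: 3 scaleC_add_left scaleC_one add.commute)
    also have "(1 / of_nat p) *\<^sub>C (weil_N (d y) - weil_N (d0 y))
        + (1 / of_nat (Suc p)) *\<^sub>C (of_nat (Suc p) *\<^sub>C weil_N (front_d0 y)) = (1 / of_nat p) *\<^sub>C weil_N (d y)"
      using False by (simp add: 3 cvec.scale_right_diff_distrib scaleC_scaleC scaleC_one del: of_nat_Suc)
    finally show ?thesis using 1 2 by (simp add: y_def)
  qed
qed (intro clinear_compose[OF weil_N_eqs(1)] clinear_compose[OF b_linear] weil_N_eqs(1) d.linear)+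

end

subsection \<open>Powers of the curvature ideal\<close>

lemma length_le_wdeg: "length w \<le> wdeg w"
proof (induct w)
  case (Cons a w)
  then show ?case by (cases a) auto
qed simp

text \<open>Equality of degree and length of \<open>u\<close> says that it has only letters of
  degree 1, so the displayed \<open>Curv h\<close> is the first of its kind.\<close>

lemma split_first_curv:
  assumes "length w < wdeg w"
  obtains u h v where "w = u @ Curv h # v" "wdeg u = length u"
  using assms
proof (induct w arbitrary: thesis)
  case (Cons a w)
  show ?case
  proof (cases a)
    case (Gen g)
    then obtain u h v where "w = u @ Curv h # v" "wdeg u = length u"
      using Cons by auto
    then show ?thesis using Gen Cons.prems(1)[of "a # u" h v] by simp
  next
    case (Curv g)
    then show ?thesis using Cons.prems(1)[of "[]" g w] by simp
  qed
qed simp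

text \<open>In contrast to \<open>wspan_mono\<close>, the implication is tested only at pairs
  realised by words, so that facts such as \<open>length_le_wdeg\<close> can enter.\<close>

lemma wspan_word_mono:
  assumes "\<And>w :: 'h::complex_vector gen list. P (length w) (wdeg w) \<Longrightarrow> R (length w) (wdeg w)"
  shows "(wspan P :: 'h weil set) \<subseteq> wspan R"
proof
  fix x :: "'h weil" assume "x \<in> wspan P"
  then show "x \<in> wspan R"
    by (rule linear_wspan[OF clinear_ident, rotated]) (rule monom_in_wspan, rule assms)
qed

lemma wspan_subset_iff: "cvec.subspace V \<Longrightarrow> wspan P \<subseteq> V \<longleftrightarrow> (\<forall>w. P (length w) (wdeg w) \<longrightarrow> monom w \<in> V)"
  using linear_wspan_subspace[OF clinear_ident] monom_in_wspan by blast

lemma weil_plus_eq: "weil_plus = wspan (\<lambda>p q. p \<noteq> 0)"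
  by (simp add: weil_plus_def wspan_def)

lemma in_wspan_le: "x \<in> wspan (\<lambda>p q. p \<le> q)"
  using wspan_word_mono[of "\<lambda>_ _. True" "\<lambda>p q. p \<le> q"] length_le_wdeg wspan_UNIV by blast

lemma curv_ideal_eq: "curv_ideal = wspan (\<lambda>p q. p < q)"
proof
  show "curv_ideal \<subseteq> (wspan (\<lambda>p q. p < q) :: 'a weil set)"
    unfolding curv_ideal_def
  proof (rule cvec.span_minimal[OF _ subspace_wspan], safe)
    fix x y :: "'a weil" and h
    have "x * gen (Curv h) \<in> wspan (\<lambda>p q. p < q)"
      by (rule wspan_mult[OF in_wspan_le gen_hom]) auto
    then show "x * gen (Curv h) * y \<in> wspan (\<lambda>p q. p < q)"
      by (rule wspan_mult[OF _ in_wspan_le]) auto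
  qed
  show "wspan (\<lambda>p q. p < q) \<subseteq> (curv_ideal :: 'a weil set)"
  proof (subst wspan_subset_iff, simp add: curv_ideal_def cvec.subspace_span, safe)
    fix w :: "'a gen list" assume "length w < wdeg w"
    then obtain u h v where w: "w = u @ Curv h # v" by (rule split_first_curv)
    then have "monom w = monom u * gen (Curv h) * monom v" by (simp add: mult.assoc)
    then show "monom w \<in> curv_ideal"
      unfolding curv_ideal_def by (intro cvec.span_base) blast
  qed
qed

text \<open>Degree minus length counts the curvature letters and is additive under products.
  Conversely, cutting a word just after its first curvature letter leaves exactly one in the prefix
  and all the others in the rest.\<close>

lemma curv_power_eq: "curv_power m = wspan (\<lambda>p q. p + m \<le> q)"
proof (induct m)
  case 0
  then show ?case using in_wspan_le by auto
next
  case (Suc m)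
  show ?case
  proof
    show "curv_power (Suc m) \<subseteq> (wspan (\<lambda>p q. p + Suc m \<le> q) :: 'a weil set)"
      unfolding curv_power.simps Suc curv_ideal_eq
      by (rule cvec.span_minimal[OF _ subspace_wspan], safe) (erule (1) wspan_mult, simp)
    show "wspan (\<lambda>p q. p + Suc m \<le> q) \<subseteq> (curv_power (Suc m) :: 'a weil set)"
    proof (subst wspan_subset_iff, simp add: cvec.subspace_span, safe)
      fix w :: "'a gen list" assume w: "length w + Suc m \<le> wdeg w"
      then have "length w < wdeg w" by simp
      then obtain u h v where uv: "w = u @ Curv h # v" "wdeg u = length u"
        by (rule split_first_curv)
      have "monom (u @ [Curv h]) \<in> curv_ideal"
        unfolding curv_ideal_eq by (rule monom_in_wspan) (use uv in simp)
      moreover have "monom v \<in> curv_power m"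
        unfolding Suc by (rule monom_in_wspan) (use uv w in simp)
      moreover have "monom w = monom (u @ [Curv h]) * monom v"
        using uv by (simp add: mult.assoc)
      ultimately show "monom w \<in> curv_power (Suc m)"
        unfolding curv_power.simps by (intro cvec.span_base) blast
    qed
  qed
qed

section \<open>The grading by degree and the complexes spanned by words\<close>

definition deg_proj :: "nat \<Rightarrow> 'h::complex_vector weil \<Rightarrow> 'h weil"
  where "deg_proj k = shape_ext (\<lambda>p q x. if q = k then x else 0)"

lemma deg_proj_lin: "clinear (\<lambda>x. if q = k then x else 0)"
  by (simp add: clinear_iff)

lemma deg_proj_linear: "clinear (deg_proj k)"
  unfolding deg_proj_def by (rule shape_ext_linear[OF deg_proj_lin])

lemma deg_proj_hom: "x \<in> hom_part p q \<Longrightarrow> deg_proj k x = (if q = k then x else 0)"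
  unfolding deg_proj_def by (rule shape_ext_hom[OF deg_proj_lin])

lemma deg_proj_wspan: "x \<in> wspan P \<Longrightarrow> deg_proj k x \<in> wspan (\<lambda>p q. P p q \<and> q = k)"
  by (erule wspan_hom_cases[OF deg_proj_linear]) (auto simp: deg_proj_hom intro: wspan_of_hom)

lemma deg_proj_homogeneous: "x \<in> wspan (\<lambda>p q. q = l) \<Longrightarrow> deg_proj k x = (if k = l then x else 0)"
proof -
  assume x: "x \<in> wspan (\<lambda>p q. q = l)"
  show ?thesis
    by (rule wspan_hom_eq[OF deg_proj_linear deg_proj_lin x]) (auto simp: deg_proj_hom)
qed

text \<open>An intersection of spans can exceed the span of the common words. Here
  \<open>deg_proj k\<close> excludes this: it maps \<open>wspan P\<close> into the span on the right
  and fixes every element of degree \<open>k\<close>.\<close>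

lemma wspan_Int_degree: "wspan P \<inter> wspan (\<lambda>p q. q = k) = wspan (\<lambda>p q. P p q \<and> q = k)"
proof
  show "wspan P \<inter> wspan (\<lambda>p q. q = k) \<subseteq> wspan (\<lambda>p q. P p q \<and> q = k)"
  proof
    fix x assume "x \<in> wspan P \<inter> wspan (\<lambda>p q. q = k)"
    then show "x \<in> wspan (\<lambda>p q. P p q \<and> q = k)"
      using deg_proj_wspan[of x P k] deg_proj_homogeneous[of x k k] by simp
  qed
qed (auto elim: wspan_mono[rotated])

lemma deg_proj_decomposition:
  fixes x :: "'h::complex_vector weil"
  shows
  "\<exists>A. finite A \<and> (\<forall>k. k \<notin> A \<longrightarrow> deg_proj k x = 0) \<and> x = (\<Sum>k\<in>A. deg_proj k x)"
proof -
  \<comment> \<open>Quantifying over all finite supersets \<open>B\<close> makes the set closed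
    under addition, since two index sets can be replaced by their union.\<close>
  let ?V = "{x :: 'h weil. \<exists>A. finite A \<and> (\<forall>B. finite B \<longrightarrow> A \<subseteq> B \<longrightarrow> x = (\<Sum>k\<in>B. deg_proj k x))}"
  note lin = clinearD[OF deg_proj_linear]
  have "cvec.subspace ?V"
  proof (rule cvec.subspaceI)
    show "0 \<in> ?V" by (auto simp: lin)
    fix x y :: "'h weil" and c assume "x \<in> ?V"
    then obtain A where A: "finite A" "\<And>B. finite B \<Longrightarrow> A \<subseteq> B \<Longrightarrow> x = (\<Sum>k\<in>B. deg_proj k x)"
      by blast
    have "c *\<^sub>C x = (\<Sum>k\<in>B. deg_proj k (c *\<^sub>C x))" if "finite B" "A \<subseteq> B" for B
      using A(2)[OF that] by (simp add: lin flip: cvec.scale_sum_right)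
    then show "c *\<^sub>C x \<in> ?V" using A(1) by blast
    assume "y \<in> ?V"
    then obtain A' where A': "finite A'" "\<And>B. finite B \<Longrightarrow> A' \<subseteq> B \<Longrightarrow> y = (\<Sum>k\<in>B. deg_proj k y)"
      by blast
    have "x + y = (\<Sum>k\<in>B. deg_proj k (x + y))" if "finite B" "A \<union> A' \<subseteq> B" for B
      using A(2)[of B] A'(2)[of B] that by (simp add: lin sum.distrib)
    moreover have "finite (A \<union> A')" using A A' by simp
    ultimately show "x + y \<in> ?V" by blast
  qed
  then have "x \<in> ?V"
  proof (rule linear_wspan_subspace[OF clinear_ident])
    show "x \<in> wspan (\<lambda>_ _. True)" by (simp add: wspan_UNIV)
    show "monom w \<in> ?V" for w :: "'h gen list"
      by (intro CollectI exI[of _ "{wdeg w}"]) (simp add: deg_proj_hom[OF monom_hom])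
  qed
  then obtain A where A: "finite A" "\<And>B. finite B \<Longrightarrow> A \<subseteq> B \<Longrightarrow> x = (\<Sum>k\<in>B. deg_proj k x)"
    by blast
  \<comment> \<open>The sums over \<open>A\<close> and over \<open>insert k A\<close> both equal
    \<open>x\<close>.\<close>
  have "deg_proj k x = 0" if "k \<notin> A" for k
    using A(2)[of A] A(2)[of "insert k A"] A(1) that by auto
  then show ?thesis using A(1) A(2)[of A] by blast
qed

lemma unital_weil_simps [simp]:
  "carrier (unital_weil \<Delta>) = UNIV" "zero (unital_weil \<Delta>) = 0" "add (unital_weil \<Delta>) = (+)"
  "mult (unital_weil \<Delta>) = (*)" "one (unital_weil \<Delta>) = 1"
  "smult (unital_weil \<Delta>) = scaleC" "diff (unital_weil \<Delta>) = weil_d \<Delta>"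
  "comp (unital_weil \<Delta>) k = wspan (\<lambda>p q. q = k)"
  by (simp_all add: unital_weil_def wspan_def)

text \<open>
  The differential is left open, because the same graded spaces carry both \<open>\<partial>\<close> and \<open>b\<close>.
\<close>

lemma unital_weil_module: "dg_module ((unital_weil \<Delta>)\<lparr>diff := b\<rparr>)"
proof (rule dg_moduleI)
  show "abelian_group ((unital_weil \<Delta>)\<lparr>diff := b\<rparr>)"
  proof (rule abelian_groupI)
    fix x :: "'a weil"
    show "\<exists>y\<in>carrier ((unital_weil \<Delta>)\<lparr>diff := b\<rparr>).
        y \<oplus>\<^bsub>(unital_weil \<Delta>)\<lparr>diff := b\<rparr>\<^esub> x = \<zero>\<^bsub>(unital_weil \<Delta>)\<lparr>diff := b\<rparr>\<^esub>"
      by (rule bexI[of _ "- x"]) simp_all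
  qed (simp_all add: algebra_simps)
qed (simp_all add: scaleC_add_left scaleC_add_right scaleC_scaleC scaleC_one)

lemma unital_weil_finsum:
  fixes f :: "'k \<Rightarrow> 'h::complex_vector weil"
  assumes "finite A"
  shows "(\<Oplus>\<^bsub>(unital_weil \<Delta>)\<lparr>diff := b\<rparr>\<^esub>k\<in>A. f k) = sum f A"
proof -
  interpret dg_module "(unital_weil \<Delta>)\<lparr>diff := b\<rparr>" by (rule unital_weil_module)
  from assms show ?thesis
    by (induct rule: finite_induct) (simp_all add: finsum_insert)
qed

lemma unital_weil_linear_iff:
  "linear_dg ((unital_weil \<Delta>)\<lparr>diff := b\<rparr>) ((unital_weil \<Delta>)\<lparr>diff := b\<rparr>) f \<longleftrightarrow> clinear f"
  by (simp add: linear_dg_def clinear_iff)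

lemma unital_weil_graded_complex:
  fixes b :: "'h::complex_vector weil \<Rightarrow> 'h weil"
  assumes b: "clinear b" "\<And>p q x. x \<in> hom_part p q \<Longrightarrow> b x \<in> wspan (\<lambda>p' q'. (p' = p \<or> p' = Suc p) \<and> q' = Suc q)"
    and bb: "\<And>x. b (b x) = 0"
  shows "graded_complex ((unital_weil \<Delta>)\<lparr>diff := b\<rparr>) deg_proj"
proof -
  have "(wspan (\<lambda>p q. q = k) :: 'h weil set) = range (deg_proj k)" (is "?L = ?R") for k
  proof
    show "?L \<subseteq> ?R"
    proof
      fix x :: "'h weil" assume "x \<in> wspan (\<lambda>p q. q = k)"
      then have "x = deg_proj k x" using deg_proj_homogeneous[of x k k] by simp
      then show "x \<in> range (deg_proj k)" by (rule range_eqI)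
    qed
    show "?R \<subseteq> ?L"
      using deg_proj_wspan[of _ "\<lambda>_ _. True" k] by (auto simp: wspan_UNIV)
  qed
  moreover have "deg_proj k (deg_proj l x) = (if k = l then deg_proj k x else 0)" for k l and x :: "'h weil"
    using deg_proj_homogeneous[of "deg_proj l x" l k] deg_proj_wspan[of x "\<lambda>_ _. True" l]
    by (simp add: wspan_UNIV)
  moreover have "\<exists>A. finite A \<and> (\<forall>k. k \<notin> A \<longrightarrow> deg_proj k x = 0) \<and>
      x = (\<Oplus>\<^bsub>(unital_weil \<Delta>)\<lparr>diff := b\<rparr>\<^esub>k\<in>A. deg_proj k x)" for x :: "'h weil"
    using deg_proj_decomposition[of x] by (auto simp: unital_weil_finsum)
  ultimately have "grading ((unital_weil \<Delta>)\<lparr>diff := b\<rparr>) deg_proj"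
    using unital_weil_module deg_proj_linear
    by (intro gradingI) (simp_all add: unital_weil_linear_iff)
  moreover have "b x \<in> wspan (\<lambda>p q. q = Suc k)" if "x \<in> wspan (\<lambda>p q. q = k)" for x k
    by (rule wspan_hom_cases[OF b(1) that]) (auto intro: wspan_mono[OF _ b(2)])
  ultimately show ?thesis
    using b bb by (auto simp: graded_complex_def unital_weil_linear_iff)
qed

lemma unital_weil_submodule_iff:
  "submodule S complex_ring ((unital_weil \<Delta>)\<lparr>diff := b\<rparr>) \<longleftrightarrow> cvec.subspace S"
proof -
  interpret dg_module "(unital_weil \<Delta>)\<lparr>diff := b\<rparr>" by (rule unital_weil_module)
  have inv: "a_inv ((unital_weil \<Delta>)\<lparr>diff := b\<rparr>) x = - x" for x
    using minus_equality[of "- x" x] by simp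
  show ?thesis
  proof
    assume "submodule S complex_ring ((unital_weil \<Delta>)\<lparr>diff := b\<rparr>)"
    note E = submoduleE[OF this]
    show "cvec.subspace S"
      using E(2,4,5) by (intro cvec.subspaceI) (auto, metis cvec.scale_zero_left)
  next
    assume S: "cvec.subspace S"
    show "submodule S complex_ring ((unital_weil \<Delta>)\<lparr>diff := b\<rparr>)"
      using S by (intro submoduleI) (auto simp: inv cvec.subspace_0 cvec.subspace_neg cvec.subspace_add cvec.subspace_scale)
  qed
qed

lemma sub_dg_diff_update: "sub_dg (C\<lparr>diff := b\<rparr>) S = (sub_dg C S)\<lparr>diff := b\<rparr>"
  by (simp add: sub_dg_def)

lemma quot_dg_diff_update:
  "quot_dg (C\<lparr>diff := b\<rparr>) S = (quot_dg C S)\<lparr>diff := coset_map C S b\<rparr>"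
  by (simp add: quot_dg_def coset_map_def[abs_def] a_r_coset_def[abs_def] A_RCOSETS_def set_add_def
      rcoset_mult_def[abs_def])

text \<open>The condition on \<open>P\<close> matches a differential that raises the degree by one
  and the length by at most one. It holds for nonempty words and for words with at least a given
  number of curvature letters.\<close>

lemma wspan_graded_complex:
  fixes b :: "'h::complex_vector weil \<Rightarrow> 'h weil"
  assumes b: "clinear b" "\<And>p q x. x \<in> hom_part p q \<Longrightarrow> b x \<in> wspan (\<lambda>p' q'. (p' = p \<or> p' = Suc p) \<and> q' = Suc q)"
    and bb: "\<And>x. b (b x) = 0"
    and P: "\<And>p q. P p q \<Longrightarrow> P p (Suc q) \<and> P (Suc p) (Suc q)"
  shows "graded_complex ((sub_dg (unital_weil \<Delta>) (wspan P))\<lparr>diff := b\<rparr>) deg_proj"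
proof -
  interpret dg_submodule "(unital_weil \<Delta>)\<lparr>diff := b\<rparr>" "wspan P"
    using unital_weil_module unital_weil_submodule_iff subspace_wspan
    unfolding dg_submodule_def dg_submodule_axioms_def by blast
  have "b x \<in> wspan P" if "x \<in> wspan P" for x
  proof (rule wspan_hom_cases[OF b(1) that])
    fix p q and y :: "'h weil" assume "P p q" "y \<in> hom_part p q"
    then show "b y \<in> wspan P"
      using P[of p q] by (intro wspan_mono[OF _ b(2)]) auto
  qed
  moreover have "deg_proj k x \<in> wspan P" if "x \<in> wspan P" for k x
    by (rule wspan_mono[OF _ deg_proj_wspan[OF that]]) simp
  ultimately have "graded_complex (sub_dg ((unital_weil \<Delta>)\<lparr>diff := b\<rparr>) (wspan P)) deg_proj"
    by (intro sub_graded_complex unital_weil_graded_complex[OF b bb]) auto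
  then show ?thesis by (simp only: sub_dg_diff_update)
qed

subsection \<open>Commutators\<close>

definition cyc_diff :: "'h::complex_vector weil \<Rightarrow> 'h weil"
  where "cyc_diff x = weil_t x - x"

lemma cyc_diff_linear: "clinear cyc_diff"
  unfolding cyc_diff_def[abs_def] by (intro clinear_intros weil_t_eqs(1))

lemma cyc_diff_wspan: "x \<in> wspan P \<Longrightarrow> cyc_diff x \<in> wspan P"
  unfolding cyc_diff_def by (intro wspan_closed weil_t_wspan)

lemma subspace_cyc_diff: "cvec.subspace (cyc_diff ` wspan P)"
proof (rule cvec.subspaceI)
  note lin = clinearD[OF cyc_diff_linear]
  show "0 \<in> cyc_diff ` wspan P"
    by (rule image_eqI[of _ cyc_diff 0]) (simp_all add: lin)
  fix x y :: "'a weil" and c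
  assume "x \<in> cyc_diff ` wspan P"
  then obtain x' where x: "x = cyc_diff x'" "x' \<in> wspan P" by blast
  then show "c *\<^sub>C x \<in> cyc_diff ` wspan P"
    by (intro image_eqI[of _ cyc_diff "c *\<^sub>C x'"]) (simp_all add: lin)
  assume "y \<in> cyc_diff ` wspan P"
  then obtain y' where y: "y = cyc_diff y'" "y' \<in> wspan P" by blast
  with x show "x + y \<in> cyc_diff ` wspan P"
    by (intro image_eqI[of _ cyc_diff "x' + y'"]) (simp_all add: lin)
qed

lemma weil_t_pow_diff: "x - (weil_t ^^ i) x = cyc_diff (- (\<Sum>j<i. (weil_t ^^ j) x))"
proof (induct i)
  case (Suc i)
  have "cyc_diff (- (\<Sum>j<Suc i. (weil_t ^^ j) x)) =
      cyc_diff (- (\<Sum>j<i. (weil_t ^^ j) x)) - cyc_diff ((weil_t ^^ i) x)"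
    by (simp add: clinearD[OF cyc_diff_linear])
  then show ?case
    by (simp only: Suc[symmetric]) (simp add: cyc_diff_def)
qed (simp add: clinearD[OF cyc_diff_linear])

text \<open>By the block rotation, the commutator with \<open>u\<close> is \<open>1 - t^i\<close>
  for \<open>i = length u\<close>, so it lies in the image of \<open>t - 1\<close>.\<close>

lemma word_commutator:
  "monom u * monom v - (-1) ^ (wdeg u * wdeg v) *\<^sub>C (monom v * monom u) =
    monom u * monom v - (weil_t ^^ length u) (monom u * monom v)"
  by (simp add: weil_t_pow_hom[OF monom_hom] sgn_op_monom scaleC_mult_weil)

lemma commutator_image:
  fixes x y :: "'h::complex_vector weil"
  assumes x: "x \<in> wspan P" "x \<in> wspan (\<lambda>p q. q = k)"
    and y: "y \<in> wspan R" "y \<in> wspan (\<lambda>p q. q = l)"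
    and S: "\<And>p q p' q'. P p q \<Longrightarrow> R p' q' \<Longrightarrow> S (p + p') (q + q')"
  shows "x * y - (-1) ^ (k * l) *\<^sub>C (y * x) \<in> cyc_diff ` wspan S"
proof -
  have x': "x \<in> wspan (\<lambda>p q. P p q \<and> q = k)" and y': "y \<in> wspan (\<lambda>p q. R p q \<and> q = l)"
    using x y by (simp_all flip: wspan_Int_degree)
  show ?thesis
  proof (rule linear_wspan_subspace[OF _ subspace_cyc_diff _ x'])
    fix u :: "'h gen list" assume u: "P (length u) (wdeg u) \<and> wdeg u = k"
    show "monom u * y - (-1) ^ (k * l) *\<^sub>C (y * monom u) \<in> cyc_diff ` wspan S"
    proof (rule linear_wspan_subspace[OF _ subspace_cyc_diff _ y'])
      fix v :: "'h gen list" assume v: "R (length v) (wdeg v) \<and> wdeg v = l"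
      have "monom u * monom v \<in> wspan S"
        using S[of "length u" "wdeg u" "length v" "wdeg v"] u v monom_in_wspan[of S "u @ v"] by auto
      then have "(weil_t ^^ j) (monom u * monom v) \<in> wspan S" for j
        by (induct j) (simp_all add: weil_t_wspan)
      then have "cyc_diff (- (\<Sum>j<length u. (weil_t ^^ j) (monom u * monom v))) \<in> cyc_diff ` wspan S"
        by (intro imageI wspan_closed)
      then show "monom u * monom v - (-1) ^ (k * l) *\<^sub>C (monom v * monom u) \<in> cyc_diff ` wspan S"
        using word_commutator[of u v] u v by (simp add: weil_t_pow_diff)
    qed (intro clinear_intros)
  qed (intro clinear_intros)
qed

text \<open>
  Let \<open>w = u \<omega> v\<close> with \<open>\<omega>\<close> the first letter of degree 2. Then \<open>u \<omega>\<close> lies in the ideal \<open>I(H)\<close> and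
  \<open>v\<close> in \<open>I(H)\<^sup>n\<close>, so that \<open>w\<close> is up to sign congruent to \<open>v u \<omega>\<close> modulo commutators. If \<open>u\<close> is
  nonempty, the same reasoning applies to \<open>t w\<close> and leads to the same word.
\<close>

lemma cyc_diff_in_commutators:
  fixes V :: "'h::complex_vector weil set"
  assumes V: "cvec.subspace V"
    and comm: "\<And>k l x y. x \<in> wspan (\<lambda>p q. p < q) \<Longrightarrow> x \<in> wspan (\<lambda>p q. q = k) \<Longrightarrow>
      y \<in> wspan (\<lambda>p q. p + n \<le> q) \<Longrightarrow> y \<in> wspan (\<lambda>p q. q = l) \<Longrightarrow>
      x * y - (-1) ^ (k * l) *\<^sub>C (y * x) \<in> V"
    and x: "x \<in> wspan (\<lambda>p q. p + Suc n \<le> q)"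
  shows "cyc_diff x \<in> V"
proof (rule linear_wspan_subspace[OF cyc_diff_linear V _ x])
  have rot: "monom (u @ v) - (weil_t ^^ length u) (monom (u @ v)) \<in> V"
    if "length u < wdeg u" "length v + n \<le> wdeg v" for u v :: "'h gen list"
    using comm[of "monom u" "wdeg u" "monom v" "wdeg v"] that word_commutator[of u v]
    by (simp add: monom_in_wspan)
  fix w :: "'h gen list" assume w: "length w + Suc n \<le> wdeg w"
  then have "length w < wdeg w" by simp
  then obtain u h v where uv: "w = u @ Curv h # v" "wdeg u = length u"
    by (rule split_first_curv)
  have w_rot: "monom w - (weil_t ^^ Suc (length u)) (monom w) \<in> V"
    using rot[of "u @ [Curv h]" v] uv w by (simp del: funpow.simps)
  show "cyc_diff (monom w) \<in> V"
  proof (cases u)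
    case Nil
    then show ?thesis
      using cvec.subspace_neg[OF V w_rot] by (simp add: cyc_diff_def)
  next
    case (Cons e u')
    have e: "length v + Suc n \<le> wdeg v + gdeg e"
      using uv w by (cases e) auto
    have "wdeg u' = length u'"
      using uv Cons length_le_wdeg[of u'] by (cases e) auto
    then have "monom (u' @ Curv h # v @ [e]) - (weil_t ^^ Suc (length u')) (monom (u' @ Curv h # v @ [e])) \<in> V"
      using rot[of "u' @ [Curv h]" "v @ [e]"] e by (simp del: funpow.simps)
    note cvec.subspace_scale[OF V this, of "(-1) ^ (gdeg e * wdeg (u' @ Curv h # v))"]
    moreover have "weil_t (monom w) = (-1) ^ (gdeg e * wdeg (u' @ Curv h # v)) *\<^sub>C monom (u' @ Curv h # v @ [e])"
      using weil_t_gen[of e "monom (u' @ Curv h # v)"] sgn_op_monom[of "gdeg e" "u' @ Curv h # v"]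
      by (simp add: uv Cons scaleC_mult_weil mult.assoc)
    ultimately have "weil_t (monom w) - (weil_t ^^ Suc (length u')) (weil_t (monom w)) \<in> V"
      by (simp add: cvec.scale_right_diff_distrib clinearD[OF weil_t_pow_linear] clinearD[OF weil_t_eqs(1)])
    moreover have "(weil_t ^^ Suc (length u')) (weil_t (monom w)) = (weil_t ^^ Suc (length u)) (monom w)"
      using Cons by (simp add: funpow_swap1)
    ultimately have "weil_t (monom w) - (weil_t ^^ Suc (length u)) (monom w) \<in> V"
      by simp
    from cvec.subspace_diff[OF V this w_rot] show ?thesis by (simp add: cyc_diff_def)
  qed
qed

lemma cyc_diff_word_commutator:
  "cyc_diff (monom (a # v)) =
    - (gen a * monom v - (-1) ^ (gdeg a * wdeg v) *\<^sub>C (monom v * gen a))"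
  by (simp add: cyc_diff_def weil_t_gen sgn_op_monom scaleC_mult_weil)

lemma weil_N_cyc_diff: "weil_N (cyc_diff x) = 0"
  by (simp add: cyc_diff_def clinearD[OF weil_N_eqs(1)] weil_N_weil_t)

lemma cyc_diff_weil_N: "cyc_diff (weil_N x) = 0"
  by (simp add: cyc_diff_def weil_t_weil_N)

text \<open>The first form shows that the kernel of \<open>t - 1\<close> is the image of
  \<open>N\<close>, the second that the kernel of \<open>N\<close> is the image of
  \<open>t - 1\<close>. Both remain usable modulo a span of words, as every operator involved
  preserves it.\<close>

lemma avg_decomposition_cyc_diff:
  assumes "x \<in> wspan (\<lambda>p q. p \<noteq> 0)"
  shows "x = weil_N (inv_len x) + part_avg (- cyc_diff x)"
    and "x = inv_len (weil_N x) + cyc_diff (- part_avg x)"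
proof -
  show "x = weil_N (inv_len x) + part_avg (- cyc_diff x)"
    using avg_decomposition(1)[OF assms] by (simp add: cyc_diff_def algebra_simps)
  show "x = inv_len (weil_N x) + cyc_diff (- part_avg x)"
    using avg_decomposition[OF assms]
    by (simp add: clinearD[OF cyc_diff_linear] inv_len_weil_N) (simp add: cyc_diff_def algebra_simps)
qed

section \<open>The exact sequence for the powers of the curvature ideal\<close>

context coalgebra
begin

lemma cyc_diff_b: "cyc_diff (b x) = d (cyc_diff x)"
  by (simp add: cyc_diff_def weil_t_b)

lemma unital_weil_diff_update: "(unital_weil comult)\<lparr>diff := d\<rparr> = unital_weil comult"
  by (simp add: unital_weil_def)

lemma d_graded_complex:
  "(\<And>p q. P p q \<Longrightarrow> P p (Suc q) \<and> P (Suc p) (Suc q)) \<Longrightarrow>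
    graded_complex (sub_dg (unital_weil comult) (wspan P)) deg_proj"
  using wspan_graded_complex[OF d.linear d.hom d_d, of P comult]
  by (simp add: unital_weil_diff_update flip: sub_dg_diff_update)

lemma b_graded_complex:
  "(\<And>p q. P p q \<Longrightarrow> P p (Suc q) \<and> P (Suc p) (Suc q)) \<Longrightarrow>
    graded_complex ((sub_dg (unital_weil comult) (wspan P))\<lparr>diff := b\<rparr>) deg_proj"
  by (rule wspan_graded_complex[OF b_linear b_hom b_b])

lemma sub_weil_linear:
  "clinear f \<Longrightarrow> (\<And>x. x \<in> wspan P \<Longrightarrow> f x \<in> wspan P) \<Longrightarrow>
    linear_dg (sub_dg (unital_weil comult) (wspan P)) (sub_dg (unital_weil comult) (wspan P)) f"
  by (simp add: linear_dg_def clinear_iff)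

lemma curv_power_positive: "curv_power (Suc n) \<subseteq> wspan (\<lambda>p q. p \<noteq> 0)"
  unfolding curv_power_eq by (rule wspan_word_mono) auto

text \<open>Commutators lie in the image because the numbers of curvature letters add up, at least 1
  and at least \<open>n\<close>. The converse inclusion is
  \<open>cyc_diff_in_commutators\<close>.\<close>

lemma In_comm_eq: "In_comm comult n = cyc_diff ` curv_power (Suc n)"
proof -
  interpret dg_module "unital_weil comult"
    using unital_weil_module[of d comult] by (simp add: unital_weil_diff_update)
  have sub: "submodule V complex_ring (unital_weil comult) \<longleftrightarrow> cvec.subspace V" for V
    using unital_weil_submodule_iff[of V d comult] by (simp add: unital_weil_diff_update)
  have minus: "x \<ominus>\<^bsub>unital_weil comult\<^esub> y = x - y" for x y
    using inv_eq_smult[of y] by (simp add: M.minus_eq scaleC_one)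
  show ?thesis
    unfolding In_comm_def graded_comm_def
  proof (rule submodule_span_eqI)
    show "submodule (cyc_diff ` curv_power (Suc n)) complex_ring (unital_weil comult)"
      unfolding sub curv_power_eq by (rule subspace_cyc_diff)
  next
    show "{x \<otimes>\<^bsub>unital_weil comult\<^esub> y \<ominus>\<^bsub>unital_weil comult\<^esub>
        ((-1) ^ (k * l)) \<odot>\<^bsub>unital_weil comult\<^esub> (y \<otimes>\<^bsub>unital_weil comult\<^esub> x) | k l x y.
        x \<in> curv_ideal \<inter> comp (unital_weil comult) k \<and> y \<in> curv_power n \<inter> comp (unital_weil comult) l}
      \<subseteq> cyc_diff ` curv_power (Suc n)"
      unfolding curv_power_eq curv_ideal_eq minus
      by (auto intro!: commutator_image)
  next
    fix V :: "'h weil set"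
    assume V: "submodule V complex_ring (unital_weil comult)"
      and G: "{x \<otimes>\<^bsub>unital_weil comult\<^esub> y \<ominus>\<^bsub>unital_weil comult\<^esub>
        ((-1) ^ (k * l)) \<odot>\<^bsub>unital_weil comult\<^esub> (y \<otimes>\<^bsub>unital_weil comult\<^esub> x) | k l x y.
        x \<in> curv_ideal \<inter> comp (unital_weil comult) k \<and> y \<in> curv_power n \<inter> comp (unital_weil comult) l} \<subseteq> V"
    show "cyc_diff ` curv_power (Suc n) \<subseteq> V"
      unfolding curv_power_eq
    proof (rule image_subsetI, erule cyc_diff_in_commutators[rotated 2])
      show "cvec.subspace V" using V sub by simp
      show "x * y - (-1) ^ (k * l) *\<^sub>C (y * x) \<in> V"
        if "x \<in> wspan (\<lambda>p q. p < q)" "x \<in> wspan (\<lambda>p q. q = k)"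
          "y \<in> wspan (\<lambda>p q. p + n \<le> q)" "y \<in> wspan (\<lambda>p q. q = l)" for k l x y
        using that by (intro subsetD[OF G]) (auto simp: minus curv_power_eq curv_ideal_eq)
    qed
  qed
qed

theorem In_exact:
  "exact_complexes
     (In_nat comult n) (descend weil_N) (In_b comult n) (\<lambda>x. weil_t x - x)
     (In comult n) (\<lambda>x. In_comm comult n +>\<^bsub>In comult n\<^esub> x) (In_nat comult n)"
proof -
  let ?P = "\<lambda>p q. p + Suc n \<le> q"
  have In_eq: "In comult n = sub_dg (unital_weil comult) (wspan ?P)"
    by (simp add: In_def curv_power_eq)
  have pos: "x \<in> wspan (\<lambda>p q. p \<noteq> 0)" if "x \<in> wspan ?P" for x :: "'h weil"
    using that curv_power_positive[of n] by (auto simp: curv_power_eq)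
  have "exact_complexes (quot_dg (In comult n) (In_comm comult n)) (descend weil_N)
     ((In comult n)\<lparr>diff := b\<rparr>) cyc_diff (In comult n)
     (\<lambda>x. In_comm comult n +>\<^bsub>In comult n\<^esub> x) (quot_dg (In comult n) (In_comm comult n))"
    unfolding In_eq In_comm_eq curv_power_eq
  proof (rule exact_coinvariants)
    show "graded_complex (sub_dg (unital_weil comult) (wspan ?P)) deg_proj"
      by (rule d_graded_complex) simp
    show "graded_complex ((sub_dg (unital_weil comult) (wspan ?P))\<lparr>diff := b\<rparr>) deg_proj"
      by (rule b_graded_complex) simp
    show "x \<in> carrier (sub_dg (unital_weil comult) (wspan ?P)) \<Longrightarrow>
      cyc_diff x = \<zero>\<^bsub>sub_dg (unital_weil comult) (wspan ?P)\<^esub> \<longleftrightarrow>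
      x \<in> weil_N ` carrier (sub_dg (unital_weil comult) (wspan ?P))" for x
      using avg_decomposition_cyc_diff(1)[OF pos, of x] inv_len_wspan[of x ?P]
      by (auto simp: cyc_diff_weil_N clinearD[OF part_avg_linear])
    show "x \<in> carrier (sub_dg (unital_weil comult) (wspan ?P)) \<Longrightarrow>
      weil_N x = \<zero>\<^bsub>sub_dg (unital_weil comult) (wspan ?P)\<^esub> \<longleftrightarrow> x \<in> cyc_diff ` wspan ?P" for x
      using avg_decomposition_cyc_diff(2)[OF pos, of x] part_avg_wspan[of x ?P]
      by (auto simp: weil_N_cyc_diff clinearD[OF inv_len_linear])
  qed (auto simp: sub_weil_linear cyc_diff_linear weil_N_eqs(1) cyc_diff_wspan weil_N_wspan
      cyc_diff_b b_weil_N)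
  then show ?thesis by (simp add: In_nat_def In_b_def cyc_diff_def[abs_def])
qed

end

text \<open>From here on \<open>curv_power (Suc n)\<close> is the subspace that is divided out, and
  simplification should not unfold it into products.\<close>

declare curv_power.simps(2) [simp del]

section \<open>The exact sequence for the quotients \<open>W\<^sub>n(H)\<close>\<close>

context coalgebra
begin

context
  fixes n :: nat
begin

abbreviation (input) "W \<equiv> weil_dg comult"
abbreviation (input) "K \<equiv> curv_power (Suc n) :: 'h weil set"

lemma weil_dg_eq: "W = sub_dg (unital_weil comult) (wspan (\<lambda>p q. p \<noteq> 0))"
  by (simp add: weil_dg_def weil_plus_eq)

lemma weil_dg_simps:
  "carrier W = wspan (\<lambda>p q. p \<noteq> 0)" "zero W = 0" "add W = (+)" "mult W = (*)" "smult W = scaleC"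
  "diff W = d" "comp W k = wspan (\<lambda>p q. q = k) \<inter> wspan (\<lambda>p q. p \<noteq> 0)"
  by (simp_all add: weil_dg_eq)

text \<open>Stated for any record with these fields, because it is applied to \<open>W(H)\<close>
  with each of the two differentials.\<close>

lemma curv_power_submodule: "dg_module C \<Longrightarrow> carrier C = wspan (\<lambda>p q. p \<noteq> 0) \<Longrightarrow>
    zero C = 0 \<Longrightarrow> add C = (+) \<Longrightarrow> smult C = scaleC \<Longrightarrow> dg_submodule C K"
  using curv_power_positive[of n]
  by (intro dg_module.dg_submoduleI) (auto simp: curv_power_eq)

lemma W_graded: "graded_complex W deg_proj"
  unfolding weil_dg_eq by (rule d_graded_complex) simp

lemma W_b_graded: "graded_complex (W\<lparr>diff := b\<rparr>) deg_proj"
  unfolding weil_dg_eq by (rule b_graded_complex) simp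

lemma W_module: "dg_module W" "dg_module (W\<lparr>diff := b\<rparr>)"
  using W_graded W_b_graded by (simp_all add: graded_complex_def grading_def)

interpretation W: dg_submodule W K
  using W_module(1) by (rule curv_power_submodule) (simp_all add: weil_dg_simps)

interpretation Wb: dg_submodule "W\<lparr>diff := b\<rparr>" K
  using W_module(2) by (rule curv_power_submodule) (simp_all add: weil_dg_simps)

abbreviation (input) "cls x \<equiv> K +>\<^bsub>W\<^esub> x"

lemma curv_power_preserved:
  assumes "clinear f" "\<And>p q x. x \<in> hom_part p q \<Longrightarrow> f x \<in> wspan (\<lambda>p' q'. (p' = p \<or> p' = Suc p) \<and> q' = Suc q)"
  shows "f ` K \<subseteq> K"
proof (rule image_subsetI)
  fix x :: "'h weil" assume "x \<in> K"
  then show "f x \<in> K"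
    unfolding curv_power_eq
  proof (rule wspan_hom_cases[OF assms(1)])
    fix p q and y :: "'h weil" assume "p + Suc n \<le> q" "y \<in> hom_part p q"
    then show "f y \<in> wspan (\<lambda>p q. p + Suc n \<le> q)"
      by (intro wspan_mono[OF _ assms(2)]) auto
  qed
qed

lemma W_linear: "clinear f \<Longrightarrow> (\<And>P x. x \<in> wspan P \<Longrightarrow> f x \<in> wspan P) \<Longrightarrow> linear_dg W W f"
  unfolding weil_dg_eq by (rule sub_weil_linear)

lemma W_d_linear: "linear_dg W W d" "linear_dg W W b"
  using W_graded W_b_graded by (auto simp: graded_complex_def linear_dg_def weil_dg_simps)

lemma Wn_map_cls:
  assumes "linear_dg W W f" "f ` K \<subseteq> K" "x \<in> weil_plus"
  shows "Wn_map comult n f (cls x) = cls (f x)"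
  unfolding Wn_map_def using assms by (intro W.coset_map_eq) (simp_all add: weil_dg_simps weil_plus_eq)

lemma deg_proj_preserves: "x \<in> wspan P \<Longrightarrow> deg_proj k x \<in> wspan P"
  by (rule wspan_mono[OF _ deg_proj_wspan]) auto

lemma curv_power_shape_preserved: "(\<And>P x. x \<in> wspan P \<Longrightarrow> f x \<in> wspan P) \<Longrightarrow> f ` K \<subseteq> K"
  unfolding curv_power_eq by blast

lemma curv_power_ideal:
  assumes "x \<in> K"
  shows "x * y \<in> K" "y * x \<in> K"
  using assms unfolding curv_power_eq
  by (auto intro: wspan_mult[OF _ in_wspan_le] wspan_mult[OF in_wspan_le])

lemma cls_eq_iff: "x \<in> weil_plus \<Longrightarrow> y \<in> weil_plus \<Longrightarrow> cls x = cls y \<longleftrightarrow> x - y \<in> K"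
  using W.coset_eq_iff[of x y] W.inv_eq_smult[of y]
  by (simp add: W.M.minus_eq weil_dg_simps weil_plus_eq scaleC_one)

lemma weil_plus_mult: "x \<in> weil_plus \<Longrightarrow> x * y \<in> weil_plus"
  unfolding weil_plus_eq by (erule wspan_mult[OF _ in_wspan_le]) simp

text \<open>The product of cosets is a union over pairs of representatives. It is constant on them
  because \<open>x' * y' - x * y = (x' - x) * y' + x * (y' - y)\<close> lies in the ideal
  \<open>K\<close>.\<close>

lemma Wn_mult_cls:
  assumes x: "x \<in> weil_plus" and y: "y \<in> weil_plus"
  shows "cls x \<otimes>\<^bsub>Wn comult n\<^esub> cls y = cls (x * y)"
proof -
  have "cls (x' * y') = cls (x * y)" if "x' \<in> cls x" "y' \<in> cls y" for x' y'
  proof -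
    have car: "x' \<in> weil_plus" "y' \<in> weil_plus"
      using that x y W.a_r_coset_subset_G[OF W.a_subset]
      by (auto simp: weil_dg_simps weil_plus_eq)
    have "cls x' = cls x" "cls y' = cls y"
      using W.a_repr_independence'[OF that(1)] W.a_repr_independence'[OF that(2)] x y
      by (simp_all add: weil_dg_simps weil_plus_eq)
    then have "x' - x \<in> K" "y' - y \<in> K" using car x y by (simp_all add: cls_eq_iff)
    then have "(x' - x) * y' + x * (y' - y) \<in> K"
      using curv_power_ideal unfolding curv_power_eq by (intro wspan_closed(2)) blast+
    then show ?thesis
      using car x y by (simp add: cls_eq_iff weil_plus_mult algebra_simps)
  qed
  note const = this
  have "x \<in> cls x" "y \<in> cls y"
    using x y by (auto intro!: W.a_rcos_self simp: weil_dg_simps weil_plus_eq)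
  then have ne: "cls x \<noteq> {}" "cls y \<noteq> {}" by (metis empty_iff)+
  have "cls x \<otimes>\<^bsub>Wn comult n\<^esub> cls y = (\<Union>x'\<in>cls x. \<Union>y'\<in>cls y. cls (x' * y'))"
    by (simp add: Wn_def quot_dg_def rcoset_mult_def weil_dg_simps)
  also have "\<dots> = (\<Union>x'\<in>cls x. \<Union>y'\<in>cls y. cls (x * y))"
    by (intro SUP_cong refl) (rule const)
  also have "\<dots> = cls (x * y)" using ne by simp
  finally show ?thesis .
qed

abbreviation (input) "Q \<equiv> Wn comult n"

lemma Wn_quot: "Q = quot_dg W K"
  by (simp add: Wn_def)

lemma Wn_carrier: "carrier Q = cls ` weil_plus"
  by (simp add: Wn_quot W.quot_carrier weil_dg_simps weil_plus_eq)

lemma Wn_comp: "comp Q k = cls ` (wspan (\<lambda>p q. q = k) \<inter> weil_plus)"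
  by (simp add: Wn_quot W.quot_comp weil_dg_simps weil_plus_eq)

lemma Wn_zero: "\<zero>\<^bsub>Q\<^esub> = cls 0"
  by (simp add: Wn_quot W.quot_zero weil_dg_simps)

lemma Wn_module: "dg_module Q"
  unfolding Wn_quot by (rule W.quot_module)

lemma cls_zero_iff: "x \<in> weil_plus \<Longrightarrow> cls x = cls 0 \<longleftrightarrow> x \<in> K"
  using cls_eq_iff[of x 0] by (simp add: weil_plus_eq)

lemma Wn_map_cyc_diff: "x \<in> weil_plus \<Longrightarrow> Wn_map comult n cyc_diff (cls x) = cls (cyc_diff x)"
  by (intro Wn_map_cls W_linear curv_power_shape_preserved cyc_diff_linear cyc_diff_wspan)

lemma Wn_map_weil_N: "x \<in> weil_plus \<Longrightarrow> Wn_map comult n weil_N (cls x) = cls (weil_N x)"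
  by (intro Wn_map_cls W_linear curv_power_shape_preserved weil_N_eqs(1) weil_N_wspan)

lemma Wn_map_d: "x \<in> weil_plus \<Longrightarrow> Wn_map comult n d (cls x) = cls (d x)"
  by (intro Wn_map_cls W_d_linear curv_power_preserved d.linear d.hom)

lemma Wn_map_b: "x \<in> weil_plus \<Longrightarrow> Wn_map comult n b (cls x) = cls (b x)"
  by (intro Wn_map_cls W_d_linear curv_power_preserved b_linear b_hom)

lemma Wn_map_linear: "linear_dg W W f \<Longrightarrow> f ` K \<subseteq> K \<Longrightarrow> linear_dg Q Q (Wn_map comult n f)"
  unfolding Wn_quot Wn_map_def[abs_def] by (rule W.coset_map_linear)

lemma Wn_map_cyc_diff_linear: "linear_dg Q Q (Wn_map comult n cyc_diff)"
  by (intro Wn_map_linear W_linear curv_power_shape_preserved cyc_diff_linear cyc_diff_wspan)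

lemma Wn_map_weil_N_linear: "linear_dg Q Q (Wn_map comult n weil_N)"
  by (intro Wn_map_linear W_linear curv_power_shape_preserved weil_N_eqs(1) weil_N_wspan)

lemma Wn_commutator:
  assumes x: "x \<in> weil_plus" and y: "y \<in> weil_plus"
  shows "cls x \<otimes>\<^bsub>Q\<^esub> cls y \<ominus>\<^bsub>Q\<^esub> (a \<odot>\<^bsub>Q\<^esub> (cls y \<otimes>\<^bsub>Q\<^esub> cls x)) = cls (x * y - a *\<^sub>C (y * x))"
proof -
  have xy: "x * y \<in> carrier W" "y * x \<in> carrier W" "a *\<^sub>C (y * x) \<in> carrier W"
    using x y weil_plus_mult by (auto simp: weil_dg_simps weil_plus_eq)
  have "cls (x * y \<ominus>\<^bsub>W\<^esub> (a *\<^sub>C (y * x))) = cls (x * y) \<ominus>\<^bsub>Q\<^esub> cls (a *\<^sub>C (y * x))"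
    unfolding Wn_quot
    by (rule linear_dg_minus[OF W_module(1) W.quot_module W.proj_linear xy(1,3)])
  moreover have "x * y \<ominus>\<^bsub>W\<^esub> (a *\<^sub>C (y * x)) = x * y - a *\<^sub>C (y * x)"
    using W.inv_eq_smult[OF xy(3)] by (simp add: W.M.minus_eq weil_dg_simps scaleC_scaleC cvec.scale_minus_left)
  moreover have "a \<odot>\<^bsub>Q\<^esub> cls (y * x) = cls (a *\<^sub>C (y * x))"
    unfolding Wn_quot using W.quot_smult[OF xy(2), of a] by (simp add: weil_dg_simps)
  ultimately show ?thesis using x y by (simp add: Wn_mult_cls)
qed

text \<open>On a word \<open>a v\<close> the operator \<open>t - 1\<close> is minus the commutator
  of \<open>a\<close> with \<open>v\<close>. Unlike for the powers of the ideal, any two nonempty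
  factors are admissible, so the first letter can simply be split off.\<close>

lemma Wn_comm_eq: "Wn_comm comult n = Wn_map comult n cyc_diff ` carrier Q"
  unfolding Wn_comm_def graded_comm_def
proof (rule submodule_span_eqI)
  show "submodule (Wn_map comult n cyc_diff ` carrier Q) complex_ring Q"
    by (rule linear_dg_image_submodule[OF Wn_module Wn_module Wn_map_cyc_diff_linear])
next
  show "{X \<otimes>\<^bsub>Q\<^esub> Y \<ominus>\<^bsub>Q\<^esub> (((-1) ^ (k * l)) \<odot>\<^bsub>Q\<^esub> (Y \<otimes>\<^bsub>Q\<^esub> X)) | k l X Y.
      X \<in> carrier Q \<inter> comp Q k \<and> Y \<in> carrier Q \<inter> comp Q l} \<subseteq> Wn_map comult n cyc_diff ` carrier Q"
  proof safe
    fix k l X Y assume "X \<in> comp Q k" "Y \<in> comp Q l"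
    then obtain x y where x: "X = cls x" "x \<in> weil_plus" "x \<in> wspan (\<lambda>p q. q = k)"
      and y: "Y = cls y" "y \<in> weil_plus" "y \<in> wspan (\<lambda>p q. q = l)"
      by (auto simp: Wn_comp)
    have "x * y - (-1) ^ (k * l) *\<^sub>C (y * x) \<in> cyc_diff ` weil_plus"
      using x y unfolding weil_plus_eq
      by (intro commutator_image[where P = "\<lambda>p q. p \<noteq> 0" and R = "\<lambda>p q. p \<noteq> 0"]) simp_all
    then obtain z where z: "z \<in> weil_plus" "x * y - (-1) ^ (k * l) *\<^sub>C (y * x) = cyc_diff z"
      by blast
    show "X \<otimes>\<^bsub>Q\<^esub> Y \<ominus>\<^bsub>Q\<^esub> (((-1) ^ (k * l)) \<odot>\<^bsub>Q\<^esub> (Y \<otimes>\<^bsub>Q\<^esub> X)) \<in> Wn_map comult n cyc_diff ` carrier Q"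
      using x y z Wn_map_cyc_diff[OF z(1)]
      by (intro image_eqI[of _ "Wn_map comult n cyc_diff" "cls z"]) (simp_all add: Wn_commutator Wn_carrier)
  qed
next
  fix V assume V: "submodule V complex_ring Q"
    and G: "{X \<otimes>\<^bsub>Q\<^esub> Y \<ominus>\<^bsub>Q\<^esub> (((-1) ^ (k * l)) \<odot>\<^bsub>Q\<^esub> (Y \<otimes>\<^bsub>Q\<^esub> X)) | k l X Y.
      X \<in> carrier Q \<inter> comp Q k \<and> Y \<in> carrier Q \<inter> comp Q l} \<subseteq> V"
  interpret Q: dg_module Q by (rule Wn_module)
  note E = Q.submoduleE[OF V]
  \<comment> \<open>Pulling \<open>V\<close> back to \<open>W(H)\<close> reduces the inclusion to a
    check on words.\<close>
  let ?V = "{x \<in> weil_plus. cls x \<in> V}"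
  obtain v where v: "v \<in> V" using E(2) by blast
  have zero: "cls 0 \<in> V"
    using E(4)[of 0 v] Q.smult_l_null[of v] E(1) v by (auto simp: Wn_zero)
  have sub: "cvec.subspace ?V"
  proof (rule cvec.subspaceI)
    show "0 \<in> ?V" using zero by (simp add: weil_plus_eq)
    fix x y :: "'h weil" and a
    assume x: "x \<in> ?V"
    then have "cls (a *\<^sub>C x) = a \<odot>\<^bsub>Q\<^esub> cls x"
      using W.quot_smult[of x a] by (simp add: weil_dg_simps weil_plus_eq Wn_quot)
    then show "a *\<^sub>C x \<in> ?V" using x E(4)[of a "cls x"] by (simp add: weil_plus_eq)
    assume y: "y \<in> ?V"
    have "cls (x + y) = cls x \<oplus>\<^bsub>Q\<^esub> cls y"
      using W.quot_add[of x y] x y by (simp add: weil_dg_simps weil_plus_eq Wn_quot)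
    then show "x + y \<in> ?V" using x y E(5)[of "cls x" "cls y"] by (simp add: weil_plus_eq)
  qed
  have "cyc_diff x \<in> ?V" if "x \<in> weil_plus" for x
  proof (rule linear_wspan_subspace[OF cyc_diff_linear sub _ that[unfolded weil_plus_eq]])
    fix w :: "'h gen list" assume "length w \<noteq> 0"
    then obtain a v where w: "w = a # v" by (cases w) auto
    show "cyc_diff (monom w) \<in> ?V"
    proof (cases "v = []")
      \<comment> \<open>A single letter is not a product in the algebra without unit, but
        \<open>t\<close> fixes it.\<close>
      case True
      then have "cyc_diff (monom w) = 0"
        by (simp add: w cyc_diff_word_commutator del: monom_simps(2))
      then show ?thesis using zero by (simp add: weil_plus_eq)
    next
      case False
      have a: "gen a \<in> weil_plus" "gen a \<in> wspan (\<lambda>p q. q = gdeg a)"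
        and v: "monom v \<in> weil_plus" "monom v \<in> wspan (\<lambda>p q. q = wdeg v)"
        unfolding weil_plus_eq using False
        by (auto intro: wspan_of_hom[OF _ gen_hom] monom_in_wspan)
      have "cls (gen a * monom v - (-1) ^ (gdeg a * wdeg v) *\<^sub>C (monom v * gen a)) \<in> V"
        unfolding Wn_commutator[OF a(1) v(1), symmetric]
      proof (rule subsetD[OF G], intro CollectI exI conjI, rule refl)
        show "cls (gen a) \<in> carrier Q \<inter> comp Q (gdeg a)"
          "cls (monom v) \<in> carrier Q \<inter> comp Q (wdeg v)"
          using a v by (simp_all add: Wn_carrier Wn_comp)
      qed
      then have "gen a * monom v - (-1) ^ (gdeg a * wdeg v) *\<^sub>C (monom v * gen a) \<in> ?V"
        using a(1) v(1) weil_plus_mult unfolding weil_plus_eq by blast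
      then show ?thesis
        using cvec.subspace_neg[OF sub] unfolding w cyc_diff_word_commutator by blast
    qed
  qed
  then show "Wn_map comult n cyc_diff ` carrier Q \<subseteq> V"
    by (auto simp: Wn_carrier Wn_map_cyc_diff)
qed

theorem Wn_exact:
  "exact_complexes
     (Wn_nat comult n) (descend (Wn_map comult n weil_N))
     (Wn_b comult n) (Wn_map comult n (\<lambda>x. weil_t x - x))
     (Wn comult n) (\<lambda>x. Wn_comm comult n +>\<^bsub>Wn comult n\<^esub> x) (Wn_nat comult n)"
proof -
  let ?\<pi> = "\<lambda>k. coset_map W K (deg_proj k)"
  have \<pi>: "deg_proj k ` K \<subseteq> K" for k
    by (rule curv_power_shape_preserved) (rule deg_proj_preserves)
  have K: "d ` K \<subseteq> K" "b ` K \<subseteq> K"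
    by (intro curv_power_preserved d.linear d.hom b_linear b_hom; assumption)+
  have "exact_complexes (quot_dg Q (Wn_comm comult n)) (descend (Wn_map comult n weil_N))
     (Q\<lparr>diff := Wn_map comult n b\<rparr>) (Wn_map comult n cyc_diff) Q
     (\<lambda>x. Wn_comm comult n +>\<^bsub>Q\<^esub> x) (quot_dg Q (Wn_comm comult n))"
  proof (rule exact_coinvariants[where \<pi> = ?\<pi>])
    show "graded_complex Q ?\<pi>"
      unfolding Wn_quot using K(1) \<pi>
      by (intro W.quot_graded_complex W_graded) (simp_all add: weil_dg_simps)
    \<comment> \<open>The complex with differential \<open>b\<close> is the quotient of
      \<open>W(H)\<close> taken with that differential; the cosets themselves do not depend on
      it.\<close>
    have "graded_complex (quot_dg (W\<lparr>diff := b\<rparr>) K) (\<lambda>k. coset_map (W\<lparr>diff := b\<rparr>) K (deg_proj k))"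
      using K(2) \<pi>
      by (intro Wb.quot_graded_complex W_b_graded) simp_all
    then show "graded_complex (Q\<lparr>diff := Wn_map comult n b\<rparr>) ?\<pi>"
      by (simp add: quot_dg_diff_update Wn_quot Wn_map_def[abs_def] coset_map_def[abs_def]
          a_r_coset_def[abs_def])
    show "linear_dg Q Q (Wn_map comult n cyc_diff)" "linear_dg Q Q (Wn_map comult n weil_N)"
      by (rule Wn_map_cyc_diff_linear, rule Wn_map_weil_N_linear)
    show "Wn_map comult n cyc_diff ` comp Q k \<subseteq> comp Q k" for k
    proof (rule image_subsetI)
      fix X assume "X \<in> comp Q k"
      then obtain x where x: "X = cls x" "x \<in> wspan (\<lambda>p q. q = k)" "x \<in> weil_plus"
        by (auto simp: Wn_comp)
      have "cls (cyc_diff x) \<in> comp Q k"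
        using x(2,3) unfolding Wn_comp weil_plus_eq by (intro imageI IntI cyc_diff_wspan)
      then show "Wn_map comult n cyc_diff X \<in> comp Q k" using x by (simp add: Wn_map_cyc_diff)
    qed
    show "Wn_map comult n weil_N ` comp Q k \<subseteq> comp Q k" for k
    proof (rule image_subsetI)
      fix X assume "X \<in> comp Q k"
      then obtain x where x: "X = cls x" "x \<in> wspan (\<lambda>p q. q = k)" "x \<in> weil_plus"
        by (auto simp: Wn_comp)
      have "cls (weil_N x) \<in> comp Q k"
        using x(2,3) unfolding Wn_comp weil_plus_eq by (intro imageI IntI weil_N_wspan)
      then show "Wn_map comult n weil_N X \<in> comp Q k" using x by (simp add: Wn_map_weil_N)
    qed
    show "Wn_comm comult n = Wn_map comult n cyc_diff ` carrier Q"
      by (rule Wn_comm_eq)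
    fix X assume "X \<in> carrier Q"
    then obtain x where x: "X = cls x" "x \<in> weil_plus" by (auto simp: Wn_carrier)
    have clos: "d x \<in> weil_plus" "b x \<in> weil_plus" "cyc_diff x \<in> weil_plus" "weil_N x \<in> weil_plus"
      "inv_len x \<in> weil_plus" "part_avg x \<in> weil_plus"
      using x(2) linear_dg_closed[OF W_d_linear(1), of x] linear_dg_closed[OF W_d_linear(2), of x]
        cyc_diff_wspan weil_N_wspan inv_len_wspan part_avg_wspan
      by (simp_all add: weil_dg_simps weil_plus_eq)
    have diffQ: "diff Q = Wn_map comult n d"
      by (simp add: Wn_quot quot_dg_def Wn_map_def[abs_def] weil_dg_simps)
    show "Wn_map comult n cyc_diff (Wn_map comult n b X) = diff Q (Wn_map comult n cyc_diff X)"
      using x clos by (simp add: diffQ Wn_map_b Wn_map_d Wn_map_cyc_diff cyc_diff_b)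
    show "Wn_map comult n b (Wn_map comult n weil_N X) = Wn_map comult n weil_N (diff Q X)"
      using x clos by (simp add: diffQ Wn_map_b Wn_map_d Wn_map_weil_N b_weil_N)
    show "Wn_map comult n cyc_diff X = \<zero>\<^bsub>Q\<^esub> \<longleftrightarrow> X \<in> Wn_map comult n weil_N ` carrier Q"
    proof
      assume "Wn_map comult n cyc_diff X = \<zero>\<^bsub>Q\<^esub>"
      then have "cyc_diff x \<in> K" using x clos by (simp add: Wn_map_cyc_diff Wn_zero cls_zero_iff)
      \<comment> \<open>A cycle condition in the quotient only places \<open>(t - 1) x\<close> in
        \<open>K\<close>. Since \<open>part_avg\<close> preserves \<open>K\<close>, the element
        \<open>x\<close> differs from a value of \<open>N\<close> by an element of
        \<open>K\<close>.\<close>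
      then have "part_avg (- cyc_diff x) \<in> K"
        unfolding curv_power_eq by (intro part_avg_wspan wspan_closed)
      moreover have "x - weil_N (inv_len x) = part_avg (- cyc_diff x)"
        using avg_decomposition_cyc_diff(1) x(2) unfolding weil_plus_eq
        by (metis add_diff_cancel_left')
      ultimately have "X = cls (weil_N (inv_len x))"
        using x clos weil_N_wspan[of "inv_len x" "\<lambda>p q. p \<noteq> 0"]
        by (simp add: cls_eq_iff weil_plus_eq)
      then show "X \<in> Wn_map comult n weil_N ` carrier Q"
        using clos by (auto simp: Wn_carrier Wn_map_weil_N image_image)
    next
      assume "X \<in> Wn_map comult n weil_N ` carrier Q"
      then obtain y where "y \<in> weil_plus" "X = cls (weil_N y)"
        by (auto simp: Wn_carrier Wn_map_weil_N)
      then show "Wn_map comult n cyc_diff X = \<zero>\<^bsub>Q\<^esub>"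
        using weil_N_wspan[of y "\<lambda>p q. p \<noteq> 0"]
        by (simp add: Wn_map_cyc_diff weil_plus_eq cyc_diff_weil_N Wn_zero)
    qed
    show "Wn_map comult n weil_N X = \<zero>\<^bsub>Q\<^esub> \<longleftrightarrow> X \<in> Wn_comm comult n"
      unfolding Wn_comm_eq
    proof
      assume "Wn_map comult n weil_N X = \<zero>\<^bsub>Q\<^esub>"
      then have "weil_N x \<in> K" using x clos by (simp add: Wn_map_weil_N Wn_zero cls_zero_iff)
      \<comment> \<open>The same argument with the second decomposition: \<open>inv_len\<close>
        preserves \<open>K\<close>, so \<open>x\<close> agrees modulo \<open>K\<close> with a value
        of \<open>t - 1\<close>.\<close>
      then have "inv_len (weil_N x) \<in> K"
        unfolding curv_power_eq by (rule inv_len_wspan)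
      moreover have pa: "- part_avg x \<in> weil_plus" using clos unfolding weil_plus_eq by (intro wspan_closed)
      moreover from this have "cyc_diff (- part_avg x) \<in> weil_plus"
        unfolding weil_plus_eq by (rule cyc_diff_wspan)
      moreover have "x - cyc_diff (- part_avg x) = inv_len (weil_N x)"
        using avg_decomposition_cyc_diff(2) x(2) unfolding weil_plus_eq
        by (metis add_diff_cancel_right')
      ultimately have "X = cls (cyc_diff (- part_avg x))"
        using x by (simp add: cls_eq_iff)
      also have "\<dots> = Wn_map comult n cyc_diff (cls (- part_avg x))"
        using pa by (simp add: Wn_map_cyc_diff)
      finally show "X \<in> Wn_map comult n cyc_diff ` carrier Q"
        using pa by (auto simp: Wn_carrier)
    next
      assume "X \<in> Wn_map comult n cyc_diff ` carrier Q"
      then obtain y where "y \<in> weil_plus" "X = cls (cyc_diff y)"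
        by (auto simp: Wn_carrier Wn_map_cyc_diff)
      then show "Wn_map comult n weil_N X = \<zero>\<^bsub>Q\<^esub>"
        using cyc_diff_wspan[of y "\<lambda>p q. p \<noteq> 0"]
        by (simp add: Wn_map_weil_N weil_plus_eq weil_N_cyc_diff Wn_zero)
    qed
  qed
  then show ?thesis by (simp add: Wn_nat_def Wn_b_def cyc_diff_def[abs_def])
qed

end
end

theorem corollary6p10:
  fixes \<Delta> :: "'h::complex_vector \<Rightarrow> ('h, 'h) tensor"
    and \<epsilon> :: "'h \<Rightarrow> complex"
    and n :: nat
  assumes "coalgebra \<Delta> \<epsilon>"
  shows
    "exact_complexes
       (Wn_nat \<Delta> n) (descend (Wn_map \<Delta> n weil_N))
       (Wn_b \<Delta> n) (Wn_map \<Delta> n (\<lambda>x. weil_t x - x))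
       (Wn \<Delta> n) (\<lambda>x. Wn_comm \<Delta> n +>\<^bsub>Wn \<Delta> n\<^esub> x)
       (Wn_nat \<Delta> n) \<and>
     exact_complexes
       (In_nat \<Delta> n) (descend weil_N)
       (In_b \<Delta> n) (\<lambda>x. weil_t x - x)
       (In \<Delta> n) (\<lambda>x. In_comm \<Delta> n +>\<^bsub>In \<Delta> n\<^esub> x)
       (In_nat \<Delta> n)"
  using coalgebra.Wn_exact[OF assms] coalgebra.In_exact[OF assms] by blast

end
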